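(* Let $X$ and $Y$ be uniformly discrete metric spaces of bounded geometry, let $T=\gamma D(X,Y)$, and let the continuous fields of $C^*$-algebras $\mathcal A=(T,A,\{A_t\}_{t\in T},\{p_t\}_{t\in T})$, $\mathcal B=(T,B,\{B_t\}_{t\in T},\{q_t\}_{t\in T})$ with $A_t=C^*_u(Y,d^l)$ and $B_t=C^*_u(X,d^r)$ for $t=[d]\in D(X,Y)$, and the data $M$, $\{M_t\}_{t\in T}$, $\{\pi_t\}_{t\in T}$ with $M_t=M_{[d]}$ for $t=[d]\in D(X,Y)$, be as constructed in the context. Then $\mathcal M=(T,M,\{M_t\}_{t\in T},\{\pi_t\}_{t\in T})$ is a continuous field of Hilbert $\mathcal A$-$\mathcal B$-$C^*$-bimodules.
   Context: Spaces: $X$ is uniformly discrete if $\inf_{x\ne x'}d_X(x,x')>0$; it has bounded geometry if for every $R>0$ there is $C>0$ such that every ball of radius $R$ has at most $C$ points. Metrics: $\mathcal D(X,Y)$ is the set of metrics $d$ on $X\sqcup Y$ with $d|_X=d_X$, $d|_Y=d_Y$ and $\inf_{x\in X,y\in Y}d(x,y)>0$. Metrics $d_1,d_2\in\mathcal D(X,Y)$ are coarsely equivalent if there is a homeomorphism $\phi$ of $[0,\infty)$ with $\phi^{-1}(d_1(x,y))\le d_2(x,y)\le\phi(d_1(x,y))$ for all $x\in X,y\in Y$. $D(X,Y)$ is the set of coarse equivalence classes $[d]$, partially ordered by: $[d_1]\le[d_2]$ if there is a homeomorphism $\phi$ of $[0,\infty)$ with $d_2(x,y)\le\phi(d_1(x,y))$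 for all $x\in X$, $y\in Y$. It has a smallest element, the class of $d(x,y)=d_X(x,x_0)+1+d_Y(y_0,y)$ for fixed $x_0\in X,y_0\in Y$. Operators: $H_X=l_2(X)$, $H_Y=l_2(Y)$ with bases $\delta_x$, $\delta_y$. A bounded $S:H_X\to H_Y$ has propagation $\le L$ with respect to $d$ if $S_{yx}=\langle\delta_y,S\delta_x\rangle\ne0$ implies $d(x,y)\le L$. $M_{[d]}\subset\mathbb B(H_X,H_Y)$ is the norm closure of the set of operators of finite propagation; it depends only on $[d]$, is a ternary ring of operators (TRO: a closed linear subspace $N$ with $NN^*N\subset N$), and $[d_1]\le[d_2]$ implies $M_{[d_1]}\subset M_{[d_2]}$. For $d\in\mathcal D(X,Y)$ put $d^r(x_1,x_2)=\inf_{u\in Y}(d(x_1,u)+d(x_2,u))$ if $x_1\ne x_2$ and $0$ if $x_1=x_2$; $d^l(y_1,y_2)=\inf_{u\in X}(d(u,y_1)+d(u,y_2))$ if $y_1\ne y_2$ and $0$ if $y_1=y_2$. These are metrics on $X$ and $Y$. $C^*_u(X,d')$ denotes the uniform Roe algebra of $X$ with respect to a metric $d'$, i.e. the norm closure in $\mathbb B(H_X)$ of the operators of finite propagation with respect to $d'$; similarly for $Y$. If $[d_1]\le[d_2]$ then $C^*_u(X,d_1^r)\subset C^*_u(X,d_2^r)$ and $C^*_u(Y,d_1^l)\subset C^*_u(Y,d_2^l)$. Topology and compactification of a poset $P$ (applied to $P=D(X,Y)$): for $a\in P$ put $U_a=\{b\in P:a\le b\}$, $V_a=P\setminus U_a$;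 $P$ has the topology with subbase $\{U_a,V_a:a\in P\}$. $C_b(P,E)$ is the space of bounded continuous maps from $P$ to $E$, $C_b(P)=C_b(P,\mathbb C)$. Let $\chi_a,\chi'_a$ be the characteristic functions of $U_a,V_a$ and $C\subset C_b(P)$ the $C^*$-subalgebra generated by them. $\gamma P$ is the compact Hausdorff Gelfand spectrum of $C$, so $C=C(\gamma P)$, and $P$ is dense in $\gamma P$. Construction of the data over $T=\gamma P$, $P=D(X,Y)$: for $a\in P$, $s\in M_a$, let $\chi_{s,a}(b)=s$ if $a\le b$ and $0$ otherwise. $M$ is the smallest norm closed linear subspace of $C_b(P,\mathbb B(H_X,H_Y))$ that contains all $\chi_{s,a}$ and is closed under pointwise ternary products $(m,n,r)\mapsto mn^*r$ and under multiplication by bounded continuous functions on $P$. Each $m\in M$ extends by continuity to a map $\widetilde m$ on $\gamma P$; $\pi_t(m)=\widetilde m(t)$ and $M_t$ is the range of $\pi_t$. Similarly, $A$ is the $C^*$-subalgebra of $C_b(P,\mathbb B(H_Y))$ generated by the maps $b\mapsto\chi_{[d]}(b)a$, $[d]\in P$, $a\in C^*_u(Y,d^l)$; its elements extend continuously to $\gamma P$, $p_t$ is evaluation at $t$ and $A_t$ is its range. $B$, $q_t$, $B_t$ are defined in the same way from the algebras $C^*_u(X,d^r)\subset\mathbb B(H_X)$. Inner products are ${}_A\langle m,n\rangle=mn^*$, $\langle m,n\rangle_B=m^*n$, and likewise on fibres. Continuous fields: for a family of normed spaces, $\prod_{t\in T}A_t$ is the set of bounded families. $(T,A,\{A_t\},\{p_t\})$,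 with $T$ compact Hausdorff, $A$, $A_t$ $C^*$-algebras, $A\subset\prod_tA_t$ and canonical projections $p_t$, is a continuous field of $C^*$-algebras if all $p_t$ are surjective, $C(T)$ acts on $A$ with $p_t(fa)=f(t)p_t(a)$, and $t\mapsto\|p_t(a)\|$ is continuous for all $a\in A$. A continuous field of Hilbert $\mathcal A$-$\mathcal B$-$C^*$-bimodules is a quadruple $(T,M,\{M_t\},\{\pi_t\})$ where $M$ is a Hilbert $A$-$B$-$C^*$-bimodule, each $M_t$ is a Hilbert $A_t$-$B_t$-$C^*$-bimodule, $M\subset\prod_tM_t$, $C(T)$ acts on $M$ with $\pi_t(fm)=f(t)\pi_t(m)$, the canonical projections $\pi_t:M\to M_t$ are surjective, $\pi_t(am)=p_t(a)\pi_t(m)$, $\pi_t(mb)=\pi_t(m)q_t(b)$, $p_t({}_A\langle m,n\rangle)={}_{A_t}\langle\pi_t(m),\pi_t(n)\rangle$ and $q_t(\langle m,n\rangle_B)=\langle\pi_t(m),\pi_t(n)\rangle_{B_t}$ for all $a\in A$, $b\in B$, $m,n\in M$, $t\in T$.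
   Formalization: M is closed under multiplication by the functions in C = C(γP), not by all bounded continuous functions on P = D(X,Y): some of the latter do not extend to γP, so with them the elements of M could not be evaluated on γP. *)

theory Defs
  imports "HOL-Analysis.Analysis"
begin

section \<open>The Hilbert space of square-summable functions\<close>

typedef 'a ell2 = "{f :: 'a \<Rightarrow> complex. (\<lambda>x. (cmod (f x))\<^sup>2) summable_on UNIV}"
  morphisms ell2_fun Abs_ell2
  by (intro exI[of _ "\<lambda>_. 0"]) simp

setup_lifting type_definition_ell2

lemma ell2_sq_summable: "(\<lambda>x. (cmod (ell2_fun f x))\<^sup>2) summable_on UNIV"
  using ell2_fun[of f] by simp

lemma ell2_add_closed:
  fixes f g :: "'a \<Rightarrow> complex"
  assumes "(\<lambda>x. (cmod (f x))\<^sup>2) summable_on UNIV" "(\<lambda>x. (cmod (g x))\<^sup>2) summable_on UNIV"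
  shows "(\<lambda>x. (cmod (f x + g x))\<^sup>2) summable_on UNIV"
proof (rule summable_on_comparison_test)
  show "(\<lambda>x. 2 * (cmod (f x))\<^sup>2 + 2 * (cmod (g x))\<^sup>2) summable_on UNIV"
    by (intro summable_on_add summable_on_cmult_right assms)
  show "(cmod (f x + g x))\<^sup>2 \<le> 2 * (cmod (f x))\<^sup>2 + 2 * (cmod (g x))\<^sup>2" for x
  proof -
    have "(cmod (f x + g x))\<^sup>2 \<le> (cmod (f x) + cmod (g x))\<^sup>2"
      by (intro power_mono norm_triangle_ineq) auto
    also have "\<dots> \<le> 2 * (cmod (f x))\<^sup>2 + 2 * (cmod (g x))\<^sup>2"
      using sum_squares_bound[of "cmod (f x)" "cmod (g x)"] by (simp add: power2_sum)
    finally show ?thesis .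
  qed
qed auto

lemma ell2_scale_closed:
  fixes f :: "'a \<Rightarrow> complex"
  assumes "(\<lambda>x. (cmod (f x))\<^sup>2) summable_on UNIV"
  shows "(\<lambda>x. (cmod (c * f x))\<^sup>2) summable_on UNIV"
  using summable_on_cmult_right[OF assms, of "(cmod c)\<^sup>2"]
  by (simp add: norm_mult power_mult_distrib)

lemma ell2_prod_summable: "(\<lambda>x. cnj (ell2_fun f x) * ell2_fun g x) summable_on UNIV"
proof (rule Infinite_Sum.abs_summable_summable, rule Infinite_Sum.abs_summable_on_comparison_test')
  show "(\<lambda>x. (cmod (ell2_fun f x))\<^sup>2 + (cmod (ell2_fun g x))\<^sup>2) summable_on UNIV"
    by (intro summable_on_add ell2_sq_summable)
  show "cmod (cnj (ell2_fun f x) * ell2_fun g x)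
      \<le> (cmod (ell2_fun f x))\<^sup>2 + (cmod (ell2_fun g x))\<^sup>2" for x
  proof -
    have "0 \<le> cmod (ell2_fun f x) * cmod (ell2_fun g x)" by (rule mult_nonneg_nonneg) auto
    moreover have "2 * (cmod (ell2_fun f x) * cmod (ell2_fun g x))
        \<le> (cmod (ell2_fun f x))\<^sup>2 + (cmod (ell2_fun g x))\<^sup>2"
      using sum_squares_bound[of "cmod (ell2_fun f x)" "cmod (ell2_fun g x)"] by (simp only: mult.assoc)
    ultimately have "cmod (ell2_fun f x) * cmod (ell2_fun g x)
        \<le> (cmod (ell2_fun f x))\<^sup>2 + (cmod (ell2_fun g x))\<^sup>2" by linarith
    then show ?thesis by (simp only: norm_mult complex_mod_cnj)
  qed
qed

text \<open>Linear in the second argument, so that \<open>cinner (delta y) (S (delta x))\<close> is the matrix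
  entry of \<open>S\<close>.\<close>

definition cinner :: "'a ell2 \<Rightarrow> 'a ell2 \<Rightarrow> complex" where
  "cinner f g = (\<Sum>\<^sub>\<infinity>x. cnj (ell2_fun f x) * ell2_fun g x)"

lift_definition cscale_ell2 :: "complex \<Rightarrow> 'a ell2 \<Rightarrow> 'a ell2" is "\<lambda>c f x. c * f x"
  by (rule ell2_scale_closed)

lift_definition delta :: "'a \<Rightarrow> 'a ell2" is "\<lambda>x z. if z = x then 1 else 0"
proof -
  fix x :: 'a
  have "(\<lambda>z. (cmod (if z = x then 1 else 0))\<^sup>2) summable_on {x}" by simp
  then show "(\<lambda>z. (cmod (if z = x then 1 else 0))\<^sup>2) summable_on UNIV"
    by (rule summable_on_cong_neutral[THEN iffD1, rotated -1]) auto
qed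

instantiation ell2 :: (type) real_inner
begin

lift_definition zero_ell2 :: "'a ell2" is "\<lambda>_. 0" by simp
lift_definition plus_ell2 :: "'a ell2 \<Rightarrow> 'a ell2 \<Rightarrow> 'a ell2" is "\<lambda>f g x. f x + g x"
  by (rule ell2_add_closed)
lift_definition uminus_ell2 :: "'a ell2 \<Rightarrow> 'a ell2" is "\<lambda>f x. - f x" by simp
definition minus_ell2 :: "'a ell2 \<Rightarrow> 'a ell2 \<Rightarrow> 'a ell2" where "f - g = f + - g" for f g :: "'a ell2"
lift_definition scaleR_ell2 :: "real \<Rightarrow> 'a ell2 \<Rightarrow> 'a ell2" is "\<lambda>r f x. complex_of_real r * f x"
  by (rule ell2_scale_closed)
definition inner_ell2 :: "'a ell2 \<Rightarrow> 'a ell2 \<Rightarrow> real" where "inner_ell2 f g = Re (cinner f g)"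
definition norm_ell2 :: "'a ell2 \<Rightarrow> real" where "norm_ell2 f = sqrt (inner f f)"
definition sgn_ell2 :: "'a ell2 \<Rightarrow> 'a ell2" where "sgn_ell2 f = scaleR (inverse (norm f)) f"
definition dist_ell2 :: "'a ell2 \<Rightarrow> 'a ell2 \<Rightarrow> real" where "dist_ell2 f g = norm (f - g)"
definition uniformity_ell2 :: "('a ell2 \<times> 'a ell2) filter" where
  "uniformity_ell2 = (INF e\<in>{0<..}. principal {(x, y). dist x y < e})"
definition open_ell2 :: "'a ell2 set \<Rightarrow> bool" where
  "open_ell2 U = (\<forall>x\<in>U. eventually (\<lambda>(x', y). x' = x \<longrightarrow> y \<in> U) uniformity)"

instance
proof
  fix f g h :: "'a ell2" and r s :: real and U :: "'a ell2 set"
  show "f + g + h = f + (g + h)" "f + g = g + f" "0 + f = f" "- f + f = 0"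
    by (transfer, force)+
  show "f - g = f + - g" by (rule minus_ell2_def)
  show "r *\<^sub>R (f + g) = r *\<^sub>R f + r *\<^sub>R g" "(r + s) *\<^sub>R f = r *\<^sub>R f + s *\<^sub>R f"
    "r *\<^sub>R s *\<^sub>R f = (r * s) *\<^sub>R f" "1 *\<^sub>R f = f"
    by (transfer, force simp: algebra_simps)+
  show "sgn f = scaleR (inverse (norm f)) f" by (rule sgn_ell2_def)
  show "dist f g = norm (f - g)" by (rule dist_ell2_def)
  show "uniformity = (INF e\<in>{0<..}. principal {(x, y :: 'a ell2). dist x y < e})"
    by (rule uniformity_ell2_def)
  show "open U = (\<forall>x\<in>U. \<forall>\<^sub>F (x', y) in uniformity. x' = x \<longrightarrow> y \<in> U)"
    by (rule open_ell2_def)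
  show "norm f = sqrt (inner f f)" by (rule norm_ell2_def)
  have "cinner f g = cnj (cinner g f)"
    unfolding cinner_def by (subst infsum_cnj[symmetric]) (simp add: mult.commute)
  then show "inner f g = inner g f" by (simp add: inner_ell2_def)
  have "cinner (f + g) h = cinner f h + cinner g h"
    using infsum_add[OF ell2_prod_summable[of f h] ell2_prod_summable[of g h]]
    by (simp add: cinner_def plus_ell2.rep_eq algebra_simps)
  then show "inner (f + g) h = inner f h + inner g h" by (simp add: inner_ell2_def)
  have "cinner (r *\<^sub>R f) g = complex_of_real r * cinner f g"
    by (simp add: cinner_def scaleR_ell2.rep_eq mult.assoc infsum_cmult_right')
  then show "inner (r *\<^sub>R f) g = r * inner f g" by (simp add: inner_ell2_def)
  have eq: "inner f f = (\<Sum>\<^sub>\<infinity>x. (cmod (ell2_fun f x))\<^sup>2)"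
  proof -
    have "inner f f = (\<Sum>\<^sub>\<infinity>x. Re (cnj (ell2_fun f x) * ell2_fun f x))"
      by (simp only: inner_ell2_def cinner_def infsum_Re[OF ell2_prod_summable])
    also have "\<dots> = (\<Sum>\<^sub>\<infinity>x. (cmod (ell2_fun f x))\<^sup>2)"
      by (intro infsum_cong) (metis Re_complex_of_real complex_norm_square mult.commute)
    finally show ?thesis .
  qed
  show "0 \<le> inner f f" unfolding eq by (rule infsum_nonneg) simp
  show "inner f f = 0 \<longleftrightarrow> f = 0"
  proof
    assume "inner f f = 0"
    then have "(cmod (ell2_fun f x))\<^sup>2 = 0" for x
      using nonneg_infsum_le_0D[OF _ ell2_sq_summable[of f], of x] eq by simp
    then show "f = 0" by (intro ell2_fun_inject[THEN iffD1]) (simp add: zero_ell2.rep_eq fun_eq_iff)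
  next
    assume "f = 0"
    then show "inner f f = 0" unfolding eq by (simp add: zero_ell2.rep_eq)
  qed
qed

end


section \<open>Operators\<close>

text \<open>The library type \<open>'a ell2 \<Rightarrow>\<^sub>L 'b ell2\<close> consists of the bounded \<^emph>\<open>real\<close>-linear maps, with the
  operator norm.  The space of bounded operators of the theory is its subset \<open>bounded_ops\<close>.\<close>

definition bounded_ops :: "('a ell2 \<Rightarrow>\<^sub>L 'b ell2) set" where
  "bounded_ops = {S. \<forall>c v. blinfun_apply S (cscale_ell2 c v) = cscale_ell2 c (blinfun_apply S v)}"

lemma inner_cscale_ell2:
  "inner (cscale_ell2 c f) (cscale_ell2 c f) = (cmod c)\<^sup>2 * inner f f"
proof -
  have "cinner (cscale_ell2 c f) (cscale_ell2 c f) = (cnj c * c) * cinner f f"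
    unfolding cinner_def cscale_ell2.rep_eq
    by (subst infsum_cmult_right'[symmetric]) (simp add: ac_simps)
  also have "cnj c * c = complex_of_real ((cmod c)\<^sup>2)"
    by (metis complex_norm_square mult.commute)
  finally show ?thesis unfolding inner_ell2_def by simp
qed

lemma norm_cscale_ell2: "norm (cscale_ell2 c f) = cmod c * norm f"
  by (simp add: norm_eq_sqrt_inner inner_cscale_ell2 real_sqrt_mult)

lemma bounded_linear_cscale_ell2: "bounded_linear (cscale_ell2 c)"
proof (rule bounded_linear_intro[where K = "cmod c"])
  show "cscale_ell2 c (x + y) = cscale_ell2 c x + cscale_ell2 c y" for x y
    by transfer (simp add: algebra_simps)
  show "cscale_ell2 c (r *\<^sub>R x) = r *\<^sub>R cscale_ell2 c x" for r x
    by transfer (simp add: algebra_simps)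
  show "norm (cscale_ell2 c x) \<le> norm x * cmod c" for x
    by (simp add: norm_cscale_ell2)
qed

definition cscale_op :: "complex \<Rightarrow> ('a ell2 \<Rightarrow>\<^sub>L 'b ell2) \<Rightarrow> ('a ell2 \<Rightarrow>\<^sub>L 'b ell2)" where
  "cscale_op c S = Blinfun (\<lambda>v. cscale_ell2 c (blinfun_apply S v))"

lemma cscale_op_apply: "blinfun_apply (cscale_op c S) v = cscale_ell2 c (blinfun_apply S v)"
  unfolding cscale_op_def
  by (subst bounded_linear_Blinfun_apply)
    (simp_all add: bounded_linear_compose[OF bounded_linear_cscale_ell2] blinfun.bounded_linear_right)

text \<open>The Hilbert space adjoint; unspecified outside \<open>bounded_ops\<close>.\<close>

definition adj :: "('a ell2 \<Rightarrow>\<^sub>L 'b ell2) \<Rightarrow> ('b ell2 \<Rightarrow>\<^sub>L 'a ell2)" where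
  "adj S = (THE S'. \<forall>u v. cinner (blinfun_apply S' v) u = cinner v (blinfun_apply S u))"

definition propagation_le :: "('a \<Rightarrow> 'b \<Rightarrow> real) \<Rightarrow> ('a ell2 \<Rightarrow>\<^sub>L 'b ell2) \<Rightarrow> real \<Rightarrow> bool" where
  "propagation_le d S L \<longleftrightarrow>
     (\<forall>x y. cinner (delta y) (blinfun_apply S (delta x)) \<noteq> 0 \<longrightarrow> d x y \<le> L)"

definition roe_closure :: "('a \<Rightarrow> 'b \<Rightarrow> real) \<Rightarrow> ('a ell2 \<Rightarrow>\<^sub>L 'b ell2) set" where
  "roe_closure d = closure {S \<in> bounded_ops. \<exists>L. propagation_le d S L}"


section \<open>Metrics on the disjoint union and their coarse classes\<close>

definition bounded_geometry :: "'a::metric_space set \<Rightarrow> bool" where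
  "bounded_geometry X \<longleftrightarrow>
     (\<forall>R>0. \<exists>C::nat. \<forall>x\<in>X. finite (cball x R \<inter> X) \<and> card (cball x R \<inter> X) \<le> C)"

definition union_metrics :: "('x::metric_space + 'y::metric_space \<Rightarrow> 'x + 'y \<Rightarrow> real) set" where
  "union_metrics = {d. Metric_space UNIV d
     \<and> (\<forall>x x'. d (Inl x) (Inl x') = dist x x') \<and> (\<forall>y y'. d (Inr y) (Inr y') = dist y y')
     \<and> (\<exists>c>0. \<forall>x y. c \<le> d (Inl x) (Inr y))}"

definition coarse_equiv :: "('x + 'y \<Rightarrow> 'x + 'y \<Rightarrow> real) \<Rightarrow> ('x + 'y \<Rightarrow> 'x + 'y \<Rightarrow> real) \<Rightarrow> bool" where
  "coarse_equiv d1 d2 \<longleftrightarrow> (\<exists>\<phi> \<phi>'. homeomorphism {0::real..} {0..} \<phi> \<phi>' \<and>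
     (\<forall>x y. \<phi>' (d1 (Inl x) (Inr y)) \<le> d2 (Inl x) (Inr y) \<and>
            d2 (Inl x) (Inr y) \<le> \<phi> (d1 (Inl x) (Inr y))))"

definition coarse_le :: "('x + 'y \<Rightarrow> 'x + 'y \<Rightarrow> real) \<Rightarrow> ('x + 'y \<Rightarrow> 'x + 'y \<Rightarrow> real) \<Rightarrow> bool" where
  "coarse_le d1 d2 \<longleftrightarrow> (\<exists>\<phi> \<phi>'. homeomorphism {0::real..} {0..} \<phi> \<phi>' \<and>
     (\<forall>x y. d2 (Inl x) (Inr y) \<le> \<phi> (d1 (Inl x) (Inr y))))"

lemma homeomorphism_halflineD:
  fixes \<phi> \<phi>' :: "real \<Rightarrow> real"
  assumes h: "homeomorphism {0..} {0..} \<phi> \<phi>'" and t: "t \<ge> 0"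
  shows "\<phi> t \<ge> 0" "\<phi>' t \<ge> 0" "\<phi>' (\<phi> t) = t" "\<phi> (\<phi>' t) = t"
proof -
  have t': "t \<in> {0..}" using t by simp
  show "\<phi> t \<ge> 0" using imageI[OF t', of \<phi>] homeomorphism_image1[OF h] by simp
  show "\<phi>' t \<ge> 0" using imageI[OF t', of \<phi>'] homeomorphism_image2[OF h] by simp
  show "\<phi>' (\<phi> t) = t" by (rule homeomorphism_apply1[OF h t'])
  show "\<phi> (\<phi>' t) = t" by (rule homeomorphism_apply2[OF h t'])
qed

lemma homeomorphism_halfline_mono:
  fixes \<phi> \<phi>' :: "real \<Rightarrow> real"
  assumes h: "homeomorphism {0..} {0..} \<phi> \<phi>'"
  shows "strict_mono_on {0..} \<phi>"
proof -
  have im: "\<phi> ` {0..} = {0..}" and c: "continuous_on {0..} \<phi>"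
    by (rule homeomorphism_image1[OF h], rule homeomorphism_cont1[OF h])
  note nn = homeomorphism_halflineD(1)[OF h] and inv = homeomorphism_halflineD(3)[OF h]
  have inj: "inj_on \<phi> {0..}" by (metis inj_onI atLeast_iff inv)
  have less: "\<phi> x < \<phi> y" if xy: "0 \<le> x" "x < y" for x y
  proof (rule ccontr)
    assume "\<not> \<phi> x < \<phi> y"
    moreover have "\<phi> x \<noteq> \<phi> y" using inj_onD[OF inj, of x y] that by auto
    ultimately have lt: "\<phi> y < \<phi> x" by simp
    have ab: "bdd_above (\<phi> ` {0..y})"
      by (intro bounded_imp_bdd_above compact_imp_bounded compact_continuous_image)
         (auto intro: continuous_on_subset[OF c])
    then obtain B where "\<forall>t\<in>{0..y}. \<phi> t \<le> B" by (auto simp: bdd_above_def)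
    then have B: "\<And>t. 0 \<le> t \<Longrightarrow> t \<le> y \<Longrightarrow> \<phi> t \<le> B" by simp
    obtain z where z: "z \<ge> 0" "\<phi> z = max B (\<phi> x) + 1"
    proof -
      have "max B (\<phi> x) + 1 \<in> \<phi> ` {0..}" using im nn[OF xy(1)] by simp
      then show ?thesis using that by fastforce
    qed
    have "z > y" using B[of z] z by (cases "z \<le> y") auto
    have cyz: "continuous_on {y..z} \<phi>" using c xy by (rule_tac continuous_on_subset) auto
    have "\<phi> y \<le> \<phi> x" "\<phi> x \<le> \<phi> z" "y \<le> z" using lt z(2) \<open>z > y\<close> by linarith+
    then obtain w where w: "y \<le> w" "w \<le> z" "\<phi> w = \<phi> x"
      using IVT'[OF _ _ _ cyz] by blast
    have "w = x" using inj_onD[OF inj w(3)] w(1) that by simp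
    then show False using w(1) that by simp
  qed
  then show ?thesis by (auto intro!: strict_mono_onI)
qed

lemma homeomorphism_halfline_add:
  fixes \<phi> \<psi> :: "real \<Rightarrow> real"
  assumes h: "homeomorphism {0..} {0..} \<phi> \<phi>'" "homeomorphism {0..} {0..} \<psi> \<psi>'"
  shows "\<exists>\<theta>'. homeomorphism {0..} {0..} (\<lambda>t. \<phi> t + \<psi> t) \<theta>'"
proof (rule homeomorphism_into_1d)
  have im: "\<phi> ` {0..} = {0..}" "\<psi> ` {0..} = {0..}"
    and c: "continuous_on {0..} \<phi>" "continuous_on {0..} \<psi>"
    using h by (simp_all add: homeomorphism_def)
  have nn: "\<phi> x \<ge> 0" "\<psi> x \<ge> 0" if "x \<ge> 0" for x
    by (rule homeomorphism_halflineD(1)[OF h(1) that], rule homeomorphism_halflineD(1)[OF h(2) that])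
  have sm: "strict_mono_on {0..} \<phi>" "strict_mono_on {0..} \<psi>"
    using h homeomorphism_halfline_mono by blast+
  have z: "f 0 = 0" if "f ` {0..} = {0..}" "strict_mono_on {0..} f" for f :: "real \<Rightarrow> real"
  proof -
    have "0 \<in> f ` {0..}" unfolding that(1) by simp
    then obtain t where t: "t \<ge> 0" "f t = 0" by force
    have "f 0 \<ge> 0" using that(1) imageI[of 0 "{0..}" f] by simp
    then show ?thesis using strict_mono_onD[OF that(2), of 0 t] t by (cases "t = 0") auto
  qed
  show "path_connected {0::real..}" by (intro convex_imp_path_connected) simp
  show cs: "continuous_on {0..} (\<lambda>t. \<phi> t + \<psi> t)" by (intro continuous_intros c)
  show "inj_on (\<lambda>t. \<phi> t + \<psi> t) {0..}"
  proof (rule linorder_inj_onI)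
    show "\<phi> x + \<psi> x \<noteq> \<phi> y + \<psi> y" if "x < y" "x \<in> {0..}" "y \<in> {0..}" for x y
      using strict_mono_onD[OF sm(1), of x y] strict_mono_onD[OF sm(2), of x y] that by auto
  qed auto
  show "(\<lambda>t. \<phi> t + \<psi> t) ` {0..} = {0..}"
  proof (intro equalityI subsetI)
    fix s :: real assume s: "s \<in> {0..}"
    have "s \<in> \<phi> ` {0..}" unfolding im(1) by (rule s)
    then obtain t where t: "t \<ge> 0" "\<phi> t = s" by force
    have "continuous_on {0..t} (\<lambda>t. \<phi> t + \<psi> t)" by (rule continuous_on_subset[OF cs]) auto
    moreover have "\<phi> 0 + \<psi> 0 \<le> s" using z[OF im(1) sm(1)] z[OF im(2) sm(2)] s by simp
    moreover have "s \<le> \<phi> t + \<psi> t" using t nn(2)[OF t(1)] by simp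
    ultimately have "\<exists>u\<ge>0. u \<le> t \<and> \<phi> u + \<psi> u = s"
      using IVT'[of "\<lambda>t. \<phi> t + \<psi> t" 0 s t] t(1) by blast
    then show "s \<in> (\<lambda>t. \<phi> t + \<psi> t) ` {0..}" by force
  next
    fix s assume "s \<in> (\<lambda>t. \<phi> t + \<psi> t) ` {0..}"
    then obtain t where t: "t \<ge> 0" "s = \<phi> t + \<psi> t" by force
    then show "s \<in> {0..}" using nn(1)[OF t(1)] nn(2)[OF t(1)] by simp
  qed
qed

lemma union_metricsD: "d \<in> union_metrics \<Longrightarrow> d (Inl x) (Inr y) \<ge> 0"
  unfolding union_metrics_def by (drule CollectD, elim conjE, rule Metric_space.nonneg)

lemma coarse_le_refl: "coarse_le d d"
proof -
  have "homeomorphism {0::real..} {0..} (\<lambda>x. x) (\<lambda>x. x)" by (simp add: homeomorphism_def)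
  then show ?thesis unfolding coarse_le_def by blast
qed

lemma coarse_le_trans:
  assumes d: "d1 \<in> union_metrics" "d2 \<in> union_metrics"
    and "coarse_le d1 d2" "coarse_le d2 d3"
  shows "coarse_le d1 d3"
proof -
  obtain \<phi> \<phi>' \<psi> \<psi>' where h: "homeomorphism {0::real..} {0..} \<phi> \<phi>'" "homeomorphism {0::real..} {0..} \<psi> \<psi>'"
    and le: "\<And>x y. d2 (Inl x) (Inr y) \<le> \<phi> (d1 (Inl x) (Inr y))"
      "\<And>x y. d3 (Inl x) (Inr y) \<le> \<psi> (d2 (Inl x) (Inr y))"
    using assms(3,4) unfolding coarse_le_def by blast
  have nn: "\<phi> t \<ge> 0" if "t \<ge> 0" for t by (rule homeomorphism_halflineD(1)[OF h(1) that])
  have "d3 (Inl x) (Inr y) \<le> \<psi> (\<phi> (d1 (Inl x) (Inr y)))" for x y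
  proof -
    have "\<psi> (d2 (Inl x) (Inr y)) \<le> \<psi> (\<phi> (d1 (Inl x) (Inr y)))"
      by (rule strict_mono_on_leD[OF homeomorphism_halfline_mono[OF h(2)] _ _ le(1)])
        (simp_all add: union_metricsD d nn)
    then show ?thesis using le(2)[of x y] by simp
  qed
  then show ?thesis
    unfolding coarse_le_def using homeomorphism_compose[OF h]
    by (intro exI conjI) (assumption, simp)
qed

lemma coarse_equiv_iff:
  assumes d: "d1 \<in> union_metrics" "d2 \<in> union_metrics"
  shows "coarse_equiv d1 d2 \<longleftrightarrow> coarse_le d1 d2 \<and> coarse_le d2 d1"
proof
  assume "coarse_equiv d1 d2"
  then obtain \<phi> \<phi>' where h: "homeomorphism {0::real..} {0..} \<phi> \<phi>'"
    and le: "\<And>x y. \<phi>' (d1 (Inl x) (Inr y)) \<le> d2 (Inl x) (Inr y)"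
      "\<And>x y. d2 (Inl x) (Inr y) \<le> \<phi> (d1 (Inl x) (Inr y))"
    unfolding coarse_equiv_def by blast
  have "d1 (Inl x) (Inr y) \<le> \<phi> (d2 (Inl x) (Inr y))" for x y
  proof -
    have "\<phi>' (d1 (Inl x) (Inr y)) \<ge> 0" "\<phi> (\<phi>' (d1 (Inl x) (Inr y))) = d1 (Inl x) (Inr y)"
      by (rule homeomorphism_halflineD[OF h union_metricsD[OF d(1)]])+
    then show ?thesis
      using strict_mono_on_leD[OF homeomorphism_halfline_mono[OF h], of
          "\<phi>' (d1 (Inl x) (Inr y))" "d2 (Inl x) (Inr y)"] le(1)[of x y] union_metricsD[OF d(2), of x y]
      by simp
  qed
  then show "coarse_le d1 d2 \<and> coarse_le d2 d1" unfolding coarse_le_def using h le by blast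
next
  assume "coarse_le d1 d2 \<and> coarse_le d2 d1"
  then obtain \<phi> \<phi>' \<psi> \<psi>' where h: "homeomorphism {0::real..} {0..} \<phi> \<phi>'" "homeomorphism {0::real..} {0..} \<psi> \<psi>'"
    and le: "\<And>x y. d2 (Inl x) (Inr y) \<le> \<phi> (d1 (Inl x) (Inr y))"
      "\<And>x y. d1 (Inl x) (Inr y) \<le> \<psi> (d2 (Inl x) (Inr y))"
    unfolding coarse_le_def by blast
  have nn: "\<phi> t \<ge> 0" "\<psi> t \<ge> 0" if "t \<ge> 0" for t
    by (rule homeomorphism_halflineD(1)[OF h(1) that], rule homeomorphism_halflineD(1)[OF h(2) that])
  obtain \<theta>' where t: "homeomorphism {0..} {0..} (\<lambda>t. \<phi> t + \<psi> t) \<theta>'"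
    using homeomorphism_halfline_add[OF h] by blast
  have "\<theta>' (d1 (Inl x) (Inr y)) \<le> d2 (Inl x) (Inr y)" for x y
  proof -
    let ?d1 = "d1 (Inl x) (Inr y)" and ?d2 = "d2 (Inl x) (Inr y)"
    have n: "?d1 \<ge> 0" "?d2 \<ge> 0" using d union_metricsD by blast+
    have "?d1 \<le> \<phi> ?d2 + \<psi> ?d2" using le(2)[of x y] nn(1)[OF n(2)] by simp
    then have "\<theta>' ?d1 \<le> \<theta>' (\<phi> ?d2 + \<psi> ?d2)"
      using strict_mono_on_leD[OF homeomorphism_halfline_mono[OF homeomorphism_symD[OF t]], of
          ?d1 "\<phi> ?d2 + \<psi> ?d2"] n(1) by simp
    also have "\<dots> = ?d2" by (rule homeomorphism_halflineD(3)[OF t n(2)])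
    finally show ?thesis .
  qed
  moreover have "d2 (Inl x) (Inr y) \<le> \<phi> (d1 (Inl x) (Inr y)) + \<psi> (d1 (Inl x) (Inr y))" for x y
    using le(1)[of x y] nn(2)[OF union_metricsD[OF d(1), of x y]] by simp
  ultimately show "coarse_equiv d1 d2" unfolding coarse_equiv_def using t by blast
qed

text \<open>The metric representing the smallest class.\<close>

lemma union_metrics_nonempty: "\<exists>d. d \<in> (union_metrics :: ('x::metric_space + 'y::metric_space \<Rightarrow> _) set)"
proof -
  obtain x0 :: 'x and y0 :: 'y where True by blast
  define d :: "'x + 'y \<Rightarrow> 'x + 'y \<Rightarrow> real" where "d = (\<lambda>p q. case (p, q) of
      (Inl x, Inl x') \<Rightarrow> dist x x' | (Inr y, Inr y') \<Rightarrow> dist y y'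
    | (Inl x, Inr y) \<Rightarrow> dist x x0 + 1 + dist y0 y | (Inr y, Inl x) \<Rightarrow> dist x x0 + 1 + dist y0 y)"
  have e: "d (Inl a) (Inl b) = dist a b" "d (Inr y) (Inr z) = dist y z"
    "d (Inl a) (Inr y) = dist a x0 + 1 + dist y0 y" "d (Inr y) (Inl a) = dist a x0 + 1 + dist y0 y"
    for a b y z by (simp_all add: d_def)
  have nz: "dist a x0 + 1 + dist y0 y > 0" for a y
    using zero_le_dist[of a x0] zero_le_dist[of y0 y] by linarith
  have tx: "dist a x0 \<le> dist a b + dist b x0" "dist a b \<le> dist a x0 + dist b x0" for a b
    by (rule dist_triangle, rule dist_triangle2)
  have ty: "dist y0 z \<le> dist y0 y + dist y z" "dist y z \<le> dist y0 y + dist y0 z" for y z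
    by (rule dist_triangle, rule dist_triangle3)
  have "Metric_space UNIV d"
  proof
    fix p q r
    show "0 \<le> d p q"
      by (cases p; cases q) (simp_all only: e zero_le_dist less_imp_le[OF nz])
    show "d p q = d q p"
      by (cases p; cases q) (simp_all only: e dist_commute)
    show "d p q = 0 \<longleftrightarrow> p = q"
      by (cases p; cases q) (simp_all add: e nz[THEN less_imp_neq, symmetric])
    show "d p r \<le> d p q + d q r"
    proof (cases p; cases q; cases r)
      fix a b c assume "p = Inl a" "q = Inl b" "r = Inl c"
      then show ?thesis by (simp add: e dist_triangle)
    next
      fix a b z assume "p = Inl a" "q = Inl b" "r = Inr z"
      then show ?thesis using tx(1)[of a b] by (simp add: e)
    next
      fix a y c assume *: "p = Inl a" "q = Inr y" "r = Inl c"
      have "dist a c \<le> (dist a x0 + 1 + dist y0 y) + (dist c x0 + 1 + dist y0 y)"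
        using tx(2)[of a c] zero_le_dist[of y0 y] by linarith
      then show ?thesis by (simp only: e *)
    next
      fix a y z assume "p = Inl a" "q = Inr y" "r = Inr z"
      then show ?thesis using ty(1)[of z y] by (simp add: e)
    next
      fix y b c assume "p = Inr y" "q = Inl b" "r = Inl c"
      then show ?thesis using tx(1)[of c b] by (simp add: e dist_commute)
    next
      fix y b z assume *: "p = Inr y" "q = Inl b" "r = Inr z"
      have "dist y z \<le> (dist b x0 + 1 + dist y0 y) + (dist b x0 + 1 + dist y0 z)"
        using ty(2)[of y z] zero_le_dist[of b x0] by linarith
      then show ?thesis by (simp only: e *)
    next
      fix y z c assume "p = Inr y" "q = Inr z" "r = Inl c"
      then show ?thesis using ty(1)[of y z] by (simp add: e dist_commute)
    next
      fix y z w assume "p = Inr y" "q = Inr z" "r = Inr w"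
      then show ?thesis by (simp add: e dist_triangle)
    qed
  qed
  then have "d \<in> union_metrics"
    unfolding union_metrics_def using e
    by (intro CollectI conjI exI[of _ 1]) (simp_all add: add_increasing add_increasing2)
  then show ?thesis by blast
qed

quotient_type (overloaded) ('x, 'y) coarse_class =
  "'x::metric_space + 'y::metric_space \<Rightarrow> 'x + 'y \<Rightarrow> real" / partial:
  "\<lambda>d1 d2. d1 \<in> union_metrics \<and> d2 \<in> union_metrics \<and> coarse_equiv d1 d2"
proof (rule part_equivpI)
  show "\<exists>d::'x + 'y \<Rightarrow> 'x + 'y \<Rightarrow> real. d \<in> union_metrics \<and> d \<in> union_metrics \<and> coarse_equiv d d"
    using union_metrics_nonempty coarse_le_refl coarse_equiv_iff by blast
  show "symp (\<lambda>d1 d2::'x + 'y \<Rightarrow> 'x + 'y \<Rightarrow> real.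
      d1 \<in> union_metrics \<and> d2 \<in> union_metrics \<and> coarse_equiv d1 d2)"
    by (auto simp: symp_def coarse_equiv_iff)
  show "transp (\<lambda>d1 d2::'x + 'y \<Rightarrow> 'x + 'y \<Rightarrow> real.
      d1 \<in> union_metrics \<and> d2 \<in> union_metrics \<and> coarse_equiv d1 d2)"
    unfolding transp_def using coarse_equiv_iff coarse_le_trans by blast
qed

instantiation coarse_class :: (metric_space, metric_space) order
begin

lift_definition less_eq_coarse_class :: "('a, 'b) coarse_class \<Rightarrow> ('a, 'b) coarse_class \<Rightarrow> bool"
  is coarse_le
  using coarse_equiv_iff coarse_le_trans by blast

definition less_coarse_class :: "('a, 'b) coarse_class \<Rightarrow> ('a, 'b) coarse_class \<Rightarrow> bool" where
  "a < b \<longleftrightarrow> a \<le> b \<and> \<not> b \<le> a" for a b :: "('a, 'b) coarse_class"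

instance
proof
  fix a b c :: "('a, 'b) coarse_class"
  show "a < b \<longleftrightarrow> a \<le> b \<and> \<not> b \<le> a" by (rule less_coarse_class_def)
  show "a \<le> a" by transfer (rule coarse_le_refl)
  show "a \<le> b \<Longrightarrow> b \<le> c \<Longrightarrow> a \<le> c" by transfer (blast intro: coarse_le_trans)
  show "a \<le> b \<Longrightarrow> b \<le> a \<Longrightarrow> a = b" by transfer (simp add: coarse_equiv_iff)
qed

end

text \<open>\<open>roe_closure (cross d)\<close> is the space \<open>M\<close> of the class of \<open>d\<close>; \<open>roe_closure (right_metric d)\<close> and
  \<open>roe_closure (left_metric d)\<close> are the uniform Roe algebras of \<open>X\<close> and \<open>Y\<close> for the two induced
  metrics.\<close>

definition cross :: "('x + 'y \<Rightarrow> 'x + 'y \<Rightarrow> real) \<Rightarrow> 'x \<Rightarrow> 'y \<Rightarrow> real" where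
  "cross d x y = d (Inl x) (Inr y)"

definition right_metric :: "('x + 'y \<Rightarrow> 'x + 'y \<Rightarrow> real) \<Rightarrow> 'x \<Rightarrow> 'x \<Rightarrow> real" where
  "right_metric d x1 x2 =
     (if x1 = x2 then 0 else (INF u. d (Inl x1) (Inr u) + d (Inl x2) (Inr u)))"

definition left_metric :: "('x + 'y \<Rightarrow> 'x + 'y \<Rightarrow> real) \<Rightarrow> 'y \<Rightarrow> 'y \<Rightarrow> real" where
  "left_metric d y1 y2 =
     (if y1 = y2 then 0 else (INF u. d (Inl u) (Inr y1) + d (Inl u) (Inr y2)))"


section \<open>Abstract \<open>C\<^sup>*\<close>-algebras, Hilbert bimodules and continuous fields\<close>

record 'a cvec =
  carr :: "'a set"
  zro :: 'a
  pls :: "'a \<Rightarrow> 'a \<Rightarrow> 'a"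
  scl :: "complex \<Rightarrow> 'a \<Rightarrow> 'a"

record 'a cstar = "'a cvec" +
  mul :: "'a \<Rightarrow> 'a \<Rightarrow> 'a"
  star :: "'a \<Rightarrow> 'a"
  nrm :: "'a \<Rightarrow> real"

record ('m, 'a, 'b) bimod = "'m cvec" +
  lact :: "'a \<Rightarrow> 'm \<Rightarrow> 'm"
  ract :: "'m \<Rightarrow> 'b \<Rightarrow> 'm"
  lip :: "'m \<Rightarrow> 'm \<Rightarrow> 'a"
  rip :: "'m \<Rightarrow> 'm \<Rightarrow> 'b"

definition mns :: "('a, 'z) cvec_scheme \<Rightarrow> 'a \<Rightarrow> 'a \<Rightarrow> 'a" where
  "mns V x y = pls V x (scl V (-1) y)"

definition norm_complete :: "('a, 'z) cvec_scheme \<Rightarrow> ('a \<Rightarrow> real) \<Rightarrow> bool" where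
  "norm_complete V N \<longleftrightarrow> (\<forall>s. (\<forall>n::nat. s n \<in> carr V) \<and>
     (\<forall>e>0. \<exists>k. \<forall>m\<ge>k. \<forall>n\<ge>k. N (mns V (s m) (s n)) < e) \<longrightarrow>
     (\<exists>l\<in>carr V. (\<lambda>n. N (mns V (s n) l)) \<longlonglongrightarrow> 0))"

definition norm_closed_in :: "('a, 'z) cvec_scheme \<Rightarrow> ('a \<Rightarrow> real) \<Rightarrow> 'a set \<Rightarrow> bool" where
  "norm_closed_in V N S \<longleftrightarrow> (\<forall>s l. (\<forall>n::nat. s n \<in> S) \<and> l \<in> carr V \<and>
     (\<lambda>n. N (mns V (s n) l)) \<longlonglongrightarrow> 0 \<longrightarrow> l \<in> S)"

definition linear_subspace :: "('a, 'z) cvec_scheme \<Rightarrow> 'a set \<Rightarrow> bool" where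
  "linear_subspace V S \<longleftrightarrow> S \<subseteq> carr V \<and> zro V \<in> S \<and>
     (\<forall>x\<in>S. \<forall>y\<in>S. pls V x y \<in> S) \<and> (\<forall>c. \<forall>x\<in>S. scl V c x \<in> S)"

locale complex_space =
  fixes V :: "('a, 'z) cvec_scheme"
  assumes zro_closed: "zro V \<in> carr V"
    and pls_closed: "\<lbrakk>x \<in> carr V; y \<in> carr V\<rbrakk> \<Longrightarrow> pls V x y \<in> carr V"
    and scl_closed: "x \<in> carr V \<Longrightarrow> scl V c x \<in> carr V"
    and pls_assoc: "\<lbrakk>x \<in> carr V; y \<in> carr V; z \<in> carr V\<rbrakk>
          \<Longrightarrow> pls V (pls V x y) z = pls V x (pls V y z)"
    and pls_comm: "\<lbrakk>x \<in> carr V; y \<in> carr V\<rbrakk> \<Longrightarrow> pls V x y = pls V y x"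
    and pls_zro: "x \<in> carr V \<Longrightarrow> pls V x (zro V) = x"
    and mns_self: "x \<in> carr V \<Longrightarrow> mns V x x = zro V"
    and scl_pls: "\<lbrakk>x \<in> carr V; y \<in> carr V\<rbrakk> \<Longrightarrow> scl V c (pls V x y) = pls V (scl V c x) (scl V c y)"
    and pls_scl: "x \<in> carr V \<Longrightarrow> scl V (c + c') x = pls V (scl V c x) (scl V c' x)"
    and scl_scl: "x \<in> carr V \<Longrightarrow> scl V c (scl V c' x) = scl V (c * c') x"
    and scl_one: "x \<in> carr V \<Longrightarrow> scl V 1 x = x"

definition linear_map :: "('a, 'z) cvec_scheme \<Rightarrow> ('b, 'w) cvec_scheme \<Rightarrow> ('a \<Rightarrow> 'b) \<Rightarrow> bool" where
  "linear_map V W h \<longleftrightarrow> (\<forall>x\<in>carr V. h x \<in> carr W) \<and>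
     (\<forall>x\<in>carr V. \<forall>y\<in>carr V. h (pls V x y) = pls W (h x) (h y)) \<and>
     (\<forall>c. \<forall>x\<in>carr V. h (scl V c x) = scl W c (h x))"

locale cstar_algebra = complex_space A for A :: "'a cstar" +
  assumes mul_closed: "\<lbrakk>x \<in> carr A; y \<in> carr A\<rbrakk> \<Longrightarrow> mul A x y \<in> carr A"
    and mul_assoc: "\<lbrakk>x \<in> carr A; y \<in> carr A; z \<in> carr A\<rbrakk>
          \<Longrightarrow> mul A (mul A x y) z = mul A x (mul A y z)"
    and mul_linear_left: "y \<in> carr A \<Longrightarrow> linear_map A A (\<lambda>x. mul A x y)"
    and mul_linear_right: "x \<in> carr A \<Longrightarrow> linear_map A A (mul A x)"
    and star_closed: "x \<in> carr A \<Longrightarrow> star A x \<in> carr A"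
    and star_star: "x \<in> carr A \<Longrightarrow> star A (star A x) = x"
    and star_pls: "\<lbrakk>x \<in> carr A; y \<in> carr A\<rbrakk> \<Longrightarrow> star A (pls A x y) = pls A (star A x) (star A y)"
    and star_scl: "x \<in> carr A \<Longrightarrow> star A (scl A c x) = scl A (cnj c) (star A x)"
    and star_mul: "\<lbrakk>x \<in> carr A; y \<in> carr A\<rbrakk> \<Longrightarrow> star A (mul A x y) = mul A (star A y) (star A x)"
    and nrm_nonneg: "x \<in> carr A \<Longrightarrow> 0 \<le> nrm A x"
    and nrm_eq_zero: "x \<in> carr A \<Longrightarrow> nrm A x = 0 \<longleftrightarrow> x = zro A"
    and nrm_triangle: "\<lbrakk>x \<in> carr A; y \<in> carr A\<rbrakk> \<Longrightarrow> nrm A (pls A x y) \<le> nrm A x + nrm A y"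
    and nrm_scl: "x \<in> carr A \<Longrightarrow> nrm A (scl A c x) = cmod c * nrm A x"
    and nrm_mul: "\<lbrakk>x \<in> carr A; y \<in> carr A\<rbrakk> \<Longrightarrow> nrm A (mul A x y) \<le> nrm A x * nrm A y"
    and cstar_identity: "x \<in> carr A \<Longrightarrow> nrm A (mul A (star A x) x) = (nrm A x)\<^sup>2"
    and complete: "norm_complete A (nrm A)"

definition star_hom :: "'a cstar \<Rightarrow> 'b cstar \<Rightarrow> ('a \<Rightarrow> 'b) \<Rightarrow> bool" where
  "star_hom A B h \<longleftrightarrow> linear_map A B h \<and>
     (\<forall>x\<in>carr A. \<forall>y\<in>carr A. h (mul A x y) = mul B (h x) (h y)) \<and>
     (\<forall>x\<in>carr A. h (star A x) = star B (h x))"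

definition positive_in :: "'a cstar \<Rightarrow> 'a \<Rightarrow> bool" where
  "positive_in A a \<longleftrightarrow> (\<exists>b\<in>carr A. a = mul A (star A b) b)"

definition cstar_subalgebra :: "'a cstar \<Rightarrow> 'a set \<Rightarrow> bool" where
  "cstar_subalgebra A S \<longleftrightarrow> linear_subspace A S \<and> norm_closed_in A (nrm A) S \<and>
     (\<forall>x\<in>S. \<forall>y\<in>S. mul A x y \<in> S) \<and> (\<forall>x\<in>S. star A x \<in> S)"

definition cstar_generated :: "'a cstar \<Rightarrow> 'a set \<Rightarrow> 'a cstar" where
  "cstar_generated A G = A\<lparr>carr := \<Inter>{S. cstar_subalgebra A S \<and> G \<subseteq> S}\<rparr>"

locale right_hilbert_module = complex_space V + cstar_algebra B
  for V :: "('m, 'z) cvec_scheme" and B :: "'b cstar" +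
  fixes act :: "'m \<Rightarrow> 'b \<Rightarrow> 'm" and ip :: "'m \<Rightarrow> 'm \<Rightarrow> 'b"
  assumes act_linear: "b \<in> carr B \<Longrightarrow> linear_map V V (\<lambda>m. act m b)"
    and act_linear_alg: "m \<in> carr V \<Longrightarrow> linear_map B V (act m)"
    and act_mul: "\<lbrakk>m \<in> carr V; b \<in> carr B; b' \<in> carr B\<rbrakk> \<Longrightarrow> act m (mul B b b') = act (act m b) b'"
    and ip_linear: "m \<in> carr V \<Longrightarrow> linear_map V B (ip m)"
    and ip_act: "\<lbrakk>m \<in> carr V; n \<in> carr V; b \<in> carr B\<rbrakk> \<Longrightarrow> ip m (act n b) = mul B (ip m n) b"
    and ip_star: "\<lbrakk>m \<in> carr V; n \<in> carr V\<rbrakk> \<Longrightarrow> star B (ip m n) = ip n m"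
    and ip_positive: "m \<in> carr V \<Longrightarrow> positive_in B (ip m m)"
    and ip_definite: "\<lbrakk>m \<in> carr V; ip m m = zro B\<rbrakk> \<Longrightarrow> m = zro V"
    and module_complete: "norm_complete V (\<lambda>m. sqrt (nrm B (ip m m)))"

locale left_hilbert_module = complex_space V + cstar_algebra A
  for V :: "('m, 'z) cvec_scheme" and A :: "'a cstar" +
  fixes act :: "'a \<Rightarrow> 'm \<Rightarrow> 'm" and ip :: "'m \<Rightarrow> 'm \<Rightarrow> 'a"
  assumes act_linear: "a \<in> carr A \<Longrightarrow> linear_map V V (act a)"
    and act_linear_alg: "m \<in> carr V \<Longrightarrow> linear_map A V (\<lambda>a. act a m)"
    and act_mul: "\<lbrakk>m \<in> carr V; a \<in> carr A; a' \<in> carr A\<rbrakk> \<Longrightarrow> act (mul A a a') m = act a (act a' m)"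
    and ip_linear: "n \<in> carr V \<Longrightarrow> linear_map V A (\<lambda>m. ip m n)"
    and ip_act: "\<lbrakk>m \<in> carr V; n \<in> carr V; a \<in> carr A\<rbrakk> \<Longrightarrow> ip (act a m) n = mul A a (ip m n)"
    and ip_star: "\<lbrakk>m \<in> carr V; n \<in> carr V\<rbrakk> \<Longrightarrow> star A (ip m n) = ip n m"
    and ip_positive: "m \<in> carr V \<Longrightarrow> positive_in A (ip m m)"
    and ip_definite: "\<lbrakk>m \<in> carr V; ip m m = zro A\<rbrakk> \<Longrightarrow> m = zro V"
    and module_complete: "norm_complete V (\<lambda>m. sqrt (nrm A (ip m m)))"

text \<open>Hilbert \<open>C\<^sup>*\<close>-bimodules in the sense of Brown, Mingo and Shen; neither inner product is
  required to be full.\<close>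

definition hilbert_bimodule :: "'a cstar \<Rightarrow> 'b cstar \<Rightarrow> ('m, 'a, 'b) bimod \<Rightarrow> bool" where
  "hilbert_bimodule A B M \<longleftrightarrow>
     left_hilbert_module M A (lact M) (lip M) \<and> right_hilbert_module M B (ract M) (rip M) \<and>
     (\<forall>a\<in>carr A. \<forall>m\<in>carr M. \<forall>b\<in>carr B. ract M (lact M a m) b = lact M a (ract M m b)) \<and>
     (\<forall>m\<in>carr M. \<forall>n\<in>carr M. \<forall>r\<in>carr M. lact M (lip M m n) r = ract M m (rip M n r))"

text \<open>An element of the total space is identified with its family of values; this is the joint
  injectivity below.  It makes the \<open>C(T)\<close>-action unique, so the module axioms for it need not be
  stated.\<close>

definition CT_acts :: "'t topology \<Rightarrow> ('v, 'z) cvec_scheme \<Rightarrow> ('t \<Rightarrow> ('e, 'w) cvec_scheme) \<Rightarrow>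
    ('t \<Rightarrow> 'v \<Rightarrow> 'e) \<Rightarrow> bool" where
  "CT_acts T V Vt p \<longleftrightarrow> (\<exists>act :: ('t \<Rightarrow> complex) \<Rightarrow> 'v \<Rightarrow> 'v.
     \<forall>f. continuous_map T euclidean f \<longrightarrow> (\<forall>v\<in>carr V.
       act f v \<in> carr V \<and> (\<forall>t\<in>topspace T. p t (act f v) = scl (Vt t) (f t) (p t v))))"

definition jointly_injective :: "'t topology \<Rightarrow> 'v set \<Rightarrow> ('t \<Rightarrow> 'v \<Rightarrow> 'e) \<Rightarrow> bool" where
  "jointly_injective T V p \<longleftrightarrow>
     (\<forall>v\<in>V. \<forall>w\<in>V. (\<forall>t\<in>topspace T. p t v = p t w) \<longrightarrow> v = w)"

definition continuous_field_cstar ::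
  "'t topology \<Rightarrow> 'a cstar \<Rightarrow> ('t \<Rightarrow> 'e cstar) \<Rightarrow> ('t \<Rightarrow> 'a \<Rightarrow> 'e) \<Rightarrow> bool" where
  "continuous_field_cstar T A At p \<longleftrightarrow>
     compact_space T \<and> Hausdorff_space T \<and> cstar_algebra A \<and>
     (\<forall>t\<in>topspace T. cstar_algebra (At t) \<and> star_hom A (At t) (p t) \<and> p t ` carr A = carr (At t)) \<and>
     jointly_injective T (carr A) p \<and>
     (\<forall>a\<in>carr A. bdd_above ((\<lambda>t. nrm (At t) (p t a)) ` topspace T)) \<and>
     CT_acts T A At p \<and>
     (\<forall>a\<in>carr A. continuous_map T euclideanreal (\<lambda>t. nrm (At t) (p t a)))"

definition continuous_field_bimodule ::
  "'t topology \<Rightarrow>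
   'a cstar \<Rightarrow> ('t \<Rightarrow> 'e cstar) \<Rightarrow> ('t \<Rightarrow> 'a \<Rightarrow> 'e) \<Rightarrow>
   'b cstar \<Rightarrow> ('t \<Rightarrow> 'f cstar) \<Rightarrow> ('t \<Rightarrow> 'b \<Rightarrow> 'f) \<Rightarrow>
   ('m, 'a, 'b) bimod \<Rightarrow> ('t \<Rightarrow> ('n, 'e, 'f) bimod) \<Rightarrow> ('t \<Rightarrow> 'm \<Rightarrow> 'n) \<Rightarrow> bool" where
  "continuous_field_bimodule T A At p B Bt q M Mt \<pi> \<longleftrightarrow>
     continuous_field_cstar T A At p \<and> continuous_field_cstar T B Bt q \<and>
     hilbert_bimodule A B M \<and>
     (\<forall>t\<in>topspace T. hilbert_bimodule (At t) (Bt t) (Mt t) \<and>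
        linear_map M (Mt t) (\<pi> t) \<and> \<pi> t ` carr M = carr (Mt t)) \<and>
     jointly_injective T (carr M) \<pi> \<and>
     (\<forall>m\<in>carr M. bdd_above ((\<lambda>t. sqrt (nrm (Bt t) (rip (Mt t) (\<pi> t m) (\<pi> t m)))) ` topspace T)) \<and>
     CT_acts T M Mt \<pi> \<and>
     (\<forall>t\<in>topspace T. \<forall>m\<in>carr M.
        (\<forall>a\<in>carr A. \<pi> t (lact M a m) = lact (Mt t) (p t a) (\<pi> t m)) \<and>
        (\<forall>b\<in>carr B. \<pi> t (ract M m b) = ract (Mt t) (\<pi> t m) (q t b)) \<and>
        (\<forall>n\<in>carr M. p t (lip M m n) = lip (Mt t) (\<pi> t m) (\<pi> t n) \<and>
                     q t (rip M m n) = rip (Mt t) (\<pi> t m) (\<pi> t n)))"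


section \<open>Topology and compactification of a poset\<close>

definition poset_topology :: "'p::order topology" where
  "poset_topology = topology_generated_by (range (\<lambda>a. {a..}) \<union> range (\<lambda>a. - {a..}))"

definition Cb_vec :: "('e::real_normed_vector, 'z) cvec_scheme \<Rightarrow> ('p::order \<Rightarrow> 'e) cvec" where
  "Cb_vec V = \<lparr>
     carr = {f. continuous_map poset_topology euclidean f \<and> bounded (range f) \<and> range f \<subseteq> carr V},
     zro = \<lambda>_. zro V,
     pls = \<lambda>f g b. pls V (f b) (g b),
     scl = \<lambda>c f b. scl V c (f b)\<rparr>"

definition Cb_cstar :: "'e::real_normed_vector cstar \<Rightarrow> ('p::order \<Rightarrow> 'e) cstar" where
  "Cb_cstar E = \<lparr>
     carr = carr (Cb_vec E), zro = zro (Cb_vec E), pls = pls (Cb_vec E), scl = scl (Cb_vec E),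
     mul = \<lambda>f g b. mul E (f b) (g b),
     star = \<lambda>f b. star E (f b),
     nrm = \<lambda>f. SUP b. nrm E (f b)\<rparr>"

definition complex_cstar :: "complex cstar" where
  "complex_cstar = \<lparr>carr = UNIV, zro = 0, pls = (+), scl = (*), mul = (*), star = cnj, nrm = cmod\<rparr>"

definition step_map :: "'p::order \<Rightarrow> 'e::zero \<Rightarrow> 'p \<Rightarrow> 'e" where
  "step_map a s b = (if a \<le> b then s else 0)"

definition gamma_algebra :: "('p::order \<Rightarrow> complex) cstar" where
  "gamma_algebra = cstar_generated (Cb_cstar complex_cstar)
     (range (\<lambda>a. indicator {a..}) \<union> range (\<lambda>a. indicator (- {a..})))"

text \<open>Nonzero characters with the topology of pointwise convergence.\<close>

definition gelfand_spectrum :: "'a cstar \<Rightarrow> ('a \<Rightarrow> complex) topology" where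
  "gelfand_spectrum A = subtopology (product_topology (\<lambda>_. euclidean) (carr A))
     {h. linear_map A complex_cstar h \<and>
         (\<forall>x\<in>carr A. \<forall>y\<in>carr A. h (mul A x y) = h x * h y) \<and> (\<exists>x\<in>carr A. h x \<noteq> 0)}"

definition gamma :: "(('p::order \<Rightarrow> complex) \<Rightarrow> complex) topology" where
  "gamma = gelfand_spectrum gamma_algebra"

definition gamma_point :: "'p::order \<Rightarrow> ('p \<Rightarrow> complex) \<Rightarrow> complex" where
  "gamma_point b = restrict (\<lambda>f. f b) (carr gamma_algebra)"

definition gamma_ext :: "('p::order \<Rightarrow> 'e::topological_space) \<Rightarrow> (('p \<Rightarrow> complex) \<Rightarrow> complex) \<Rightarrow> 'e" where
  "gamma_ext m = (THE g. g \<in> extensional (topspace gamma) \<and> continuous_map gamma euclidean g \<and>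
     (\<forall>b. g (gamma_point b) = m b))"


section \<open>The data over the compactification\<close>

definition op_vec :: "('a ell2 \<Rightarrow>\<^sub>L 'b ell2) set \<Rightarrow> ('a ell2 \<Rightarrow>\<^sub>L 'b ell2) cvec" where
  "op_vec S = \<lparr>carr = S, zro = 0, pls = (+), scl = cscale_op\<rparr>"

definition op_cstar :: "('a ell2 \<Rightarrow>\<^sub>L 'a ell2) set \<Rightarrow> ('a ell2 \<Rightarrow>\<^sub>L 'a ell2) cstar" where
  "op_cstar S = \<lparr>carr = S, zro = 0, pls = (+), scl = cscale_op, mul = (o\<^sub>L), star = adj, nrm = norm\<rparr>"

definition op_bimod :: "('x ell2 \<Rightarrow>\<^sub>L 'y ell2) set \<Rightarrow>
    ('x ell2 \<Rightarrow>\<^sub>L 'y ell2, 'y ell2 \<Rightarrow>\<^sub>L 'y ell2, 'x ell2 \<Rightarrow>\<^sub>L 'x ell2) bimod" where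
  "op_bimod S = \<lparr>carr = S, zro = 0, pls = (+), scl = cscale_op,
     lact = (o\<^sub>L), ract = (o\<^sub>L),
     lip = \<lambda>m n. m o\<^sub>L adj n, rip = \<lambda>m n. adj m o\<^sub>L n\<rparr>"

definition map_bimod :: "('p \<Rightarrow> 'x ell2 \<Rightarrow>\<^sub>L 'y ell2) set \<Rightarrow>
    ('p \<Rightarrow> 'x ell2 \<Rightarrow>\<^sub>L 'y ell2, 'p \<Rightarrow> 'y ell2 \<Rightarrow>\<^sub>L 'y ell2, 'p \<Rightarrow> 'x ell2 \<Rightarrow>\<^sub>L 'x ell2) bimod" where
  "map_bimod S = \<lparr>carr = S, zro = \<lambda>_. 0, pls = \<lambda>f g b. f b + g b, scl = \<lambda>c f b. cscale_op c (f b),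
     lact = \<lambda>a m b. a b o\<^sub>L m b, ract = \<lambda>m r b. m b o\<^sub>L r b,
     lip = \<lambda>m n b. m b o\<^sub>L adj (n b), rip = \<lambda>m n b. adj (m b) o\<^sub>L n b\<rparr>"

definition field_A :: "(('x::metric_space, 'y::metric_space) coarse_class \<Rightarrow> 'y ell2 \<Rightarrow>\<^sub>L 'y ell2) cstar" where
  "field_A = cstar_generated (Cb_cstar (op_cstar bounded_ops))
     {step_map (abs_coarse_class d) a | d a. d \<in> union_metrics \<and> a \<in> roe_closure (left_metric d)}"

definition field_B :: "(('x::metric_space, 'y::metric_space) coarse_class \<Rightarrow> 'x ell2 \<Rightarrow>\<^sub>L 'x ell2) cstar" where
  "field_B = cstar_generated (Cb_cstar (op_cstar bounded_ops))
     {step_map (abs_coarse_class d) b | d b. d \<in> union_metrics \<and> b \<in> roe_closure (right_metric d)}"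

text \<open>Closure under multiplication by bounded continuous functions refers to the functions in
  \<open>gamma_algebra\<close>, i.e. to those that extend continuously to \<open>gamma\<close>.  A general bounded continuous
  function on the poset has no such extension, and then neither has its product with a nonzero
  constant map, so the elements of the module could not be evaluated at the points of \<open>gamma\<close>.\<close>

definition field_M_carr ::
  "(('x::metric_space, 'y::metric_space) coarse_class \<Rightarrow> 'x ell2 \<Rightarrow>\<^sub>L 'y ell2) set" where
  "field_M_carr = \<Inter>{N.
     linear_subspace (Cb_vec (op_vec bounded_ops)) N \<and>
     norm_closed_in (Cb_vec (op_vec bounded_ops)) (\<lambda>f. SUP b. norm (f b)) N \<and>
     (\<forall>d\<in>union_metrics. \<forall>s\<in>roe_closure (cross d). step_map (abs_coarse_class d) s \<in> N) \<and>
     (\<forall>m\<in>N. \<forall>n\<in>N. \<forall>r\<in>N. (\<lambda>b. m b o\<^sub>L adj (n b) o\<^sub>L r b) \<in> N) \<and>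
     (\<forall>f\<in>carr gamma_algebra. \<forall>m\<in>N. (\<lambda>b. cscale_op (f b) (m b)) \<in> N)}"

definition field_M where "field_M = map_bimod field_M_carr"

text \<open>Evaluation of the continuous extension at a point of \<open>gamma\<close>; used for all three fields.\<close>

definition field_eval :: "(('p::order \<Rightarrow> complex) \<Rightarrow> complex) \<Rightarrow> ('p \<Rightarrow> 'e::topological_space) \<Rightarrow> 'e" where
  "field_eval t m = gamma_ext m t"

definition fibre_A ::
  "((('x::metric_space, 'y::metric_space) coarse_class \<Rightarrow> complex) \<Rightarrow> complex) \<Rightarrow> ('y ell2 \<Rightarrow>\<^sub>L 'y ell2) cstar" where
  "fibre_A t = op_cstar (field_eval t ` carr field_A)"

definition fibre_B ::
  "((('x::metric_space, 'y::metric_space) coarse_class \<Rightarrow> complex) \<Rightarrow> complex) \<Rightarrow> ('x ell2 \<Rightarrow>\<^sub>L 'x ell2) cstar" where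
  "fibre_B t = op_cstar (field_eval t ` carr field_B)"

definition fibre_M ::
  "((('x::metric_space, 'y::metric_space) coarse_class \<Rightarrow> complex) \<Rightarrow> complex) \<Rightarrow>
   ('x ell2 \<Rightarrow>\<^sub>L 'y ell2, 'y ell2 \<Rightarrow>\<^sub>L 'y ell2, 'x ell2 \<Rightarrow>\<^sub>L 'x ell2) bimod" where
  "fibre_M t = op_bimod (field_eval t ` field_M_carr)"

end

theory Submission
  imports Defs
begin

text \<open>The module is the closed linear span of the maps \<open>f \<cdot> \<chi>\<^sub>a s\<close> with \<open>f\<close> in
  \<open>gamma_algebra\<close> and \<open>s\<close> in the space of the class \<open>a\<close>.  Two coarse classes with a common upper bound have a join \<open>j\<close>, so
  \<open>\<chi>\<^sub>a s (\<chi>\<^sub>b s')\<^sup>*\<close> is either \<open>0\<close> or \<open>\<chi>\<^sub>j s s'\<^sup>*\<close>; hence this span is closed under the actions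
  of the two algebras and its inner products take values in them.  Positivity of the inner products
  requires square roots inside the algebras, which are obtained by a norm convergent iteration.

  A point \<open>t\<close> of \<open>gamma\<close> is handled through the filter on the poset generated by the sets
  \<open>{a..}\<close> and \<open>- {a..}\<close> on whose indicator \<open>t\<close> is \<open>1\<close>: continuous extension to \<open>t\<close> means convergence along
  this filter.  As the filter has a base of sets with indicator in \<open>gamma_algebra\<close>, an element of a fibre
  lifts to a section of almost the same norm, so the fibres are complete.\<close>

section \<open>Square-summable families\<close>

text \<open>Two classes need not have a common upper bound, because metrics that bring the two
  spaces together along different pairs of points can be incompatible with the given metrics. Joins
  of bounded pairs still suffice: without a common upper bound, the sets \<open>{a..}\<close> and
  \<open>{b..}\<close> are disjoint. The definition of the module by ternary products gives no
  direct hold on mixed products such as an algebra section times a module section. A closed linear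
  span does: all the products are additive and norm continuous in each factor, so their membership
  is checked on generators and carried over by a closed-subspace argument. The obstacle behind the
  square roots is that \<open>positive_in\<close> asks for a witness inside the coefficient algebra,
  whereas a module element maps between different spaces. The unit used for them is the step map at
  the least class. Fibres over points of \<open>gamma\<close> outside the poset are not described by
  a metric. Their closedness, products and square roots are therefore all obtained by evaluating
  sections.\<close>

lemma ell2_fun_simps [simp]:
  "ell2_fun 0 x = 0" "ell2_fun (f + g) x = ell2_fun f x + ell2_fun g x"
  "ell2_fun (- f) x = - ell2_fun f x" "ell2_fun (f - g) x = ell2_fun f x - ell2_fun g x"
  "ell2_fun (cscale_ell2 c f) x = c * ell2_fun f x" "ell2_fun (r *\<^sub>R f) x = of_real r * ell2_fun f x"
  by (simp_all only: zero_ell2.rep_eq plus_ell2.rep_eq uminus_ell2.rep_eq minus_ell2_def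
      cscale_ell2.rep_eq scaleR_ell2.rep_eq diff_conv_add_uminus)

lemma ell2_eqI: "(\<And>x. ell2_fun f x = ell2_fun g x) \<Longrightarrow> f = g"
  by (simp add: ell2_fun_inject[symmetric] fun_eq_iff)

lemma ell2_fun_sum: "ell2_fun (\<Sum>i\<in>I. f i) x = (\<Sum>i\<in>I. ell2_fun (f i) x)"
  by (induction I rule: infinite_finite_induct) auto

lemma ell2_fun_delta: "ell2_fun (delta x) z = (if z = x then 1 else 0)"
  by (simp add: delta.rep_eq)

lemma power2_norm_ell2: "(norm f)\<^sup>2 = (\<Sum>\<^sub>\<infinity>x. (cmod (ell2_fun f x))\<^sup>2)"
proof -
  have "(norm f)\<^sup>2 = (\<Sum>\<^sub>\<infinity>x. Re (cnj (ell2_fun f x) * ell2_fun f x))"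
    by (simp only: power2_norm_eq_inner inner_ell2_def cinner_def infsum_Re[OF ell2_prod_summable])
  also have "\<dots> = (\<Sum>\<^sub>\<infinity>x. (cmod (ell2_fun f x))\<^sup>2)"
    by (intro infsum_cong) (metis Re_complex_of_real complex_norm_square mult.commute)
  finally show ?thesis .
qed

lemma sum_le_norm_ell2: "finite F \<Longrightarrow> (\<Sum>x\<in>F. (cmod (ell2_fun f x))\<^sup>2) \<le> (norm f)\<^sup>2"
  unfolding power2_norm_ell2 by (rule finite_sum_le_infsum[OF ell2_sq_summable]) auto

text \<open>Norm estimates are tested on finite coordinate sets, where coordinatewise limits and
  truncations can be handled directly.\<close>

lemma norm_ell2_leI:
  assumes "\<And>F. finite F \<Longrightarrow> (\<Sum>x\<in>F. (cmod (ell2_fun f x))\<^sup>2) \<le> C\<^sup>2" "0 \<le> C"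
  shows "norm f \<le> C"
proof -
  have "(norm f)\<^sup>2 \<le> C\<^sup>2"
    unfolding power2_norm_ell2 by (rule infsum_le_finite_sums[OF ell2_sq_summable]) (use assms in auto)
  then show ?thesis using assms(2) by (rule power2_le_imp_le)
qed

lemma ell2_summableI:
  fixes f :: "'a \<Rightarrow> complex"
  assumes "\<And>F. finite F \<Longrightarrow> (\<Sum>x\<in>F. (cmod (f x))\<^sup>2) \<le> C"
  shows "(\<lambda>x. (cmod (f x))\<^sup>2) summable_on UNIV"
  by (rule nonneg_bdd_above_summable_on) (use assms in \<open>auto intro!: bdd_aboveI[of _ C]\<close>)

lemma cmod_le_norm_ell2: "cmod (ell2_fun f x) \<le> norm f"
  by (rule power2_le_imp_le) (use sum_le_norm_ell2[of "{x}" f] in auto)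

lemma cinner_add_left: "cinner (f + g) h = cinner f h + cinner g h"
  using infsum_add[OF ell2_prod_summable[of f h] ell2_prod_summable[of g h]]
  by (simp add: cinner_def algebra_simps)

lemma cinner_add_right: "cinner h (f + g) = cinner h f + cinner h g"
  using infsum_add[OF ell2_prod_summable[of h f] ell2_prod_summable[of h g]]
  by (simp add: cinner_def algebra_simps)

lemma cinner_cscale_left: "cinner (cscale_ell2 c f) g = cnj c * cinner f g"
  by (simp add: cinner_def mult.assoc infsum_cmult_right')

lemma cinner_cscale_right: "cinner f (cscale_ell2 c g) = c * cinner f g"
proof -
  have "cinner f (cscale_ell2 c g) = (\<Sum>\<^sub>\<infinity>x. c * (cnj (ell2_fun f x) * ell2_fun g x))"
    by (simp add: cinner_def mult.left_commute)
  then show ?thesis by (simp add: cinner_def infsum_cmult_right')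
qed

lemma cinner_commute: "cinner f g = cnj (cinner g f)"
  unfolding cinner_def by (subst infsum_cnj[symmetric]) (simp add: mult.commute)

lemma cinner_zero [simp]: "cinner 0 f = 0" "cinner f 0 = 0"
  by (simp_all add: cinner_def)

lemma cinner_sum_right: "cinner h (\<Sum>i\<in>I. f i) = (\<Sum>i\<in>I. cinner h (f i))"
  by (induction I rule: infinite_finite_induct) (auto simp: cinner_add_right)

lemma cinner_self: "cinner f f = complex_of_real ((norm f)\<^sup>2)"
proof -
  have "Im (cinner f f) = 0" using cinner_commute[of f f] by (simp add: complex_eq_iff)
  then show ?thesis by (simp add: complex_eq_iff power2_norm_eq_inner inner_ell2_def)
qed

text \<open>Rotating \<open>f\<close> by the phase \<open>c\<close> of the inner product makes it
  real and nonnegative, so that the Cauchy-Schwarz inequality for the real inner product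
  applies.\<close>

lemma cinner_Cauchy_Schwarz: "cmod (cinner f g) \<le> norm f * norm g"
proof (cases "cinner f g = 0")
  case False
  define c where "c = sgn (cinner f g)"
  have "cnj c * cinner f g = of_real ((cmod (cinner f g))\<^sup>2) / of_real (cmod (cinner f g))"
    unfolding complex_norm_square by (simp add: c_def sgn_eq mult.commute)
  also have "\<dots> = of_real (cmod (cinner f g))" by (simp add: power2_eq_square False)
  finally have "cmod (cinner f g) = Re (cnj c * cinner f g)" by simp
  also have "\<dots> = inner (cscale_ell2 c f) g" by (simp add: inner_ell2_def cinner_cscale_left)
  also have "\<dots> \<le> norm (cscale_ell2 c f) * norm g" by (rule norm_cauchy_schwarz)
  also have "\<dots> = norm f * norm g" using False by (simp add: norm_cscale_ell2 c_def norm_sgn)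
  finally show ?thesis .
qed simp

lemma cinner_delta_left: "cinner (delta x) f = ell2_fun f x"
proof -
  have "cinner (delta x) f = (\<Sum>\<^sub>\<infinity>z\<in>{x}. cnj (ell2_fun (delta x) z) * ell2_fun f z)"
    unfolding cinner_def by (intro infsum_cong_neutral) (auto simp: ell2_fun_delta)
  then show ?thesis by (simp add: ell2_fun_delta)
qed

lemma cinner_ext: "(\<And>u. cinner f u = cinner g u) \<Longrightarrow> f = g"
  by (rule ell2_eqI) (metis cinner_delta_left cinner_commute)

lemma bounded_linear_cinner: "bounded_linear (cinner f)"
proof (rule bounded_linear_intro[where K = "norm f"])
  show "cinner f (r *\<^sub>R x) = r *\<^sub>R cinner f x" for r x
  proof -
    have "r *\<^sub>R x = cscale_ell2 (of_real r) x" by (rule ell2_eqI) simp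
    then show ?thesis by (simp add: cinner_cscale_right scaleR_conv_of_real)
  qed
qed (simp_all add: cinner_add_right, metis cinner_Cauchy_Schwarz mult.commute)

text \<open>The Riesz-Fischer argument: the limit is formed coordinatewise, and the Cauchy estimate
  passes to it on each finite coordinate set.\<close>

instance ell2 :: (type) banach
proof
  fix X :: "nat \<Rightarrow> 'a ell2"
  assume X: "Cauchy X"
  have lip: "cmod (ell2_fun (X m) x - ell2_fun (X n) x) \<le> norm (X m - X n)" for m n x
    using cmod_le_norm_ell2[of "X m - X n" x] by simp
  have "Cauchy (\<lambda>n. ell2_fun (X n) x)" for x
    unfolding Cauchy_def dist_norm
  proof (intro allI impI)
    fix e :: real assume "e > 0"
    then obtain M where "\<forall>m\<ge>M. \<forall>n\<ge>M. norm (X m - X n) < e"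
      using X unfolding Cauchy_def dist_norm by blast
    then show "\<exists>M. \<forall>m\<ge>M. \<forall>n\<ge>M. cmod (ell2_fun (X m) x - ell2_fun (X n) x) < e"
      using lip le_less_trans by blast
  qed
  then have "\<exists>l. (\<lambda>n. ell2_fun (X n) x) \<longlonglongrightarrow> l" for x
    by (simp add: Cauchy_convergent_iff convergent_def)
  then obtain L where L: "\<And>x. (\<lambda>n. ell2_fun (X n) x) \<longlonglongrightarrow> L x" by metis
  \<comment> \<open>The same \<open>N\<close> serves all finite \<open>F\<close>: let
    \<open>m\<close> tend to infinity in the bound for \<open>X n - X m\<close>.\<close>
  have fin: "\<exists>N. \<forall>n\<ge>N. \<forall>F. finite F \<longrightarrow> (\<Sum>x\<in>F. (cmod (ell2_fun (X n) x - L x))\<^sup>2) \<le> e\<^sup>2"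
    if e: "e > 0" for e
  proof -
    obtain N where N: "\<forall>m\<ge>N. \<forall>n\<ge>N. norm (X m - X n) < e"
      using X e unfolding Cauchy_def dist_norm by blast
    have "(\<Sum>x\<in>F. (cmod (ell2_fun (X n) x - L x))\<^sup>2) \<le> e\<^sup>2" if "n \<ge> N" "finite F" for n F
    proof (rule tendsto_upperbound)
      show "(\<lambda>m. \<Sum>x\<in>F. (cmod (ell2_fun (X n) x - ell2_fun (X m) x))\<^sup>2)
          \<longlonglongrightarrow> (\<Sum>x\<in>F. (cmod (ell2_fun (X n) x - L x))\<^sup>2)"
        by (intro tendsto_intros L)
      show "\<forall>\<^sub>F m in sequentially. (\<Sum>x\<in>F. (cmod (ell2_fun (X n) x - ell2_fun (X m) x))\<^sup>2) \<le> e\<^sup>2"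
      proof (rule eventually_sequentiallyI[of N])
        fix m assume "m \<ge> N"
        have "(\<Sum>x\<in>F. (cmod (ell2_fun (X n) x - ell2_fun (X m) x))\<^sup>2) \<le> (norm (X n - X m))\<^sup>2"
          using sum_le_norm_ell2[of F "X n - X m"] that by simp
        also have "\<dots> \<le> e\<^sup>2" using N that \<open>m \<ge> N\<close> by (intro power_mono) (auto intro: less_imp_le)
        finally show "(\<Sum>x\<in>F. (cmod (ell2_fun (X n) x - ell2_fun (X m) x))\<^sup>2) \<le> e\<^sup>2" .
      qed
    qed simp
    then show ?thesis by blast
  qed
  obtain N where N: "\<forall>F. finite F \<longrightarrow> (\<Sum>x\<in>F. (cmod (ell2_fun (X N) x - L x))\<^sup>2) \<le> 1\<^sup>2"
    using fin[of 1] by auto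
  have "(\<lambda>x. (cmod (ell2_fun (X N) x - L x))\<^sup>2) summable_on UNIV"
    by (rule ell2_summableI) (use N in blast)
  \<comment> \<open>\<open>L\<close> is \<open>X N\<close> minus the square-summable family
    \<open>X N - L\<close>.\<close>
  from ell2_add_closed[OF ell2_scale_closed[OF this, of "-1"] ell2_sq_summable[of "X N"]]
  have "(\<lambda>x. (cmod (L x))\<^sup>2) summable_on UNIV" by simp
  then have L_fun: "ell2_fun (Abs_ell2 L) = L" by (simp add: Abs_ell2_inverse)
  have "X \<longlonglongrightarrow> Abs_ell2 L"
    unfolding LIMSEQ_def dist_norm
  proof (intro allI impI)
    fix r :: real assume r: "r > 0"
    obtain N where N: "\<And>n F. n \<ge> N \<Longrightarrow> finite F \<Longrightarrow> (\<Sum>x\<in>F. (cmod (ell2_fun (X n) x - L x))\<^sup>2) \<le> (r/2)\<^sup>2"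
      using fin[of "r/2"] r by auto
    have "norm (X n - Abs_ell2 L) \<le> r/2" if "n \<ge> N" for n
      by (rule norm_ell2_leI) (use N[OF that] r in \<open>auto simp: L_fun\<close>)
    then show "\<exists>no. \<forall>n\<ge>no. norm (X n - Abs_ell2 L) < r"
      using r by (intro exI[of _ N]) (metis field_sum_of_halves less_add_same_cancel1 half_gt_zero le_less_trans)
  qed
  then show "convergent X" by (rule convergentI)
qed

text \<open>Lets identities checked on basis vectors pass to all vectors by continuity. Once a
  finite set carries the squared norm up to \<open>(e/2)\<^sup>2\<close>, the error only involves
  coordinates outside it.\<close>

lemma has_sum_delta_ell2:
  "((\<lambda>x. cscale_ell2 (ell2_fun f x) (delta x)) has_sum f) UNIV"
  unfolding has_sum_def tendsto_iff eventually_finite_subsets_at_top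
proof (intro allI impI)
  fix e :: real assume e: "e > 0"
  let ?g = "\<lambda>F. \<Sum>x\<in>F. cscale_ell2 (ell2_fun f x) (delta x)"
  have g: "ell2_fun (?g F) x = (if x \<in> F then ell2_fun f x else 0)" if "finite F" for F x
    using that by (simp add: ell2_fun_sum ell2_fun_delta if_distrib[of "(*) _"] cong: if_cong)
  obtain F where F: "finite F" "dist (\<Sum>x\<in>F. (cmod (ell2_fun f x))\<^sup>2) ((norm f)\<^sup>2) \<le> (e/2)\<^sup>2"
    using infsum_finite_approximation[OF ell2_sq_summable[of f], of "(e/2)\<^sup>2"] e
    unfolding power2_norm_ell2 by auto
  have "dist (?g G) f < e" if G: "finite G" "F \<subseteq> G" for G
  proof -
    have "norm (?g G - f) \<le> e/2"
    proof (rule norm_ell2_leI)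
      fix H :: "'a set" assume H: "finite H"
      have "(\<Sum>x\<in>H. (cmod (ell2_fun (?g G - f) x))\<^sup>2) = (\<Sum>x\<in>H - G. (cmod (ell2_fun f x))\<^sup>2)"
        by (rule sum.mono_neutral_cong_right) (use H G g in auto)
      also have "\<dots> \<le> (\<Sum>x\<in>(H \<union> G) - F. (cmod (ell2_fun f x))\<^sup>2)"
        by (rule sum_mono2) (use H G in auto)
      also have "\<dots> = (\<Sum>x\<in>H \<union> G. (cmod (ell2_fun f x))\<^sup>2) - (\<Sum>x\<in>F. (cmod (ell2_fun f x))\<^sup>2)"
        by (rule sum_diff) (use H G in auto)
      also have "\<dots> \<le> (norm f)\<^sup>2 - (\<Sum>x\<in>F. (cmod (ell2_fun f x))\<^sup>2)"
        using sum_le_norm_ell2[of "H \<union> G" f] H G by simp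
      also have "\<dots> \<le> (e/2)\<^sup>2" using F(2) by (simp add: dist_real_def)
      finally show "(\<Sum>x\<in>H. (cmod (ell2_fun (?g G - f) x))\<^sup>2) \<le> (e/2)\<^sup>2" .
    qed (use e in simp)
    then show ?thesis using e by (simp add: dist_norm)
  qed
  then show "\<exists>X. finite X \<and> X \<subseteq> UNIV \<and> (\<forall>Y. finite Y \<and> X \<subseteq> Y \<and> Y \<subseteq> UNIV \<longrightarrow> dist (?g Y) f < e)"
    using F(1) by blast
qed


section \<open>Bounded operators and adjoints\<close>

lemma bounded_opsD: "S \<in> bounded_ops \<Longrightarrow> blinfun_apply S (cscale_ell2 c v) = cscale_ell2 c (blinfun_apply S v)"
  by (simp add: bounded_ops_def)

lemma cscale_ell2_distrib:
  "cscale_ell2 c (f + g) = cscale_ell2 c f + cscale_ell2 c g"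
  "cscale_ell2 (c + c') f = cscale_ell2 c f + cscale_ell2 c' f"
  "cscale_ell2 c (cscale_ell2 c' f) = cscale_ell2 (c * c') f"
  "cscale_ell2 1 f = f" "cscale_ell2 c 0 = 0" "cscale_ell2 0 f = 0" "cscale_ell2 (-1) f = - f"
  by (rule ell2_eqI, simp add: algebra_simps)+

lemma cscale_op_distrib:
  "cscale_op c (S + T) = cscale_op c S + cscale_op c T"
  "cscale_op (c + c') S = cscale_op c S + cscale_op c' S"
  "cscale_op c (cscale_op c' S) = cscale_op (c * c') S"
  "cscale_op 1 S = S" "cscale_op c 0 = 0" "cscale_op 0 S = 0" "cscale_op (-1) S = - S"
  by (rule blinfun_eqI, simp add: cscale_op_apply blinfun.bilinear_simps cscale_ell2_distrib)+

text \<open>Only the upper bound is direct; the lower bound is the upper bound for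
  \<open>inverse c\<close>.\<close>

lemma norm_cscale_op: "norm (cscale_op c S) = cmod c * norm S"
proof -
  have le: "norm (cscale_op c S) \<le> cmod c * norm S" for c and S :: "'a ell2 \<Rightarrow>\<^sub>L 'b ell2"
    by (rule norm_blinfun_bound)
      (auto simp: cscale_op_apply norm_cscale_ell2 mult.assoc intro!: mult_left_mono norm_blinfun)
  show ?thesis
  proof (cases "c = 0")
    case False
    have "cmod c * norm S = cmod c * norm (cscale_op (inverse c) (cscale_op c S))"
      using False by (simp add: cscale_op_distrib)
    also have "\<dots> \<le> cmod c * (cmod (inverse c) * norm (cscale_op c S))"
      by (intro mult_left_mono le) simp
    also have "\<dots> = norm (cscale_op c S)" using False by (simp add: norm_inverse)
    finally show ?thesis using le[of c S] by simp
  qed (simp add: cscale_op_distrib)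
qed

lemma scaleR_eq_cscale_op: "r *\<^sub>R S = cscale_op (of_real r) S"
  by (rule blinfun_eqI, rule ell2_eqI) (simp add: cscale_op_apply blinfun.scaleR_left)

lemma bounded_bilinear_cscale_op: "bounded_bilinear cscale_op"
proof
  show "cscale_op (a + a') b = cscale_op a b + cscale_op a' b" "cscale_op a (b + b') = cscale_op a b + cscale_op a b'"
    for a a' :: complex and b b' :: "'a ell2 \<Rightarrow>\<^sub>L 'b ell2"
    by (simp_all add: cscale_op_distrib)
  show "cscale_op (r *\<^sub>R a) b = r *\<^sub>R cscale_op a b" "cscale_op a (r *\<^sub>R b) = r *\<^sub>R cscale_op a b"
    for r a and b :: "'a ell2 \<Rightarrow>\<^sub>L 'b ell2"
    by (simp_all add: scaleR_eq_cscale_op cscale_op_distrib scaleR_conv_of_real mult.commute)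
  show "\<exists>K. \<forall>a (b :: 'a ell2 \<Rightarrow>\<^sub>L 'b ell2). norm (cscale_op a b) \<le> norm a * norm b * K"
    by (intro exI[of _ 1]) (simp add: norm_cscale_op)
qed

text \<open>Elements of the operator type are a priori real-linear, so moving a scalar past the left
  factor requires that factor to be complex-linear.\<close>

lemma cscale_op_compose:
  "S \<in> bounded_ops \<Longrightarrow> S o\<^sub>L cscale_op c T = cscale_op c (S o\<^sub>L T)"
  "cscale_op c S' o\<^sub>L T' = cscale_op c (S' o\<^sub>L T')"
  by (rule blinfun_eqI, simp add: cscale_op_apply bounded_opsD)+

lemma blinfun_compose_distrib:
  "(S + S') o\<^sub>L T = (S o\<^sub>L T) + (S' o\<^sub>L T)" "S o\<^sub>L (T + T') = (S o\<^sub>L T) + (S o\<^sub>L T')"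
  "(S - S') o\<^sub>L T = (S o\<^sub>L T) - (S' o\<^sub>L T)" "S o\<^sub>L (T - T') = (S o\<^sub>L T) - (S o\<^sub>L T')"
  "(S o\<^sub>L T) o\<^sub>L R = S o\<^sub>L (T o\<^sub>L R)" "0 o\<^sub>L T = 0" "S o\<^sub>L 0 = 0"
  by (rule blinfun_eqI, simp add: blinfun.bilinear_simps)+

lemma bounded_ops_closed_ops [simp, intro]:
  "0 \<in> bounded_ops" "id_blinfun \<in> bounded_ops"
  "S \<in> bounded_ops \<Longrightarrow> T \<in> bounded_ops \<Longrightarrow> S + T \<in> bounded_ops"
  "S \<in> bounded_ops \<Longrightarrow> cscale_op c S \<in> bounded_ops"
  "S' \<in> bounded_ops \<Longrightarrow> S \<in> bounded_ops \<Longrightarrow> S' o\<^sub>L S \<in> bounded_ops"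
  by (simp_all add: bounded_ops_def blinfun.bilinear_simps cscale_ell2_distrib cscale_op_apply mult.commute)

lemma closed_bounded_ops: "closed (bounded_ops :: ('a ell2 \<Rightarrow>\<^sub>L 'b ell2) set)"
proof -
  have eq: "(bounded_ops :: ('a ell2 \<Rightarrow>\<^sub>L 'b ell2) set)
      = (\<Inter>c. \<Inter>v. {S. blinfun_apply S (cscale_ell2 c v) = cscale_ell2 c (blinfun_apply S v)})"
    by (auto simp: bounded_ops_def)
  show ?thesis
    unfolding eq
    by (intro closed_INT ballI closed_Collect_eq continuous_on_id
        bounded_linear.continuous_on[OF bounded_linear_cscale_ell2] blinfun.continuous_on continuous_on_const)
qed

text \<open>The coordinates \<open>a v x\<close> of the adjoint vector are forced by the basis
  vectors. The point is their square-summability, which is obtained by testing \<open>S\<close> on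
  truncations.\<close>

lemma adjoint_exists:
  assumes S: "S \<in> bounded_ops"
  shows "\<exists>S'. \<forall>u v. cinner (blinfun_apply S' v) u = cinner v (blinfun_apply S u)"
proof -
  define a where "a v x = cnj (cinner v (blinfun_apply S (delta x)))" for v x
  have fin: "(\<Sum>x\<in>F. (cmod (a v x))\<^sup>2) \<le> (norm v * norm S)\<^sup>2" if F: "finite F" for F v
  proof -
    \<comment> \<open>For this truncation \<open>cinner v (S w)\<close> equals the squared norm
      \<open>q\<close> of \<open>w\<close>. Cauchy-Schwarz then gives
      \<open>q \<le> norm v * norm S * norm w\<close>, and one factor \<open>norm w\<close>
      cancels.\<close>
    define w where "w = (\<Sum>x\<in>F. cscale_ell2 (a v x) (delta x))"
    define q where "q = (\<Sum>x\<in>F. (cmod (a v x))\<^sup>2)"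
    have w: "ell2_fun w x = (if x \<in> F then a v x else 0)" for x
      unfolding w_def using F by (simp add: ell2_fun_sum ell2_fun_delta if_distrib[of "(*) _"] cong: if_cong)
    have "(norm w)\<^sup>2 = q"
      unfolding power2_norm_ell2 w q_def using F
      by (subst infsum_finite[symmetric, OF F]) (rule infsum_cong_neutral, auto)
    have "cinner v (blinfun_apply S w) = (\<Sum>x\<in>F. a v x * cinner v (blinfun_apply S (delta x)))"
      unfolding w_def by (simp add: blinfun.sum_right cinner_sum_right bounded_opsD[OF S] cinner_cscale_right)
    also have "\<dots> = (\<Sum>x\<in>F. complex_of_real ((cmod (a v x))\<^sup>2))"
      unfolding complex_norm_square by (rule sum.cong) (simp_all add: a_def mult.commute)
    also have "\<dots> = of_real q" by (simp add: q_def)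
    finally have "cinner v (blinfun_apply S w) = of_real q" .
    then have "\<bar>q\<bar> \<le> norm v * norm (blinfun_apply S w)"
      using cinner_Cauchy_Schwarz[of v "blinfun_apply S w"] by simp
    also have "\<dots> \<le> norm v * (norm S * norm w)" by (intro mult_left_mono norm_blinfun) simp
    finally have "norm w * norm w \<le> (norm v * norm S) * norm w"
      using \<open>(norm w)\<^sup>2 = q\<close> by (simp add: power2_eq_square mult.assoc)
    then have "norm w \<le> norm v * norm S"
      by (cases "norm w = 0") (simp, metis mult_right_le_imp_le norm_ge_zero order_less_le)
    then have "(norm w)\<^sup>2 \<le> (norm v * norm S)\<^sup>2" by (intro power_mono) auto
    then show ?thesis using \<open>(norm w)\<^sup>2 = q\<close> q_def by simp
  qed
  define A where "A v = Abs_ell2 (a v)" for v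
  have A: "ell2_fun (A v) x = a v x" for v x
    unfolding A_def using ell2_summableI[OF fin] by (simp add: Abs_ell2_inverse)
  have cA: "cinner (A v) u = cinner v (blinfun_apply S u)" for v u
  proof -
    \<comment> \<open>Both sides are continuous in \<open>u\<close> and agree on the finite partial
      sums of its basis expansion.\<close>
    let ?g = "\<lambda>x. cscale_ell2 (ell2_fun u x) (delta x)"
    have gen: "((\<lambda>F. h (sum ?g F)) \<longlongrightarrow> h u) (finite_subsets_at_top UNIV)" if "bounded_linear h" for h :: "_ \<Rightarrow> complex"
      using bounded_linear.tendsto[OF that] has_sum_delta_ell2[of u] unfolding has_sum_def by blast
    have "bounded_linear (\<lambda>u. cinner v (blinfun_apply S u))"
      by (intro bounded_linear_compose[OF bounded_linear_cinner] blinfun.bounded_linear_right)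
    from gen[OF this] have l2: "((\<lambda>F. cinner v (blinfun_apply S (sum ?g F))) \<longlongrightarrow> cinner v (blinfun_apply S u))
        (finite_subsets_at_top UNIV)" .
    have "cinner (A v) (delta x) = cinner v (blinfun_apply S (delta x))" for x
      using cinner_commute[of "A v" "delta x"] by (simp add: cinner_delta_left A a_def)
    then have "cinner (A v) (sum ?g F) = cinner v (blinfun_apply S (sum ?g F))" for F
      by (simp add: blinfun.sum_right cinner_sum_right bounded_opsD[OF S] cinner_cscale_right)
    then show ?thesis
      using tendsto_unique[OF finite_subsets_at_top_neq_bot gen[OF bounded_linear_cinner] , of "A v"] l2 by simp
  qed
  have "bounded_linear A"
  proof (rule bounded_linear_intro[where K = "norm S"])
    show "A (v + w) = A v + A w" for v w
      by (rule ell2_eqI) (simp add: A a_def cinner_add_left)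
    show "A (r *\<^sub>R v) = r *\<^sub>R A v" for r v
    proof -
      have r: "r *\<^sub>R v = cscale_ell2 (of_real r) v" by (rule ell2_eqI) simp
      show ?thesis by (rule ell2_eqI) (simp add: A a_def r cinner_cscale_left)
    qed
    show "norm (A v) \<le> norm v * norm S" for v
      by (rule norm_ell2_leI) (simp_all add: A fin)
  qed
  then have "blinfun_apply (Blinfun A) = A" by (rule bounded_linear_Blinfun_apply)
  then show ?thesis using cA by metis
qed

lemma adj_eqI:
  assumes "\<And>u v. cinner (blinfun_apply T v) u = cinner v (blinfun_apply S u)"
  shows "adj S = T"
  unfolding adj_def using assms
  by (intro the_equality allI) (auto intro!: blinfun_eqI cinner_ext)

lemma cinner_adj_left: "S \<in> bounded_ops \<Longrightarrow> cinner (blinfun_apply (adj S) v) u = cinner v (blinfun_apply S u)"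
  using adjoint_exists[of S] adj_eqI[of _ S] by metis

lemma cinner_adj_right: "S \<in> bounded_ops \<Longrightarrow> cinner u (blinfun_apply (adj S) v) = cinner (blinfun_apply S u) v"
  by (metis cinner_adj_left cinner_commute)

lemma adj_bounded_ops [simp, intro]: "S \<in> bounded_ops \<Longrightarrow> adj S \<in> bounded_ops"
  by (auto simp: bounded_ops_def[where 'a = 'b] cinner_adj_left cinner_cscale_left intro!: cinner_ext)

lemma adj_adj [simp]: "S \<in> bounded_ops \<Longrightarrow> adj (adj S) = S"
  by (rule adj_eqI) (simp add: cinner_adj_right)

lemma adj_add: "S \<in> bounded_ops \<Longrightarrow> T \<in> bounded_ops \<Longrightarrow> adj (S + T) = adj S + adj T"
  by (rule adj_eqI)
    (simp add: blinfun.bilinear_simps cinner_add_left cinner_add_right cinner_adj_left)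

lemma adj_cscale: "S \<in> bounded_ops \<Longrightarrow> adj (cscale_op c S) = cscale_op (cnj c) (adj S)"
  by (rule adj_eqI) (simp add: cscale_op_apply cinner_cscale_left cinner_cscale_right cinner_adj_left)

lemma adj_compose: "S \<in> bounded_ops \<Longrightarrow> T \<in> bounded_ops \<Longrightarrow> adj (S o\<^sub>L T) = adj T o\<^sub>L adj S"
  by (rule adj_eqI) (simp add: cinner_adj_left)

lemma adj_id [simp]: "adj id_blinfun = id_blinfun" and adj_0 [simp]: "adj 0 = 0"
  by (rule adj_eqI, simp)+

text \<open>\<open>1\<close> is Cauchy-Schwarz for the vectors \<open>adj S (S v)\<close> and
  \<open>v\<close>. Submultiplicativity of the norm turns it into \<open>2\<close>, and
  \<open>2\<close> for both \<open>S\<close> and \<open>adj S\<close> makes their norms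
  equal.\<close>

lemma norm_adj_compose_self:
  assumes S: "S \<in> bounded_ops"
  shows "norm (adj S o\<^sub>L S) = (norm S)\<^sup>2" and norm_adj: "norm (adj S) = norm S"
proof -
  have 1: "(norm S)\<^sup>2 \<le> norm (adj S o\<^sub>L S)" if S: "S \<in> bounded_ops" for S :: "'c ell2 \<Rightarrow>\<^sub>L 'd ell2"
  proof -
    have "norm (blinfun_apply S v) \<le> sqrt (norm (adj S o\<^sub>L S)) * norm v" for v
    proof (rule power2_le_imp_le)
      have "complex_of_real ((norm (blinfun_apply S v))\<^sup>2) = cinner (blinfun_apply (adj S o\<^sub>L S) v) v"
        by (simp add: cinner_adj_left S cinner_self)
      then have "(norm (blinfun_apply S v))\<^sup>2 = cmod (cinner (blinfun_apply (adj S o\<^sub>L S) v) v)"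
        by (metis abs_of_nonneg norm_of_real zero_le_power2)
      also have "\<dots> \<le> norm (blinfun_apply (adj S o\<^sub>L S) v) * norm v" by (rule cinner_Cauchy_Schwarz)
      also have "\<dots> \<le> (norm (adj S o\<^sub>L S) * norm v) * norm v" by (intro mult_right_mono norm_blinfun) simp
      finally show "(norm (blinfun_apply S v))\<^sup>2 \<le> (sqrt (norm (adj S o\<^sub>L S)) * norm v)\<^sup>2"
        by (simp add: power_mult_distrib power2_eq_square[of "norm v"] mult.assoc)
    qed simp
    then have "norm S \<le> sqrt (norm (adj S o\<^sub>L S))" by (intro norm_blinfun_bound) auto
    then have "(norm S)\<^sup>2 \<le> (sqrt (norm (adj S o\<^sub>L S)))\<^sup>2" by (intro power_mono) auto
    then show ?thesis by simp
  qed
  have 2: "norm S \<le> norm (adj S)" if S: "S \<in> bounded_ops" for S :: "'c ell2 \<Rightarrow>\<^sub>L 'd ell2"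
  proof -
    have "norm S * norm S \<le> norm (adj S) * norm S"
      using 1[OF S] norm_blinfun_compose[of "adj S" S] by (simp add: power2_eq_square)
    then show ?thesis by (cases "norm S = 0") (simp, metis mult_right_le_imp_le norm_ge_zero order_less_le)
  qed
  show *: "norm (adj S) = norm S" using 2[OF S] 2[OF adj_bounded_ops[OF S]] S by simp
  show "norm (adj S o\<^sub>L S) = (norm S)\<^sup>2"
    using 1[OF S] norm_blinfun_compose[of "adj S" S] * by (simp add: power2_eq_square)
qed

lemma norm_compose_adj_self: "S \<in> bounded_ops \<Longrightarrow> norm (S o\<^sub>L adj S) = (norm S)\<^sup>2"
  using norm_adj_compose_self[of "adj S"] by (simp add: norm_adj)

lemma adj_minus: "S \<in> bounded_ops \<Longrightarrow> T \<in> bounded_ops \<Longrightarrow> adj (S - T) = adj S - adj T"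
  using adj_add[of S "cscale_op (-1) T"] adj_cscale[of T "-1"] bounded_ops_closed_ops(4)[of T "-1"]
  by (simp add: cscale_op_distrib)

lemma bounded_ops_minus [simp, intro]:
  "S \<in> bounded_ops \<Longrightarrow> T \<in> bounded_ops \<Longrightarrow> S - T \<in> bounded_ops"
  using bounded_ops_closed_ops(3)[of S "cscale_op (-1) T"] bounded_ops_closed_ops(4)[of T "-1"]
  by (simp add: cscale_op_distrib)

lemma dist_adj: "S \<in> bounded_ops \<Longrightarrow> T \<in> bounded_ops \<Longrightarrow> dist (adj S) (adj T) = dist S T"
  using norm_adj[of "S - T"] by (simp add: dist_norm adj_minus)

lemma continuous_on_adj: "continuous_on bounded_ops adj"
  unfolding continuous_on_iff by (metis dist_adj)

section \<open>Norm closures of finite propagation operators\<close>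

lemma propagation_le_iff:
  "propagation_le d S L \<longleftrightarrow> (\<forall>x y. ell2_fun (blinfun_apply S (delta x)) y \<noteq> 0 \<longrightarrow> d x y \<le> L)"
  by (simp add: propagation_le_def cinner_delta_left)

lemma closed_roe_closure: "closed (roe_closure d)"
  by (simp add: roe_closure_def)

lemma roe_closure_subset: "roe_closure d \<subseteq> bounded_ops"
  unfolding roe_closure_def by (rule closure_minimal[OF _ closed_bounded_ops]) auto

text \<open>Only the sublevel sets of the two distance functions matter, so no homeomorphism of the
  half-line has to be carried along.\<close>

lemma roe_closure_mono:
  assumes "\<And>L. \<exists>L'. \<forall>x y. d1 x y \<le> L \<longrightarrow> d2 x y \<le> L'"
  shows "roe_closure d1 \<subseteq> roe_closure d2"
  unfolding roe_closure_def propagation_le_iff using assms by (intro closure_mono) blast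

text \<open>A continuous map sends the closure of \<open>A \<times> B\<close>, which is the product
  of the closures, into the closure of \<open>C\<close>.\<close>

lemma closure_binary:
  assumes "continuous_on UNIV (\<lambda>p. f (fst p) (snd p))" "\<And>s t. s \<in> A \<Longrightarrow> t \<in> B \<Longrightarrow> f s t \<in> C"
    and "s \<in> closure A" "t \<in> closure B"
  shows "f s t \<in> closure C"
proof -
  have "(\<lambda>p. f (fst p) (snd p)) ` closure (A \<times> B) \<subseteq> closure C"
    by (rule image_closure_subset)
      (use assms(1,2) closure_subset[of C] in \<open>auto intro: continuous_on_subset\<close>)
  then show ?thesis using assms(3,4) by (auto simp: closure_Times image_subset_iff)
qed

lemma roe_closure_add:
  assumes "S \<in> roe_closure d" "T \<in> roe_closure d"
  shows "S + T \<in> roe_closure d"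
  using assms unfolding roe_closure_def
proof (rule closure_binary[rotated 2])
  show "continuous_on UNIV (\<lambda>p :: ('a ell2 \<Rightarrow>\<^sub>L 'b ell2) \<times> _. fst p + snd p)" by (intro continuous_intros)
  fix S T :: "'a ell2 \<Rightarrow>\<^sub>L 'b ell2"
  assume "S \<in> {S \<in> bounded_ops. \<exists>L. propagation_le d S L}" "T \<in> {S \<in> bounded_ops. \<exists>L. propagation_le d S L}"
  then obtain K L where *: "S \<in> bounded_ops" "T \<in> bounded_ops" "propagation_le d S K" "propagation_le d T L" by blast
  have "propagation_le d (S + T) (max K L)"
    unfolding propagation_le_iff
  proof (intro allI impI)
    fix x y assume "ell2_fun (blinfun_apply (S + T) (delta x)) y \<noteq> 0"
    then have "ell2_fun (blinfun_apply S (delta x)) y \<noteq> 0 \<or> ell2_fun (blinfun_apply T (delta x)) y \<noteq> 0"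
      by (auto simp: blinfun.add_left)
    then have "d x y \<le> K \<or> d x y \<le> L" using *(3,4) by (auto simp: propagation_le_iff)
    then show "d x y \<le> max K L" by auto
  qed
  then show "S + T \<in> {S \<in> bounded_ops. \<exists>L. propagation_le d S L}" using * by blast
qed

lemma roe_closure_cscale:
  assumes "S \<in> roe_closure d"
  shows "cscale_op c S \<in> roe_closure d"
proof -
  have "cscale_op c ` closure {S \<in> bounded_ops. \<exists>L. propagation_le d S L}
      \<subseteq> closure {S \<in> bounded_ops. \<exists>L. propagation_le d S L}"
  proof (rule image_closure_subset)
    show "continuous_on (closure {S \<in> bounded_ops. \<exists>L. propagation_le d S L}) (cscale_op c)"
      by (rule bounded_linear.continuous_on[OF
            bounded_bilinear.bounded_linear_right[OF bounded_bilinear_cscale_op] continuous_on_id])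
    show "cscale_op c ` {S \<in> bounded_ops. \<exists>L. propagation_le d S L}
        \<subseteq> closure {S \<in> bounded_ops. \<exists>L. propagation_le d S L}"
    proof (rule order_trans[OF _ closure_subset], rule image_subsetI, elim CollectE conjE exE, intro CollectI conjI exI)
      fix S L assume "propagation_le d S L" "S \<in> bounded_ops"
      then show "propagation_le d (cscale_op c S) L" "cscale_op c S \<in> bounded_ops"
        by (simp_all add: propagation_le_iff cscale_op_apply)
    qed
  qed simp
  then show ?thesis using assms unfolding roe_closure_def by blast
qed

lemma roe_closure_id:
  assumes "\<And>x. d x x \<le> C"
  shows "id_blinfun \<in> roe_closure d"
proof -
  have "propagation_le d id_blinfun C"
    using assms by (auto simp: propagation_le_iff ell2_fun_delta)
  then show ?thesis unfolding roe_closure_def by (intro subsetD[OF closure_subset]) auto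
qed

lemma roe_closure_0: "0 \<in> roe_closure d"
proof -
  have "propagation_le d 0 0" by (simp add: propagation_le_iff)
  then show ?thesis unfolding roe_closure_def by (intro subsetD[OF closure_subset]) auto
qed

text \<open>Matrix multiplication for infinite matrices: the entry is the inner product of
  \<open>adj T (delta z)\<close> with \<open>v\<close>, a sum over \<open>y\<close> that vanishes if
  all its terms do.\<close>

lemma compose_entry_nonzero:
  assumes "T \<in> bounded_ops" "ell2_fun (blinfun_apply T v) z \<noteq> 0"
  shows "\<exists>y. ell2_fun (blinfun_apply T (delta y)) z \<noteq> 0 \<and> ell2_fun v y \<noteq> 0"
proof (rule ccontr)
  assume c: "\<not> ?thesis"
  have e: "ell2_fun (blinfun_apply (adj T) (delta z)) y = cnj (ell2_fun (blinfun_apply T (delta y)) z)" for y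
    by (metis assms(1) cinner_adj_right cinner_commute cinner_delta_left)
  have "ell2_fun (blinfun_apply T v) z = cinner (blinfun_apply (adj T) (delta z)) v"
    using assms(1) by (simp add: cinner_adj_left cinner_delta_left)
  also have "\<dots> = 0" unfolding cinner_def by (rule infsum_0) (use c e in auto)
  finally show False using assms(2) by simp
qed

text \<open>The assumption on the distances is a triangle inequality up to a change of bounds. As
  \<open>d1\<close>, \<open>d2\<close>, \<open>d3\<close> may live on different pairs of spaces, it
  covers the products inside the algebras, between algebra and module, and between module elements
  and adjoints.\<close>

lemma roe_closure_compose:
  assumes "T \<in> roe_closure d2" "S \<in> roe_closure d1"
    and d: "\<And>K L. \<exists>C. \<forall>x y z. d1 x y \<le> K \<longrightarrow> d2 y z \<le> L \<longrightarrow> d3 x z \<le> C"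
  shows "T o\<^sub>L S \<in> roe_closure d3"
  using assms(1,2) unfolding roe_closure_def
proof (rule closure_binary[rotated 2])
  show "continuous_on UNIV (\<lambda>p :: ('a ell2 \<Rightarrow>\<^sub>L 'b ell2) \<times> ('c ell2 \<Rightarrow>\<^sub>L 'a ell2). fst p o\<^sub>L snd p)"
    by (intro continuous_intros)
  fix T :: "'a ell2 \<Rightarrow>\<^sub>L 'b ell2" and S :: "'c ell2 \<Rightarrow>\<^sub>L 'a ell2"
  assume "T \<in> {S \<in> bounded_ops. \<exists>L. propagation_le d2 S L}" "S \<in> {S \<in> bounded_ops. \<exists>L. propagation_le d1 S L}"
  then obtain K L where *: "S \<in> bounded_ops" "T \<in> bounded_ops" "propagation_le d1 S K" "propagation_le d2 T L"
    by blast
  obtain C where C: "\<And>x y z. d1 x y \<le> K \<Longrightarrow> d2 y z \<le> L \<Longrightarrow> d3 x z \<le> C" using d by blast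
  have "propagation_le d3 (T o\<^sub>L S) C"
    unfolding propagation_le_iff
  proof (intro allI impI)
    fix x z assume "ell2_fun (blinfun_apply (T o\<^sub>L S) (delta x)) z \<noteq> 0"
    then obtain y where "ell2_fun (blinfun_apply T (delta y)) z \<noteq> 0" "ell2_fun (blinfun_apply S (delta x)) y \<noteq> 0"
      using compose_entry_nonzero[OF *(2)] by auto
    then show "d3 x z \<le> C" using *(3,4) C unfolding propagation_le_iff by blast
  qed
  then show "T o\<^sub>L S \<in> {S \<in> bounded_ops. \<exists>L. propagation_le d3 S L}" using * by blast
qed

lemma roe_closure_adj:
  assumes "S \<in> roe_closure d" and d: "\<And>L. \<exists>L'. \<forall>x y. d x y \<le> L \<longrightarrow> d' y x \<le> L'"
  shows "adj S \<in> roe_closure d'"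
proof -
  have "adj ` closure {S \<in> bounded_ops. \<exists>L. propagation_le d S L}
      \<subseteq> closure {S \<in> bounded_ops. \<exists>L. propagation_le d' S L}"
  proof (rule image_closure_subset)
    show "continuous_on (closure {S \<in> bounded_ops. \<exists>L. propagation_le d S L}) adj"
      using roe_closure_subset[of d] unfolding roe_closure_def by (rule continuous_on_subset[OF continuous_on_adj])
    have e: "ell2_fun (blinfun_apply (adj S) (delta y)) x = cnj (ell2_fun (blinfun_apply S (delta x)) y)"
      if "S \<in> bounded_ops" for S :: "'a ell2 \<Rightarrow>\<^sub>L 'b ell2" and x y
      by (metis that cinner_adj_right cinner_commute cinner_delta_left)
    have "adj S \<in> {S \<in> bounded_ops. \<exists>L. propagation_le d' S L}"
      if "S \<in> {S \<in> bounded_ops. \<exists>L. propagation_le d S L}" for S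
      using that d by (auto simp: propagation_le_iff e) metis
    then show "adj ` {S \<in> bounded_ops. \<exists>L. propagation_le d S L}
        \<subseteq> closure {S \<in> bounded_ops. \<exists>L. propagation_le d' S L}"
      using closure_subset by blast
  qed simp
  then show ?thesis using assms(1) unfolding roe_closure_def by blast
qed


section \<open>Metrics on the disjoint union\<close>

text \<open>The properties of a cross metric that are invariant under interchanging the two spaces;
  \<open>induced\<close> is \<open>left_metric\<close>, and \<open>right_metric\<close> after the interchange.\<close>

definition quadrangle :: "('x \<Rightarrow> 'y \<Rightarrow> real) \<Rightarrow> bool" where
  "quadrangle D \<longleftrightarrow> (\<forall>x y x' y'. 0 \<le> D x y \<and> D x y \<le> D x y' + D x' y' + D x' y)"

definition induced :: "('x \<Rightarrow> 'y \<Rightarrow> real) \<Rightarrow> 'y \<Rightarrow> 'y \<Rightarrow> real" where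
  "induced D y1 y2 = (if y1 = y2 then 0 else (INF u. D u y1 + D u y2))"

lemma left_metric_eq: "left_metric d = induced (cross d)"
  and right_metric_eq: "right_metric d = induced (\<lambda>y x. cross d x y)"
  by (simp_all add: fun_eq_iff left_metric_def right_metric_def induced_def cross_def)

lemma quadrangle_swap:
  assumes "quadrangle D"
  shows "quadrangle (\<lambda>y x. D x y)"
  unfolding quadrangle_def
proof (intro allI conjI)
  show "D x y \<le> D x' y + D x' y' + D x y'" for x x' y y'
    using assms[unfolded quadrangle_def, rule_format, of x y y' x'] by linarith
qed (use assms in \<open>simp add: quadrangle_def\<close>)

lemma induced_le: "quadrangle D \<Longrightarrow> induced D y1 y2 \<le> D u y1 + D u y2"
  unfolding induced_def quadrangle_def
  by (auto intro!: cINF_lower bdd_belowI2[where m = 0])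

text \<open>The infimum need not be attained. The slack 1 is harmless, because only the existence of
  some bound matters later.\<close>

lemma induced_leD:
  assumes "induced D y1 y2 \<le> L" "y1 \<noteq> y2"
  shows "\<exists>u. D u y1 + D u y2 < L + 1"
proof -
  have "(INF u. D u y1 + D u y2) < L + 1" using assms by (simp add: induced_def)
  then show ?thesis using cInf_lessD[of "range (\<lambda>u. D u y1 + D u y2)"] by auto
qed

lemma roe_closure_induced_mono:
  assumes q: "quadrangle D2" and le: "\<And>L. \<exists>L'. \<forall>x y. D1 x y \<le> L \<longrightarrow> D2 x y \<le> L'"
    and nn: "quadrangle D1"
  shows "roe_closure (induced D1) \<subseteq> roe_closure (induced D2)"
proof (rule roe_closure_mono)
  fix L
  obtain L' where L': "\<And>x y. D1 x y \<le> L + 1 \<Longrightarrow> D2 x y \<le> L'" using le by blast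
  \<comment> \<open>The bound \<open>0\<close> covers the diagonal. Off it, both legs through a
    witness \<open>u\<close> are below \<open>L + 1\<close> for \<open>D1\<close>, hence at most
    \<open>L'\<close> for \<open>D2\<close>.\<close>
  have "induced D2 y1 y2 \<le> max 0 (2 * L')" if i: "induced D1 y1 y2 \<le> L" for y1 y2
  proof (cases "y1 = y2")
    case False
    then obtain u where "D1 u y1 + D1 u y2 < L + 1" using induced_leD[OF i] by blast
    moreover have "D1 u y1 \<ge> 0" "D1 u y2 \<ge> 0" using nn unfolding quadrangle_def by blast+
    ultimately have "D2 u y1 \<le> L'" "D2 u y2 \<le> L'" by (auto intro: L')
    then show ?thesis using induced_le[OF q, of y1 y2 u] by auto
  qed (simp add: induced_def)
  then show "\<exists>L'. \<forall>x y. induced D1 x y \<le> L \<longrightarrow> induced D2 x y \<le> L'" by blast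
qed

context
  fixes D :: "'x \<Rightarrow> 'y \<Rightarrow> real"
  assumes q: "quadrangle D"
begin

lemma D_quad: "D x y \<le> D x y' + D x' y' + D x' y"
  using q unfolding quadrangle_def by blast

lemma roe_induced_id: "id_blinfun \<in> roe_closure (induced D)"
  by (rule roe_closure_id[of _ 0]) (simp add: induced_def)

lemma roe_induced_adj: "S \<in> roe_closure (induced D) \<Longrightarrow> adj S \<in> roe_closure (induced D)"
  by (erule roe_closure_adj) (auto simp: induced_def add.commute)

text \<open>A witness \<open>u\<close> for the induced distance of \<open>y\<close> and
  \<open>z\<close> yields the path \<open>x, y, u, z\<close> with three crossings, to which the
  quadrangle inequality applies.\<close>

lemma roe_induced_compose_roe:
  assumes "T \<in> roe_closure (induced D)" "S \<in> roe_closure D"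
  shows "T o\<^sub>L S \<in> roe_closure D"
proof (rule roe_closure_compose[OF assms])
  fix K L
  have "D x z \<le> max K (K + L + 1)" if xy: "D x y \<le> K" and yz: "induced D y z \<le> L" for x y z
  proof (cases "y = z")
    case False
    then obtain u where "D u y + D u z < L + 1" using induced_leD[OF yz] by blast
    then show ?thesis using xy D_quad[of x z y u] by simp
  qed (use xy in simp)
  then show "\<exists>C. \<forall>x y z. D x y \<le> K \<longrightarrow> induced D y z \<le> L \<longrightarrow> D x z \<le> C" by blast
qed

lemma roe_compose_adj:
  assumes "T \<in> roe_closure D" "S \<in> roe_closure D"
  shows "T o\<^sub>L adj S \<in> roe_closure (induced D)"
proof -
  have "adj S \<in> roe_closure (\<lambda>y x. D x y)" by (rule roe_closure_adj[OF assms(2)]) blast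
  from assms(1) this show ?thesis
  proof (rule roe_closure_compose)
    fix K L
    have "induced D x z \<le> K + L" if "D y x \<le> K" "D y z \<le> L" for x y z
      using induced_le[OF q, of x z y] that by linarith
    then show "\<exists>C. \<forall>x y z. D y x \<le> K \<longrightarrow> D y z \<le> L \<longrightarrow> induced D x z \<le> C" by blast
  qed
qed

lemma roe_induced_compose:
  assumes "T \<in> roe_closure (induced D)" "S \<in> roe_closure (induced D)"
  shows "T o\<^sub>L S \<in> roe_closure (induced D)"
proof (rule roe_closure_compose[OF assms])
  fix K L
  \<comment> \<open>\<open>K\<close> and \<open>L\<close> serve the cases in which two of the points
    coincide. The 2 is the slack of the two witnesses \<open>u\<close> and \<open>v\<close>; the
    path \<open>u, y, v, z\<close> bounds \<open>D u z\<close>.\<close>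
  have "induced D x z \<le> max K (max L (K + L + 2))" if xy: "induced D x y \<le> K" and yz: "induced D y z \<le> L" for x y z
  proof (cases "x = y \<or> y = z")
    case False
    then obtain u v where "D u x + D u y < K + 1" "D v y + D v z < L + 1"
      using induced_leD[OF xy] induced_leD[OF yz] by blast
    then show ?thesis using induced_le[OF q, of x z u] D_quad[of u z y v] by linarith
  qed (use xy yz in auto)
  then show "\<exists>C. \<forall>x y z. induced D x y \<le> K \<longrightarrow> induced D y z \<le> L \<longrightarrow> induced D x z \<le> C" by blast
qed

end

section \<open>Metrics on the union and their cross distances\<close>

lemma union_metrics_props:
  assumes "d \<in> union_metrics"
  shows "\<exists>c>0. \<forall>x y. c \<le> cross d x y" "dist x x' \<le> cross d x y + cross d x' y"
    "cross d x y \<le> dist x x' + cross d x' y' + dist y' y"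
    "quadrangle (cross d)"
proof -
  interpret Metric_space UNIV d using assms by (simp add: union_metrics_def)
  have e: "d (Inl x) (Inl x') = dist x x'" "d (Inr y) (Inr y') = dist y y'" for x x' y y'
    using assms by (simp_all add: union_metrics_def)
  show "\<exists>c>0. \<forall>x y. c \<le> cross d x y" using assms by (simp add: union_metrics_def cross_def)
  show "dist x x' \<le> cross d x y + cross d x' y"
    using triangle[of "Inl x" "Inr y" "Inl x'"] by (simp add: e cross_def commute)
  show "cross d x y \<le> dist x x' + cross d x' y' + dist y' y"
    using triangle[of "Inl x" "Inl x'" "Inr y"] triangle[of "Inl x'" "Inr y'" "Inr y"] by (simp add: e cross_def)
  show "quadrangle (cross d)"
    unfolding quadrangle_def cross_def
  proof (intro allI conjI)
    show "d (Inl x) (Inr y) \<le> d (Inl x) (Inr y') + d (Inl x') (Inr y') + d (Inl x') (Inr y)" for x y x' y'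
      using triangle[of "Inl x" "Inl x'" "Inr y"] triangle[of "Inl x" "Inr y'" "Inl x'"]
      by (simp add: commute[of "Inr y'"])
  qed simp
qed

text \<open>Up to symmetry, \<open>t\<close> lists all triangle inequalities whose corners do not
  lie in a single space; the others hold already in the two given metrics.\<close>

lemma union_metrics_of_cross:
  fixes G :: "'x::metric_space \<Rightarrow> 'y::metric_space \<Rightarrow> real"
  assumes c: "c > 0" "\<And>x y. c \<le> G x y"
    and t: "\<And>a b y. G a y \<le> dist a b + G b y" "\<And>a y z. G a z \<le> G a y + dist y z"
      "\<And>a b y. dist a b \<le> G a y + G b y" "\<And>a y z. dist y z \<le> G a y + G a z"
  shows "\<exists>d\<in>union_metrics. cross d = G"
proof -
  define d :: "'x + 'y \<Rightarrow> 'x + 'y \<Rightarrow> real" where "d = (\<lambda>p q. case (p, q) of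
      (Inl x, Inl x') \<Rightarrow> dist x x' | (Inr y, Inr y') \<Rightarrow> dist y y'
    | (Inl x, Inr y) \<Rightarrow> G x y | (Inr y, Inl x) \<Rightarrow> G x y)"
  have e: "d (Inl a) (Inl b) = dist a b" "d (Inr y) (Inr z) = dist y z"
    "d (Inl a) (Inr y) = G a y" "d (Inr y) (Inl a) = G a y"
    for a b y z by (simp_all add: d_def)
  have pos: "G x y > 0" for x y using c less_le_trans by blast
  have "Metric_space UNIV d"
  proof
    fix p q r
    show "0 \<le> d p q" by (cases p; cases q) (simp_all add: e less_imp_le[OF pos])
    show "d p q = d q p" by (cases p; cases q) (simp_all add: e dist_commute)
    show "d p q = 0 \<longleftrightarrow> p = q" by (cases p; cases q) (simp_all add: e pos[THEN less_imp_neq, symmetric])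
    show "d p r \<le> d p q + d q r"
    proof (cases p; cases q; cases r)
      fix a y z assume "p = Inr y" "q = Inr z" "r = Inl a"
      then show ?thesis using t(2)[of a y z] by (simp add: e dist_commute)
    next
      fix y b c assume "p = Inr y" "q = Inl b" "r = Inl c"
      then show ?thesis using t(1)[of c y b] by (simp add: e dist_commute)
    qed (simp_all add: e t dist_triangle)
  qed
  then have "d \<in> union_metrics" unfolding union_metrics_def using c e by auto
  moreover have "cross d = G" by (simp add: cross_def e fun_eq_iff)
  ultimately show ?thesis by blast
qed

text \<open>The largest admissible cross metric with prescribed upper bounds \<open>h x y\<close> for \<open>(x, y) \<in> K\<close>;
  it exists as soon as these bounds do not violate the triangle inequalities.\<close>

lemma union_metrics_glue:
  fixes K :: "('x::metric_space \<times> 'y::metric_space) set" and h :: "'x \<times> 'y \<Rightarrow> real"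
  assumes K: "K \<noteq> {}" and c: "c > 0" "\<And>k. k \<in> K \<Longrightarrow> c \<le> h k"
    and X: "\<And>k l. k \<in> K \<Longrightarrow> l \<in> K \<Longrightarrow> dist (fst k) (fst l) \<le> h k + h l + dist (snd k) (snd l)"
    and Y: "\<And>k l. k \<in> K \<Longrightarrow> l \<in> K \<Longrightarrow> dist (snd k) (snd l) \<le> h k + h l + dist (fst k) (fst l)"
  defines "G \<equiv> \<lambda>x y. INF k\<in>K. dist x (fst k) + h k + dist (snd k) y"
  shows "\<exists>d\<in>union_metrics. cross d = G" and "k \<in> K \<Longrightarrow> G x y \<le> dist x (fst k) + h k + dist (snd k) y"
    and "c \<le> G x y" and "\<exists>k\<in>K. dist x (fst k) + h k + dist (snd k) y < G x y + 1"
proof -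
  let ?t = "\<lambda>x y k. dist x (fst k) + h k + dist (snd k) y"
  have ct: "c \<le> ?t x y k" if "k \<in> K" for x y k
    using c(2)[OF that] zero_le_dist[of x "fst k"] zero_le_dist[of "snd k" y] by linarith
  have G_le: "G x y \<le> ?t x y k" if "k \<in> K" for k x y
    unfolding G_def by (rule cINF_lower[OF _ that]) (auto intro!: bdd_belowI2[where m = c] ct)
  have G_ge: "b \<le> G x y" if "\<And>k. k \<in> K \<Longrightarrow> b \<le> ?t x y k" for b x y
    unfolding G_def by (rule cINF_greatest[OF K that])
  show "k \<in> K \<Longrightarrow> G x y \<le> ?t x y k" by (rule G_le)
  show cG: "c \<le> G x y" for x y by (rule G_ge[OF ct])
  show "\<exists>k\<in>K. ?t x y k < G x y + 1"
    using cInf_lessD[of "?t x y ` K" "G x y + 1"] K unfolding G_def by auto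
  show "\<exists>d\<in>union_metrics. cross d = G"
  proof (rule union_metrics_of_cross[OF c(1)])
    fix a b :: 'x and y z :: 'y
    show "c \<le> G a y" by (rule cG)
    have "G a y - dist a b \<le> ?t b y k" if "k \<in> K" for k
      using G_le[OF that, of a y] dist_triangle[of a "fst k" b] by simp
    then show "G a y \<le> dist a b + G b y" using G_ge[of "G a y - dist a b" b y] by simp
    have "G a z - dist y z \<le> ?t a y k" if "k \<in> K" for k
      using G_le[OF that, of a z] dist_triangle[of "snd k" z y] by simp
    then show "G a z \<le> G a y + dist y z" using G_ge[of "G a z - dist y z" a y] by simp
    \<comment> \<open>The path runs from \<open>a\<close> through \<open>fst k\<close> and
      \<open>fst l\<close> to \<open>b\<close>. Assumption \<open>X\<close> bounds the middle part,
      and \<open>dist (snd k) (snd l)\<close> is bounded through \<open>y\<close>. The infima over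
      \<open>l\<close> and over \<open>k\<close> are then taken one after the other.\<close>
    have "dist a b - ?t a y k \<le> ?t b y l" if "k \<in> K" "l \<in> K" for k l
      using X[OF that] dist_triangle[of a b "fst k"] dist_triangle[of "fst k" b "fst l"]
        dist_triangle3[of "snd k" "snd l" y] by (simp add: dist_commute)
    then have "dist a b - ?t a y k \<le> G b y" if "k \<in> K" for k using that by (intro G_ge)
    then have "dist a b - G b y \<le> G a y" by (intro G_ge) (simp add: algebra_simps)
    then show "dist a b \<le> G a y + G b y" by simp
    have "dist y z - ?t a y k \<le> ?t a z l" if "k \<in> K" "l \<in> K" for k l
      using Y[OF that] dist_triangle[of y z "snd k"] dist_triangle[of "snd k" z "snd l"]
        dist_triangle[of "fst k" "fst l" a] by (simp add: dist_commute)
    then have "dist y z - ?t a y k \<le> G a z" if "k \<in> K" for k using that by (intro G_ge)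
    then have "dist y z - G a z \<le> G a y" by (intro G_ge) (simp add: algebra_simps)
    then show "dist y z \<le> G a y + G a z" by simp
  qed
qed

section \<open>The coarse order: least class and bounded joins\<close>

lemma coarse_le_iff_cross:
  "coarse_le d1 d2 \<longleftrightarrow> (\<exists>\<phi> \<phi>'. homeomorphism {0::real..} {0..} \<phi> \<phi>' \<and>
     (\<forall>x y. cross d2 x y \<le> \<phi> (cross d1 x y)))"
  by (simp add: coarse_le_def cross_def)

lemma cross_nonneg: "d \<in> union_metrics \<Longrightarrow> 0 \<le> cross d x y"
  by (simp add: cross_def union_metricsD)

lemma homeomorphism_halfline_leD:
  fixes \<phi> \<phi>' :: "real \<Rightarrow> real"
  assumes "homeomorphism {0..} {0..} \<phi> \<phi>'" "0 \<le> s" "s \<le> t"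
  shows "\<phi> s \<le> \<phi> t"
  using strict_mono_on_leD[OF homeomorphism_halfline_mono[OF assms(1)], of s t] assms(2,3) by simp

text \<open>Monotonicity of the homeomorphism turns the coarse order into the sublevel-set condition
  of \<open>roe_closure_mono\<close>.\<close>

lemma coarse_le_bounded:
  assumes d: "d1 \<in> union_metrics" and le: "coarse_le d1 d2"
  shows "\<exists>L'. \<forall>x y. cross d1 x y \<le> L \<longrightarrow> cross d2 x y \<le> L'"
proof -
  obtain \<phi> \<phi>' where h: "homeomorphism {0::real..} {0..} \<phi> \<phi>'"
    and b: "\<And>x y. cross d2 x y \<le> \<phi> (cross d1 x y)"
    using le unfolding coarse_le_iff_cross by blast
  have "cross d2 x y \<le> \<phi> L" if "cross d1 x y \<le> L" for x y
    using b[of x y] homeomorphism_halfline_leD[OF h cross_nonneg[OF d] that] by linarith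
  then show ?thesis by blast
qed

lemma homeomorphism_halfline_mult:
  fixes k :: real
  assumes "k > 0"
  shows "homeomorphism {0..} {0..} (\<lambda>t. k * t) (\<lambda>t. t / k)"
  using assms by (intro homeomorphismI) (auto intro!: continuous_intros)

lemma coarse_le_least:
  "\<exists>d0\<in>(union_metrics :: ('x::metric_space + 'y::metric_space \<Rightarrow> _) set). \<forall>d\<in>union_metrics. coarse_le d0 d"
proof -
  obtain x0 :: 'x and y0 :: 'y where True by blast
  \<comment> \<open>Gluing the two spaces along the single pair \<open>(x0, y0)\<close> at distance
    1 gives the metric of the smallest class.\<close>
  let ?G = "\<lambda>x y. INF k\<in>{(x0, y0)}. dist x (fst k) + 1 + dist (snd k) y"
  obtain d0 where d0: "d0 \<in> union_metrics" "cross d0 = ?G"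
    using union_metrics_glue(1)[of "{(x0, y0)}" 1 "\<lambda>_. 1"] by auto
  have "coarse_le d0 d" if d: "d \<in> union_metrics" for d
  proof -
    \<comment> \<open>The detour through \<open>x0\<close> and \<open>y0\<close> costs at most
      \<open>k - 1\<close> more than its two legs. Since \<open>k \<ge> 1\<close> and
      \<open>d0\<close> contains the summand 1, multiplication by \<open>k\<close> absorbs
      this.\<close>
    define k where "k = 1 + cross d x0 y0"
    have k: "k \<ge> 1" using cross_nonneg[OF d] by (simp add: k_def)
    have "cross d x y \<le> k * cross d0 x y" for x y
    proof -
      have "cross d x y \<le> dist x x0 + (k - 1) + dist y0 y"
        using union_metrics_props(3)[OF d, of x y x0 y0] by (simp add: k_def)
      also have "\<dots> \<le> k * dist x x0 + k * 1 + k * dist y0 y"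
        using k mult_right_mono[of 1 k "dist x x0"] mult_right_mono[of 1 k "dist y0 y"] by simp
      finally show ?thesis by (simp add: d0 algebra_simps)
    qed
    then show ?thesis
      unfolding coarse_le_iff_cross using homeomorphism_halfline_mult[of k] k by force
  qed
  then show ?thesis using d0 by blast
qed

text \<open>Any upper bound of \<open>d1\<close> and \<open>d2\<close> is at most \<open>\<psi> \<circ> min d1 d2\<close> for some homeomorphism \<open>\<psi>\<close>.  So
  \<open>\<psi> \<circ> min d1 d2\<close> does not violate the triangle inequalities, and the metric glued from it
  represents the join.\<close>

lemma coarse_le_bounded_join:
  fixes d1 d2 d3 :: "'x::metric_space + 'y::metric_space \<Rightarrow> 'x + 'y \<Rightarrow> real"
  assumes d: "d1 \<in> union_metrics" "d2 \<in> union_metrics" "d3 \<in> union_metrics"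
    and le: "coarse_le d1 d3" "coarse_le d2 d3"
  shows "\<exists>j\<in>union_metrics. coarse_le d1 j \<and> coarse_le d2 j \<and>
    (\<forall>d\<in>union_metrics. coarse_le d1 d \<longrightarrow> coarse_le d2 d \<longrightarrow> coarse_le j d)"
proof -
  define m where "m k = min (cross d1 (fst k) (snd k)) (cross d2 (fst k) (snd k))" for k
  have m0: "0 \<le> m k" for k using d by (simp add: m_def cross_nonneg)
  have bound: "\<exists>\<psi> \<psi>'. homeomorphism {0::real..} {0..} \<psi> \<psi>' \<and> (\<forall>k. cross e (fst k) (snd k) \<le> \<psi> (m k))"
    if e: "coarse_le d1 e" "coarse_le d2 e" for e
  proof -
    obtain \<phi>1 \<phi>1' \<phi>2 \<phi>2' where h: "homeomorphism {0::real..} {0..} \<phi>1 \<phi>1'" "homeomorphism {0::real..} {0..} \<phi>2 \<phi>2'"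
      and b: "\<And>x y. cross e x y \<le> \<phi>1 (cross d1 x y)" "\<And>x y. cross e x y \<le> \<phi>2 (cross d2 x y)"
      using e unfolding coarse_le_iff_cross by blast
    obtain \<theta> where t: "homeomorphism {0..} {0..} (\<lambda>t. \<phi>1 t + \<phi>2 t) \<theta>"
      using homeomorphism_halfline_add[OF h] by blast
    \<comment> \<open>\<open>m k\<close> is one of the two distances, and the homeomorphism
      belonging to the other one only adds a nonnegative term.\<close>
    have "cross e (fst k) (snd k) \<le> \<phi>1 (m k) + \<phi>2 (m k)" for k
      using b[of "fst k" "snd k"] homeomorphism_halflineD(1)[OF h(1) m0[of k]]
        homeomorphism_halflineD(1)[OF h(2) m0[of k]]
      by (cases "cross d1 (fst k) (snd k) \<le> cross d2 (fst k) (snd k)") (auto simp: m_def)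
    then show ?thesis using t by blast
  qed
  obtain \<psi> \<psi>' where h: "homeomorphism {0::real..} {0..} \<psi> \<psi>'"
    and b: "\<And>k. cross d3 (fst k) (snd k) \<le> \<psi> (m k)" using bound[OF le] by blast
  obtain c where c: "c > 0" "\<And>x y. c \<le> cross d3 x y" using union_metrics_props(1)[OF d(3)] by blast
  let ?G = "\<lambda>x y. INF k. dist x (fst k) + \<psi> (m k) + dist (snd k) y"
  \<comment> \<open>The inequalities required for gluing hold for the upper bound \<open>d3\<close>
    itself, and \<open>\<psi> (m k)\<close> dominates it.\<close>
  have A1: "c \<le> \<psi> (m k)" for k using c(2) b order_trans by blast
  have A2: "dist (fst k) (fst l) \<le> \<psi> (m k) + \<psi> (m l) + dist (snd k) (snd l)" for k l
    using union_metrics_props(2)[OF d(3), of "fst k" "fst l" "snd k"] b[of k] b[of l]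
      union_metrics_props(3)[OF d(3), of "fst l" "snd k" "fst l" "snd l"] by (simp add: dist_commute)
  have A3: "dist (snd k) (snd l) \<le> \<psi> (m k) + \<psi> (m l) + dist (fst k) (fst l)" for k l
  proof -
    interpret Metric_space UNIV d3 using d(3) by (simp add: union_metrics_def)
    have e: "d3 (Inl x) (Inl x') = dist x x'" "d3 (Inr y) (Inr y') = dist y y'" for x x' y y'
      using d(3) by (simp_all add: union_metrics_def)
    show ?thesis
      using triangle[of "Inr (snd k)" "Inl (fst k)" "Inr (snd l)"] triangle[of "Inl (fst k)" "Inl (fst l)" "Inr (snd l)"]
        b[of k] b[of l] by (simp add: e cross_def commute[of "Inr (snd k)"])
  qed
  have A: "(UNIV :: ('x \<times> 'y) set) \<noteq> {}" by simp
  note glue = union_metrics_glue[OF A c(1) A1 A2 A3]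
  obtain j where j: "j \<in> union_metrics" "cross j = ?G" using glue(1) by blast
  have Gm: "?G x y \<le> \<psi> (m (x, y))" for x y using glue(2)[of "(x, y)" x y] by simp
  have "coarse_le d1 j" "coarse_le d2 j"
    unfolding coarse_le_iff_cross j(2)
    by (intro exI[of _ \<psi>] exI[of _ \<psi>'] conjI allI h order_trans[OF Gm] homeomorphism_halfline_leD[OF h m0],
        simp add: m_def)+
  moreover have "coarse_le j e" if e: "e \<in> union_metrics" "coarse_le d1 e" "coarse_le d2 e" for e
  proof -
    obtain \<phi> \<phi>' where p: "homeomorphism {0::real..} {0..} \<phi> \<phi>'"
      and pb: "\<And>k. cross e (fst k) (snd k) \<le> \<phi> (m k)" using bound[OF e(2,3)] by blast
    \<comment> \<open>A homeomorphism of the half-line fixes \<open>0\<close>, so the slack 1 of the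
      infimum cannot simply be added. As the glued distances are at least \<open>c\<close>,
      multiplication by \<open>K\<close> absorbs it.\<close>
    define K where "K = 1 + 1 / c"
    have K: "K > 0" using c(1) by (simp add: K_def add_pos_pos)
    note hK = homeomorphism_halfline_mult[OF K]
    note comp = homeomorphism_compose[OF homeomorphism_compose[OF hK homeomorphism_symD[OF h]] p]
    \<comment> \<open>The first summand pays for the legs to a nearly optimal \<open>k\<close>. In
      the second, \<open>\<psi>'\<close> recovers a bound on \<open>m k\<close>, to which
      \<open>\<phi>\<close> is applied.\<close>
    obtain \<theta> where t: "homeomorphism {0..} {0..} (\<lambda>t. K * t + (\<phi> \<circ> (\<psi>' \<circ> (*) K)) t) \<theta>"
      using homeomorphism_halfline_add[OF hK comp] by blast
    have "cross e x y \<le> K * ?G x y + \<phi> (\<psi>' (K * ?G x y))" for x y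
    proof -
      obtain k where k: "dist x (fst k) + \<psi> (m k) + dist (snd k) y < ?G x y + 1"
        using glue(4)[of x y] by blast
      have "c \<le> ?G x y" by (rule glue(3))
      then have GK: "?G x y + 1 \<le> K * ?G x y" using c(1) by (simp add: K_def distrib_right)
      have \<psi>0: "0 \<le> \<psi> (m k)" by (rule homeomorphism_halflineD(1)[OF h m0])
      have "\<psi> (m k) \<le> K * ?G x y" using k GK zero_le_dist[of x "fst k"] zero_le_dist[of "snd k" y] by linarith
      then have "\<psi>' (\<psi> (m k)) \<le> \<psi>' (K * ?G x y)"
        by (rule homeomorphism_halfline_leD[OF homeomorphism_symD[OF h] \<psi>0])
      then have "m k \<le> \<psi>' (K * ?G x y)" using homeomorphism_halflineD(3)[OF h m0] by simp
      then have "\<phi> (m k) \<le> \<phi> (\<psi>' (K * ?G x y))" by (rule homeomorphism_halfline_leD[OF p m0])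
      then show ?thesis
        using union_metrics_props(3)[OF e(1), of x y "fst k" "snd k"] pb[of k] k GK \<psi>0 by linarith
    qed
    then show ?thesis unfolding coarse_le_iff_cross j(2) using t by (intro exI conjI) auto
  qed
  ultimately show ?thesis using j(1) by blast
qed

section \<open>Operator spaces indexed by coarse classes\<close>

definition class_M where "class_M a = roe_closure (cross (rep_coarse_class a))"
definition class_A where "class_A a = roe_closure (left_metric (rep_coarse_class a))"
definition class_B where "class_B a = roe_closure (right_metric (rep_coarse_class a))"

lemma rep_coarse_class_in: "rep_coarse_class a \<in> union_metrics"
  using Quotient3_rep_reflp[OF Quotient3_coarse_class, of a] by simp

lemma abs_coarse_class_le_iff:
  "d1 \<in> union_metrics \<Longrightarrow> d2 \<in> union_metrics \<Longrightarrow> abs_coarse_class d1 \<le> abs_coarse_class d2 \<longleftrightarrow> coarse_le d1 d2"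
  by (rule less_eq_coarse_class.abs_eq) (simp_all add: coarse_equiv_iff coarse_le_refl)

lemma abs_rep_coarse_class: "abs_coarse_class (rep_coarse_class a) = a"
  by (rule Quotient3_abs_rep[OF Quotient3_coarse_class])

lemma abs_coarse_class_surj: "\<exists>d\<in>union_metrics. a = abs_coarse_class d"
  using rep_coarse_class_in abs_rep_coarse_class by metis

lemma class_mono:
  assumes "a \<le> b"
  shows "class_M a \<subseteq> class_M b" "class_A a \<subseteq> class_A b" "class_B a \<subseteq> class_B b"
proof -
  have le: "coarse_le (rep_coarse_class a) (rep_coarse_class b)"
    using assms by (simp add: less_eq_coarse_class.rep_eq)
  note B = coarse_le_bounded[OF rep_coarse_class_in le]
  note Q = union_metrics_props(4)[OF rep_coarse_class_in]
  show "class_M a \<subseteq> class_M b" unfolding class_M_def by (rule roe_closure_mono) (rule B)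
  show "class_A a \<subseteq> class_A b" unfolding class_A_def left_metric_eq
    by (rule roe_closure_induced_mono[OF Q _ Q]) (rule B)
  show "class_B a \<subseteq> class_B b" unfolding class_B_def right_metric_eq
    by (rule roe_closure_induced_mono[OF quadrangle_swap[OF Q] _ quadrangle_swap[OF Q]]) (use B in blast)
qed

text \<open>Equivalent metrics bound each other on sublevel sets in both directions, so the
  representative chosen in \<open>class_M\<close>, \<open>class_A\<close> and \<open>class_B\<close>
  does not matter.\<close>

lemma class_abs:
  assumes d: "d \<in> union_metrics"
  shows "class_M (abs_coarse_class d) = roe_closure (cross d)"
    "class_A (abs_coarse_class d) = roe_closure (left_metric d)"
    "class_B (abs_coarse_class d) = roe_closure (right_metric d)"
proof -
  let ?e = "rep_coarse_class (abs_coarse_class d)"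
  have e: "?e \<in> union_metrics" by (rule rep_coarse_class_in)
  have "abs_coarse_class ?e = abs_coarse_class d" by (rule abs_rep_coarse_class)
  then have "coarse_le d ?e" "coarse_le ?e d"
    using abs_coarse_class_le_iff[OF d e] abs_coarse_class_le_iff[OF e d] by simp_all
  note B = coarse_le_bounded[OF d this(1)] coarse_le_bounded[OF e this(2)]
  note Q = union_metrics_props(4)[OF d] union_metrics_props(4)[OF e]
  note Qs = Q[THEN quadrangle_swap]
  show "class_M (abs_coarse_class d) = roe_closure (cross d)"
    unfolding class_M_def by (intro equalityI roe_closure_mono B)
  show "class_A (abs_coarse_class d) = roe_closure (left_metric d)"
    unfolding class_A_def left_metric_eq by (intro equalityI roe_closure_induced_mono Q B)
  show "class_B (abs_coarse_class d) = roe_closure (right_metric d)"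
    unfolding class_B_def right_metric_eq
    by (intro equalityI roe_closure_induced_mono Qs) (use B in blast)+
qed

lemma class_least: "\<exists>z. \<forall>a :: ('x::metric_space, 'y::metric_space) coarse_class. z \<le> a"
  using coarse_le_least abs_coarse_class_surj abs_coarse_class_le_iff by metis

lemma class_bounded_join:
  fixes a b c :: "('x::metric_space, 'y::metric_space) coarse_class"
  assumes "a \<le> c" "b \<le> c"
  shows "\<exists>j. a \<le> j \<and> b \<le> j \<and> (\<forall>k. a \<le> k \<longrightarrow> b \<le> k \<longrightarrow> j \<le> k)"
proof -
  note in_um = rep_coarse_class_in[where ?'a = 'x and ?'b = 'y]
  have "coarse_le (rep_coarse_class a) (rep_coarse_class c)" "coarse_le (rep_coarse_class b) (rep_coarse_class c)"
    using assms by (simp_all add: less_eq_coarse_class.rep_eq)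
  from coarse_le_bounded_join[OF in_um in_um in_um this] obtain j where j: "j \<in> union_metrics"
      "coarse_le (rep_coarse_class a) j" "coarse_le (rep_coarse_class b) j"
      "\<And>d. d \<in> union_metrics \<Longrightarrow> coarse_le (rep_coarse_class a) d \<Longrightarrow> coarse_le (rep_coarse_class b) d \<Longrightarrow> coarse_le j d"
    by blast
  have "a \<le> abs_coarse_class j" "b \<le> abs_coarse_class j"
    using j(2,3) abs_coarse_class_le_iff[OF in_um j(1)] by (metis abs_rep_coarse_class)+
  moreover have "abs_coarse_class j \<le> k" if "a \<le> k" "b \<le> k" for k
    using that j(4)[OF in_um, of k] abs_coarse_class_le_iff[OF j(1) in_um, of k]
    by (simp add: less_eq_coarse_class.rep_eq[symmetric] abs_rep_coarse_class)
  ultimately show ?thesis by blast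
qed

lemma closed_class: "closed (class_M a)" "closed (class_A a)" "closed (class_B a)"
  by (simp_all add: class_M_def class_A_def class_B_def closed_roe_closure)

lemma class_subset: "class_M a \<subseteq> bounded_ops" "class_A a \<subseteq> bounded_ops" "class_B a \<subseteq> bounded_ops"
  by (simp_all add: class_M_def class_A_def class_B_def roe_closure_subset)

lemma class_linear:
  "0 \<in> class_M a" "0 \<in> class_A a" "0 \<in> class_B a"
  "S \<in> class_M a \<Longrightarrow> S' \<in> class_M a \<Longrightarrow> S + S' \<in> class_M a"
  "T \<in> class_A a \<Longrightarrow> T' \<in> class_A a \<Longrightarrow> T + T' \<in> class_A a"
  "R \<in> class_B a \<Longrightarrow> R' \<in> class_B a \<Longrightarrow> R + R' \<in> class_B a"
  "S \<in> class_M a \<Longrightarrow> cscale_op c S \<in> class_M a"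
  "T \<in> class_A a \<Longrightarrow> cscale_op c T \<in> class_A a"
  "R \<in> class_B a \<Longrightarrow> cscale_op c R \<in> class_B a"
  by (simp_all add: class_M_def class_A_def class_B_def roe_closure_0 roe_closure_add roe_closure_cscale)

lemma class_star_algebra:
  "id_blinfun \<in> class_A a" "id_blinfun \<in> class_B a"
  "T \<in> class_A a \<Longrightarrow> adj T \<in> class_A a"
  "R \<in> class_B a \<Longrightarrow> adj R \<in> class_B a"
  "T \<in> class_A a \<Longrightarrow> T' \<in> class_A a \<Longrightarrow> T o\<^sub>L T' \<in> class_A a"
  "R \<in> class_B a \<Longrightarrow> R' \<in> class_B a \<Longrightarrow> R o\<^sub>L R' \<in> class_B a"
  using union_metrics_props(4)[OF rep_coarse_class_in, of a]
  by (simp_all add: class_A_def class_B_def left_metric_eq right_metric_eq roe_induced_id roe_induced_adj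
      roe_induced_compose quadrangle_swap)

text \<open>The two statements about \<open>class_B\<close> are those about \<open>class_A\<close>
  for the interchanged spaces, carried over by taking adjoints.\<close>

lemma class_bimodule:
  "T \<in> class_A a \<Longrightarrow> S \<in> class_M a \<Longrightarrow> T o\<^sub>L S \<in> class_M a"
  "S \<in> class_M a \<Longrightarrow> S' \<in> class_M a \<Longrightarrow> S o\<^sub>L adj S' \<in> class_A a"
  "S \<in> class_M a \<Longrightarrow> R \<in> class_B a \<Longrightarrow> S o\<^sub>L R \<in> class_M a"
  "S \<in> class_M a \<Longrightarrow> S' \<in> class_M a \<Longrightarrow> adj S o\<^sub>L S' \<in> class_B a"
proof -
  let ?D = "cross (rep_coarse_class a)"
  have q: "quadrangle ?D" by (rule union_metrics_props(4)[OF rep_coarse_class_in])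
  note q' = quadrangle_swap[OF q]
  have sw: "adj S \<in> roe_closure (\<lambda>y x. ?D x y)" if "S \<in> roe_closure ?D" for S
    by (rule roe_closure_adj[OF that]) blast
  have sw': "adj S \<in> roe_closure ?D" if "S \<in> roe_closure (\<lambda>y x. ?D x y)" for S
    by (rule roe_closure_adj[OF that]) blast
  show "T \<in> class_A a \<Longrightarrow> S \<in> class_M a \<Longrightarrow> T o\<^sub>L S \<in> class_M a"
    unfolding class_A_def class_M_def left_metric_eq by (rule roe_induced_compose_roe[OF q])
  show "S \<in> class_M a \<Longrightarrow> S' \<in> class_M a \<Longrightarrow> S o\<^sub>L adj S' \<in> class_A a"
    unfolding class_A_def class_M_def left_metric_eq by (rule roe_compose_adj[OF q])
  show "S o\<^sub>L R \<in> class_M a" if "S \<in> class_M a" "R \<in> class_B a"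
  proof -
    have "S \<in> bounded_ops" "R \<in> bounded_ops" using that class_subset by blast+
    then have "S o\<^sub>L R = adj (adj R o\<^sub>L adj S)" by (simp add: adj_compose)
    moreover have "adj R o\<^sub>L adj S \<in> roe_closure (\<lambda>y x. ?D x y)"
      using that class_star_algebra(4)[of R a] sw[of S] roe_induced_compose_roe[OF q', of "adj R" "adj S"]
      unfolding class_B_def class_M_def right_metric_eq by blast
    ultimately show ?thesis using sw' unfolding class_M_def by simp
  qed
  show "adj S o\<^sub>L S' \<in> class_B a" if "S \<in> class_M a" "S' \<in> class_M a"
  proof -
    have "S' \<in> bounded_ops" using that class_subset by blast
    then show ?thesis
      using that sw[of S] sw[of S'] roe_compose_adj[OF q', of "adj S" "adj S'"]
      unfolding class_B_def class_M_def right_metric_eq by simp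
  qed
qed

section \<open>Bounded continuous maps on a poset\<close>

definition cb :: "'e::real_normed_vector set \<Rightarrow> ('p::order \<Rightarrow> 'e) set" where
  "cb S = {f. continuous_map poset_topology euclidean f \<and> bounded (range f) \<and> range f \<subseteq> S}"

text \<open>Merges \<open>linear_subspace\<close> and \<open>norm_closed_in\<close> and expresses
  limits in the sup norm as uniform limits. The scalar multiplication \<open>sc\<close> is a
  parameter, so that complex functions and operator-valued maps are both covered.\<close>

definition closed_subspace ::
  "(complex \<Rightarrow> 'e \<Rightarrow> 'e) \<Rightarrow> 'e::real_normed_vector set \<Rightarrow> ('p::order \<Rightarrow> 'e) set \<Rightarrow> bool" where
  "closed_subspace sc S N \<longleftrightarrow> N \<subseteq> cb S \<and> (\<lambda>_. 0) \<in> N \<and>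
     (\<forall>f\<in>N. \<forall>g\<in>N. (\<lambda>b. f b + g b) \<in> N) \<and> (\<forall>c. \<forall>f\<in>N. (\<lambda>b. sc c (f b)) \<in> N) \<and>
     (\<forall>s l. (\<forall>n. s n \<in> N) \<longrightarrow> uniform_limit UNIV s l sequentially \<longrightarrow> l \<in> N)"

lemma closed_subspaceD:
  assumes "closed_subspace sc S N"
  shows "f \<in> N \<Longrightarrow> f \<in> cb S" "(\<lambda>_. 0) \<in> N" "f \<in> N \<Longrightarrow> g \<in> N \<Longrightarrow> (\<lambda>b. f b + g b) \<in> N"
    "f \<in> N \<Longrightarrow> (\<lambda>b. sc c (f b)) \<in> N"
    "(\<And>n. s n \<in> N) \<Longrightarrow> uniform_limit UNIV s l sequentially \<Longrightarrow> l \<in> N"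
  using assms unfolding closed_subspace_def by blast+

lemma cb_bounded: "f \<in> cb S \<Longrightarrow> \<exists>B. \<forall>b. norm (f b) \<le> B"
  by (auto simp: cb_def bounded_iff)

text \<open>The common shape of the density arguments below: a property that survives linear
  combinations and uniform limits cuts out a closed subspace, hence spreads from generators to
  everything they generate.\<close>

lemma closed_subspace_CollectI:
  assumes N: "closed_subspace sc S N" and zero: "P (\<lambda>_. 0)"
    and add: "\<And>f g. f \<in> N \<Longrightarrow> g \<in> N \<Longrightarrow> P f \<Longrightarrow> P g \<Longrightarrow> P (\<lambda>b. f b + g b)"
    and scale: "\<And>c f. f \<in> N \<Longrightarrow> P f \<Longrightarrow> P (\<lambda>b. sc c (f b))"
    and lim: "\<And>s l. (\<And>n. s n \<in> N) \<Longrightarrow> (\<And>n. P (s n)) \<Longrightarrow> l \<in> N \<Longrightarrow>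
      uniform_limit UNIV s l sequentially \<Longrightarrow> P l"
  shows "closed_subspace sc S {m \<in> N. P m}"
  unfolding closed_subspace_def
proof (intro conjI allI ballI impI)
  fix s l assume s: "\<forall>n. s n \<in> {m \<in> N. P m}" and l: "uniform_limit UNIV s l sequentially"
  have "l \<in> N" by (rule closed_subspaceD(5)[OF N _ l]) (use s in blast)
  moreover have "P l" by (rule lim[OF _ _ \<open>l \<in> N\<close> l]) (use s in blast)+
  ultimately show "l \<in> {m \<in> N. P m}" by blast
qed (use closed_subspaceD[OF N] zero add scale in auto)

lemma topspace_poset_topology [simp]: "topspace poset_topology = UNIV"
  by (auto simp: poset_topology_def)

lemma clopen_atLeast:
  "openin poset_topology {a..}" "openin poset_topology (- {a..})"
  unfolding poset_topology_def by (rule topology_generated_by_Basis, blast)+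

lemma continuous_map_euclidean_iff:
  "continuous_map X euclidean f \<longleftrightarrow> (\<forall>x\<in>topspace X. (f \<longlongrightarrow> f x) (atin X x))"
  by (simp add: continuous_map_atin)

lemma cb_in: "f \<in> cb S \<Longrightarrow> f b \<in> S"
  and cb_tendsto: "f \<in> cb S \<Longrightarrow> (f \<longlongrightarrow> f b) (atin poset_topology b)"
  by (auto simp: cb_def continuous_map_euclidean_iff)

lemma cbI:
  assumes "\<And>b. (f \<longlongrightarrow> f b) (atin poset_topology b)" "\<And>b. norm (f b) \<le> B" "\<And>b. f b \<in> S"
  shows "f \<in> cb S"
  using assms by (auto simp: cb_def continuous_map_euclidean_iff bounded_iff)

text \<open>\<open>{a..}\<close> and its complement are both open, so the map is locally
  constant.\<close>

lemma continuous_map_step: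
  "continuous_map poset_topology euclidean (\<lambda>b. if a \<le> b then s else t)"
  unfolding continuous_map_euclidean_iff
proof
  fix b
  define U where "U = (if a \<le> b then {a..} else - {a..})"
  have "openin poset_topology U" "b \<in> U" "\<And>x. x \<in> U \<Longrightarrow> (a \<le> x) = (a \<le> b)"
    using clopen_atLeast[of a] by (auto simp: U_def split: if_splits)
  then have "\<forall>\<^sub>F x in atin poset_topology b. (a \<le> x) = (a \<le> b)"
    unfolding eventually_atin by blast
  then show "((\<lambda>x. if a \<le> x then s else t) \<longlongrightarrow> (if a \<le> b then s else t)) (atin poset_topology b)"
    by (intro tendsto_eventually) (erule eventually_mono, simp)
qed

lemma uniform_limit_UNIV_bounded:
  fixes s :: "nat \<Rightarrow> 'p \<Rightarrow> 'e::real_normed_vector"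
  assumes l: "uniform_limit UNIV s l sequentially" and b: "\<And>n. bounded (range (s n))"
  shows "bounded (range l)"
proof -
  have "\<forall>\<^sub>F n in sequentially. \<forall>x\<in>UNIV. dist (s n x) (l x) < 1"
    using l by (rule uniform_limitD) simp
  then obtain n where n: "\<And>x. dist (s n x) (l x) < 1" unfolding eventually_sequentially by auto
  obtain B where B: "\<And>x. norm (s n x) \<le> B" using b[of n] unfolding bounded_iff by blast
  have "norm (l x) \<le> B + 1" for x
    using n[of x] B[of x] norm_triangle_sub[of "l x" "s n x"]
    by (simp add: dist_norm norm_minus_commute)
  then show ?thesis unfolding bounded_iff by blast
qed

lemma cb_uniform_limit:
  assumes S: "closed S" and s: "\<And>n. s n \<in> cb S" and l: "uniform_limit UNIV s l sequentially"
  shows "l \<in> cb S"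
proof -
  have "continuous_map poset_topology euclidean l"
    unfolding continuous_map_euclidean_iff
  proof
    fix b
    show "(l \<longlongrightarrow> l b) (atin poset_topology b)"
    proof (rule swap_uniform_limit')
      show "\<forall>\<^sub>F n in sequentially. (s n \<longlongrightarrow> s n b) (atin poset_topology b)"
        using s by (auto simp: cb_def continuous_map_euclidean_iff)
      show "(\<lambda>n. s n b) \<longlonglongrightarrow> l b" by (rule tendsto_uniform_limitI[OF l]) simp
    qed (use l in auto)
  qed
  moreover have "l b \<in> S" for b
    by (rule closed_sequentially[OF S _ tendsto_uniform_limitI[OF l]]) (use s in \<open>auto simp: cb_def\<close>)
  ultimately show ?thesis
    using uniform_limit_UNIV_bounded[OF l] s by (auto simp: cb_def)
qed

lemma cb_le_SUP: "f \<in> cb S \<Longrightarrow> norm (f b) \<le> (SUP b. norm (f b))"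
  by (rule cSUP_upper) (auto simp: cb_def bounded_iff bdd_above_def)

text \<open>Boundedness makes the suprema meaningful: over an unbounded set of reals,
  \<open>SUP\<close> is an unspecified value.\<close>

lemma uniform_limit_iff_SUP:
  assumes "\<And>n. \<exists>B. \<forall>b. norm (s n b - l b) \<le> B"
  shows "uniform_limit UNIV s l sequentially \<longleftrightarrow> (\<lambda>n. SUP b. norm (s n b - l b)) \<longlonglongrightarrow> 0"
proof
  have up: "norm (s n b - l b) \<le> (SUP b. norm (s n b - l b))" for n b
    by (rule cSUP_upper) (use assms[of n] in \<open>auto simp: bdd_above_def\<close>)
  { assume "(\<lambda>n. SUP b. norm (s n b - l b)) \<longlonglongrightarrow> 0"
    then show "uniform_limit UNIV s l sequentially"
      unfolding uniform_limit_iff tendsto_iff dist_norm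
      by (auto elim!: all_forward imp_forward eventually_mono intro: le_less_trans[OF up] simp: abs_less_iff) }
  assume u: "uniform_limit UNIV s l sequentially"
  show "(\<lambda>n. SUP b. norm (s n b - l b)) \<longlonglongrightarrow> 0"
    unfolding tendsto_iff
  proof (intro allI impI)
    fix e :: real assume e: "e > 0"
    have "\<forall>\<^sub>F n in sequentially. \<forall>b\<in>UNIV. dist (s n b) (l b) < e/2"
      using u e by (intro uniform_limitD) auto
    then show "\<forall>\<^sub>F n in sequentially. dist (SUP b. norm (s n b - l b)) 0 < e"
    proof eventually_elim
      case (elim n)
      have "(SUP b. norm (s n b - l b)) \<le> e/2"
        by (rule cSUP_least) (use elim in \<open>auto simp: dist_norm intro: less_imp_le\<close>)
      moreover have "0 \<le> (SUP b. norm (s n b - l b))" using order_trans[OF norm_ge_zero up] by blast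
      ultimately show ?case using e by simp
    qed
  qed
qed

text \<open>The bridge from the closedness notion of the statement, where convergence is measured by
  a norm function, to uniform convergence. The membership of the limit demanded there is automatic,
  by \<open>cb_uniform_limit\<close>.\<close>

lemma closed_subspace_iff:
  assumes V: "carr V = cb S" "zro V = (\<lambda>_. 0)" "pls V = (\<lambda>f g b. f b + g b)" "scl V = (\<lambda>c f b. sc c (f b))"
    and sc: "\<And>x. x \<in> S \<Longrightarrow> sc (-1) x = - x" and S: "closed S"
    and N: "nr = (\<lambda>f. SUP b. norm (f b))"
  shows "linear_subspace V N \<and> norm_closed_in V nr N \<longleftrightarrow> closed_subspace sc S N"
proof -
  have "(\<forall>s l. (\<forall>n::nat. s n \<in> N) \<and> l \<in> cb S \<and> (\<lambda>n. nr (mns V (s n) l)) \<longlonglongrightarrow> 0 \<longrightarrow> l \<in> N) \<longleftrightarrow>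
    (\<forall>s l. (\<forall>n. s n \<in> N) \<longrightarrow> uniform_limit UNIV s l sequentially \<longrightarrow> l \<in> N)" if NS: "N \<subseteq> cb S"
  proof -
    have "(\<forall>n::nat. s n \<in> N) \<and> l \<in> cb S \<and> (\<lambda>n. nr (mns V (s n) l)) \<longlonglongrightarrow> 0 \<longleftrightarrow>
      (\<forall>n. s n \<in> N) \<and> uniform_limit UNIV s l sequentially" for s l
    proof (cases "(\<forall>n. s n \<in> N) \<and> l \<in> cb S")
      case True
      then have sl: "s n \<in> cb S" "l \<in> cb S" for n using NS by auto
      have "\<exists>B. \<forall>b. norm (s n b - l b) \<le> B" for n
      proof -
        obtain B C where "\<And>b. norm (s n b) \<le> B" "\<And>b. norm (l b) \<le> C"
          using cb_bounded[OF sl(1)[of n]] cb_bounded[OF sl(2)] by blast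
        then have "norm (s n b - l b) \<le> B + C" for b
          using norm_triangle_ineq4[of "s n b" "l b"] by (meson add_mono order_trans)
        then show ?thesis by blast
      qed
      note * = uniform_limit_iff_SUP[of s l, OF this]
      have "sc (-1) (l b) = - l b" for b using sl(2) by (intro sc) (auto simp: cb_def)
      then have "nr (mns V (s n) l) = (SUP b. norm (s n b - l b))" for n
        by (simp add: N mns_def V)
      then show ?thesis using * True by simp
    next
      case False
      then show ?thesis using cb_uniform_limit[OF S, of s l] NS by blast
    qed
    then show ?thesis by blast
  qed
  then show ?thesis
    unfolding linear_subspace_def norm_closed_in_def closed_subspace_def V by blast
qed

text \<open>\<open>nr\<close> has to agree with the sup norm on \<open>N\<close> only, because for
  the modules it is the square root of the norm of an inner product.\<close>

lemma complete_closed_subspace: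
  fixes N :: "('p::order \<Rightarrow> 'e::banach) set"
  assumes V: "carr V = N" "pls V = (\<lambda>f g b. f b + g b)" "scl V = (\<lambda>c f b. sc c (f b))"
    and sc: "\<And>x. x \<in> S \<Longrightarrow> sc (-1) x = - x"
    and N: "\<And>f. f \<in> N \<Longrightarrow> nr f = (SUP b. norm (f b))" and sub: "closed_subspace sc S N"
  shows "norm_complete V nr"
  unfolding norm_complete_def V
proof (intro allI impI, elim conjE)
  fix s :: "nat \<Rightarrow> _" assume s: "\<forall>n. s n \<in> N" and C: "\<forall>e>0. \<exists>k. \<forall>m\<ge>k. \<forall>n\<ge>k. nr (mns V (s m) (s n)) < e"
  have mn: "nr (mns V f g) = (SUP b. norm (f b - g b))" "(\<lambda>b. f b - g b) \<in> N" if "f \<in> N" "g \<in> N" for f g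
  proof -
    have "sc (-1) (g b) = - g b" for b
      using closed_subspaceD(1)[OF sub that(2)] by (intro sc) (auto simp: cb_def)
    then have *: "mns V f g = (\<lambda>b. f b - g b)" by (simp add: mns_def V)
    show "(\<lambda>b. f b - g b) \<in> N"
      using closed_subspaceD(3)[OF sub that(1) closed_subspaceD(4)[OF sub that(2), of "-1"]] *
      by (simp add: mns_def V)
    then show "nr (mns V f g) = (SUP b. norm (f b - g b))" using * N by simp
  qed
  have "uniformly_Cauchy_on UNIV s"
    unfolding uniformly_Cauchy_on_def
  proof (intro allI impI)
    fix e :: real assume "e > 0"
    then obtain k where k: "\<And>m n. m \<ge> k \<Longrightarrow> n \<ge> k \<Longrightarrow> nr (mns V (s m) (s n)) < e" using C by blast
    have "dist (s m b) (s n b) < e" if "m \<ge> k" "n \<ge> k" for m n b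
      using k[OF that] cb_le_SUP[OF closed_subspaceD(1)[OF sub mn(2)], of "s m" "s n" b] s mn(1)[of "s m" "s n"]
      by (simp add: dist_norm)
    then show "\<exists>M. \<forall>x\<in>UNIV. \<forall>m\<ge>M. \<forall>n\<ge>M. dist (s m x) (s n x) < e" by blast
  qed
  then obtain l where l: "uniform_limit UNIV s l sequentially"
    using Cauchy_uniformly_convergent uniformly_convergent_on_def by blast
  have lN: "l \<in> N" using closed_subspaceD(5)[OF sub _ l] s by blast
  have "\<exists>B. \<forall>b. norm (s n b - l b) \<le> B" for n
    using cb_le_SUP[OF closed_subspaceD(1)[OF sub mn(2)[OF _ lN]]] s by blast
  then have "(\<lambda>n. nr (mns V (s n) l)) \<longlonglongrightarrow> 0"
    using uniform_limit_iff_SUP[of s l] l s mn(1)[OF _ lN] by simp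
  then show "\<exists>l\<in>N. (\<lambda>n. nr (mns V (s n) l)) \<longlonglongrightarrow> 0" using lN by blast
qed

lemma cb_binary:
  assumes h: "bounded_bilinear h" and f: "f \<in> cb S" and g: "g \<in> cb S'"
    and m: "\<And>x y. x \<in> S \<Longrightarrow> y \<in> S' \<Longrightarrow> h x y \<in> S''"
  shows "(\<lambda>b. h (f b) (g b)) \<in> cb S''"
proof -
  obtain K where K: "K \<ge> 0" "\<And>x y. norm (h x y) \<le> norm x * norm y * K"
    using bounded_bilinear.nonneg_bounded[OF h] by blast
  obtain B C where B: "\<And>b. norm (f b) \<le> B" "\<And>b. norm (g b) \<le> C"
    using cb_bounded[OF f] cb_bounded[OF g] by blast
  have C0: "0 \<le> C" using B(2) norm_ge_zero order_trans by blast
  show ?thesis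
  proof (rule cbI)
    show "((\<lambda>b. h (f b) (g b)) \<longlongrightarrow> h (f b) (g b)) (atin poset_topology b)" for b
      by (intro bounded_bilinear.tendsto[OF h] cb_tendsto[OF f] cb_tendsto[OF g])
    show "norm (h (f b) (g b)) \<le> B * C * K" for b
      by (rule order_trans[OF K(2)])
        (intro mult_right_mono[OF _ K(1)] mult_mono' B norm_ge_zero)
    show "h (f b) (g b) \<in> S''" for b by (intro m cb_in[OF f] cb_in[OF g])
  qed
qed

lemma cb_add:
  assumes f: "f \<in> cb S" and g: "g \<in> cb S" and m: "\<And>x y. x \<in> S \<Longrightarrow> y \<in> S \<Longrightarrow> x + y \<in> S"
  shows "(\<lambda>b. f b + g b) \<in> cb S"
proof -
  obtain B C where B: "\<And>b. norm (f b) \<le> B" "\<And>b. norm (g b) \<le> C"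
    using cb_bounded[OF f] cb_bounded[OF g] by blast
  show ?thesis
  proof (rule cbI)
    show "((\<lambda>b. f b + g b) \<longlongrightarrow> f b + g b) (atin poset_topology b)" for b
      by (intro tendsto_add cb_tendsto[OF f] cb_tendsto[OF g])
    show "norm (f b + g b) \<le> B + C" for b
      using norm_triangle_ineq[of "f b" "g b"] B[of b] by linarith
    show "f b + g b \<in> S" for b by (intro m cb_in[OF f] cb_in[OF g])
  qed
qed

lemma cb_const: "s \<in> S \<Longrightarrow> (\<lambda>_. s) \<in> cb S"
  by (auto simp: cb_def)

lemma cb_step:
  assumes "s \<in> S" "t \<in> S"
  shows "(\<lambda>b. if a \<le> b then s else t) \<in> cb S"
  by (rule cbI[where B = "max (norm s) (norm t)"])
    (use continuous_map_step[of a s t] assms in \<open>auto simp: continuous_map_euclidean_iff\<close>)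

text \<open>\<open>adj\<close> is isometric on \<open>bounded_ops\<close> but unspecified outside,
  hence the membership assumptions.\<close>

lemma tendsto_adj:
  assumes "\<And>b. m b \<in> bounded_ops" "l \<in> bounded_ops" "(m \<longlongrightarrow> l) F"
  shows "((\<lambda>b. adj (m b)) \<longlongrightarrow> adj l) F"
  using assms by (simp add: tendsto_iff dist_adj)

lemma cb_adj:
  assumes f: "f \<in> cb bounded_ops"
  shows "(\<lambda>b. adj (f b)) \<in> cb bounded_ops"
proof -
  obtain B where B: "\<And>b. norm (f b) \<le> B" using cb_bounded[OF f] by blast
  show ?thesis
    by (rule cbI[where B = B]) (use cb_in[OF f] cb_tendsto[OF f] B in \<open>auto intro!: tendsto_adj simp: norm_adj\<close>)
qed

lemma tendsto_bounded_ops: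
  assumes "\<And>b. m b \<in> bounded_ops" "F \<noteq> bot" "(m \<longlongrightarrow> l) F"
  shows "l \<in> bounded_ops"
  using Lim_in_closed_set[OF closed_bounded_ops _ assms(2,3)] assms(1) by simp


section \<open>The Gelfand spectrum of the poset algebra\<close>

definition star_subalgebra ::
  "(complex \<Rightarrow> 'e \<Rightarrow> 'e) \<Rightarrow> 'e::real_normed_vector set \<Rightarrow> ('e \<Rightarrow> 'e \<Rightarrow> 'e) \<Rightarrow> ('e \<Rightarrow> 'e) \<Rightarrow>
    ('p::order \<Rightarrow> 'e) set \<Rightarrow> bool" where
  "star_subalgebra sc S mu st N \<longleftrightarrow> closed_subspace sc S N \<and>
     (\<forall>f\<in>N. \<forall>g\<in>N. (\<lambda>b. mu (f b) (g b)) \<in> N) \<and> (\<forall>f\<in>N. (\<lambda>b. st (f b)) \<in> N)"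

lemma star_subalgebraD:
  assumes "star_subalgebra sc S mu st N"
  shows "closed_subspace sc S N" "f \<in> N \<Longrightarrow> g \<in> N \<Longrightarrow> (\<lambda>b. mu (f b) (g b)) \<in> N"
    "f \<in> N \<Longrightarrow> (\<lambda>b. st (f b)) \<in> N"
  using assms by (auto simp: star_subalgebra_def)

lemma cstar_subalgebra_Cb_iff:
  assumes E: "carr E = S" "zro E = 0" "pls E = (+)" "scl E = sc" "nrm E = norm"
    and sc: "\<And>x. x \<in> S \<Longrightarrow> sc (-1) x = - x" and S: "closed S"
  shows "cstar_subalgebra (Cb_cstar E) N \<longleftrightarrow> star_subalgebra sc S (mul E) (star E) N"
proof -
  have "linear_subspace (Cb_cstar E) N \<and> norm_closed_in (Cb_cstar E) (nrm (Cb_cstar E)) N \<longleftrightarrow> closed_subspace sc S N"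
    by (rule closed_subspace_iff) (auto simp: Cb_cstar_def Cb_vec_def E cb_def sc S)
  then show ?thesis
    unfolding cstar_subalgebra_def star_subalgebra_def by (auto simp: Cb_cstar_def)
qed

lemma star_subalgebra_Inter:
  assumes all: "\<And>N. N \<in> \<N> \<Longrightarrow> star_subalgebra sc S mu st N" and ne: "\<N> \<noteq> {}"
  shows "star_subalgebra sc S mu st (\<Inter>\<N>)"
proof -
  note D = star_subalgebraD[OF all]
  note C = closed_subspaceD[OF D(1)]
  have "\<Inter>\<N> \<subseteq> cb S" using ne C(1) by blast
  moreover have "l \<in> N" if "N \<in> \<N>" "\<forall>n. s n \<in> \<Inter>\<N>" "uniform_limit UNIV s l sequentially" for N s l
    by (rule C(5)[OF that(1) _ that(3)]) (use that in blast)
  ultimately show ?thesis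
    unfolding star_subalgebra_def closed_subspace_def by (simp add: C(2-4) D(2,3))
qed

text \<open>\<open>N0\<close> guarantees that the intersection defining the generated algebra runs
  over a nonempty family; an empty one would give the whole type.\<close>

lemma carr_cstar_generated:
  assumes E: "carr E = S" "zro E = 0" "pls E = (+)" "scl E = sc" "nrm E = norm"
    and sc: "\<And>x. x \<in> S \<Longrightarrow> sc (-1) x = - x" and S: "closed S"
    and N0: "star_subalgebra sc S (mul E) (star E) N0" "G \<subseteq> N0"
  shows "star_subalgebra sc S (mul E) (star E) (carr (cstar_generated (Cb_cstar E) G))"
    and "G \<subseteq> carr (cstar_generated (Cb_cstar E) G)"
    and "\<And>N. star_subalgebra sc S (mul E) (star E) N \<Longrightarrow> G \<subseteq> N \<Longrightarrow> carr (cstar_generated (Cb_cstar E) G) \<subseteq> N"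
proof -
  have eq: "carr (cstar_generated (Cb_cstar E) G) = \<Inter>{N. star_subalgebra sc S (mul E) (star E) N \<and> G \<subseteq> N}"
    by (simp add: cstar_generated_def cstar_subalgebra_Cb_iff[OF E sc S])
  show "star_subalgebra sc S (mul E) (star E) (carr (cstar_generated (Cb_cstar E) G))"
    unfolding eq by (rule star_subalgebra_Inter) (use N0 in auto)
  show "G \<subseteq> carr (cstar_generated (Cb_cstar E) G)" unfolding eq by blast
  show "\<And>N. star_subalgebra sc S (mul E) (star E) N \<Longrightarrow> G \<subseteq> N \<Longrightarrow> carr (cstar_generated (Cb_cstar E) G) \<subseteq> N"
    unfolding eq by blast
qed

lemma indicator_atLeast_step:
  "indicator {a..} = (\<lambda>b. if a \<le> b then 1 else 0)" "indicator (- {a..}) = (\<lambda>b. if a \<le> b then 0 else 1)"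
  by (auto simp: indicator_def fun_eq_iff)

lemma star_subalgebra_cb_complex: "star_subalgebra (*) UNIV (*) cnj (cb UNIV)"
  unfolding star_subalgebra_def closed_subspace_def
proof (intro conjI allI ballI impI)
  fix f g :: "'a \<Rightarrow> complex" and c assume f: "f \<in> cb UNIV" and g: "g \<in> cb UNIV"
  show "(\<lambda>b. f b * g b) \<in> cb UNIV" by (rule cb_binary[OF bounded_bilinear_mult f g]) simp
  show "(\<lambda>b. f b + g b) \<in> cb UNIV" by (rule cb_add[OF f g]) simp
next
  fix f :: "'a \<Rightarrow> complex" and c assume f: "f \<in> cb UNIV"
  show "(\<lambda>b. c * f b) \<in> cb UNIV" by (rule cb_binary[OF bounded_bilinear_mult cb_const f]) auto
  show "(\<lambda>b. cnj (f b)) \<in> cb UNIV"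
    using f by (auto simp: cb_def continuous_map_euclidean_iff bounded_iff intro!: tendsto_cnj)
next
  fix s :: "nat \<Rightarrow> 'a \<Rightarrow> complex" and l
  assume "\<forall>n. s n \<in> cb UNIV" "uniform_limit UNIV s l sequentially"
  then show "l \<in> cb UNIV" using cb_uniform_limit[of UNIV s l] by auto
qed (auto intro: cb_const)

abbreviation galg :: "('p::order \<Rightarrow> complex) set" where "galg \<equiv> carr gamma_algebra"

lemma
  shows galg_star_subalgebra: "star_subalgebra (*) UNIV (*) cnj (galg :: ('p::order \<Rightarrow> complex) set)"
    and indicator_in_galg: "indicator {a :: 'p..} \<in> galg" "indicator (- {a :: 'p..}) \<in> galg"
    and galg_least: "star_subalgebra (*) UNIV (*) cnj N \<Longrightarrow> (\<And>a :: 'p. indicator {a..} \<in> N) \<Longrightarrow>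
      (\<And>a. indicator (- {a..}) \<in> N) \<Longrightarrow> galg \<subseteq> N"
proof -
  let ?G = "range (\<lambda>a :: 'p. indicator {a..}) \<union> range (\<lambda>a. indicator (- {a..})) :: ('p \<Rightarrow> complex) set"
  have E: "carr complex_cstar = UNIV" "zro complex_cstar = 0" "pls complex_cstar = (+)" "scl complex_cstar = (*)"
    "nrm complex_cstar = norm" "mul complex_cstar = (*)" "star complex_cstar = cnj"
    by (auto simp: complex_cstar_def)
  have G: "?G \<subseteq> cb UNIV" unfolding indicator_atLeast_step by (auto intro!: cb_step)
  note gen = carr_cstar_generated[OF E(1-5), unfolded E, OF _ _ star_subalgebra_cb_complex G, folded gamma_algebra_def]
  show "star_subalgebra (*) UNIV (*) cnj (galg :: ('p \<Rightarrow> complex) set)" using gen(1) by simp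
  show "indicator {a..} \<in> (galg :: ('p \<Rightarrow> complex) set)" "indicator (- {a..}) \<in> (galg :: ('p \<Rightarrow> complex) set)"
    using gen(2) by auto
  show "star_subalgebra (*) UNIV (*) cnj N \<Longrightarrow> (\<And>a :: 'p. indicator {a..} \<in> N) \<Longrightarrow>
      (\<And>a. indicator (- {a..}) \<in> N) \<Longrightarrow> galg \<subseteq> N"
    by (rule gen(3)) auto
qed

section \<open>Closure properties of the poset algebra\<close>

lemmas galg_subspace = star_subalgebraD(1)[OF galg_star_subalgebra]
lemmas galg_add = closed_subspaceD(3)[OF galg_subspace]
lemmas galg_scale = closed_subspaceD(4)[OF galg_subspace]
lemmas galg_mult = star_subalgebraD(2)[OF galg_star_subalgebra]
lemmas galg_cnj = star_subalgebraD(3)[OF galg_star_subalgebra]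
lemmas galg_limit = closed_subspaceD(5)[OF galg_subspace]

lemma galg_const: "(\<lambda>_ :: 'p::order. c) \<in> galg"
proof -
  \<comment> \<open>For any element of the poset the two indicators add up to 1;
    \<open>undefined\<close> is an arbitrary one.\<close>
  have "(\<lambda>b :: 'p. c * (indicator {undefined..} b + indicator (- {undefined..}) b)) \<in> galg"
    by (intro galg_scale galg_add indicator_in_galg)
  moreover have "(\<lambda>b :: 'p. c * (indicator {undefined..} b + indicator (- {undefined..}) b)) = (\<lambda>_. c)"
    by (auto simp: indicator_def)
  ultimately show ?thesis by simp
qed

lemma galg_diff:
  assumes "f \<in> galg" "g \<in> galg"
  shows "(\<lambda>b. f b - g b) \<in> galg"
  using galg_add[OF assms(1) galg_scale[OF assms(2), of "-1"]] by simp

lemma galg_bounded: "f \<in> galg \<Longrightarrow> \<exists>B. \<forall>b. cmod (f b) \<le> B"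
  using cb_bounded[OF closed_subspaceD(1)[OF galg_subspace]] by blast

lemma galg_indicator_Int:
  "indicator U \<in> galg \<Longrightarrow> indicator V \<in> galg \<Longrightarrow> indicator (U \<inter> V) \<in> galg"
  using galg_mult[of "indicator U" "indicator V"] by (simp add: indicator_inter_arith[abs_def])

lemma indicator_Compl_eq: "(indicator (- U) :: 'a \<Rightarrow> complex) = (\<lambda>b. 1 - indicator U b)"
  by (auto simp: indicator_def)

lemma galg_indicator_Compl: "indicator U \<in> galg \<Longrightarrow> indicator (- U) \<in> galg"
  unfolding indicator_Compl_eq by (rule galg_diff[OF galg_const])

lemma galg_power: "f \<in> galg \<Longrightarrow> (\<lambda>b. f b ^ n) \<in> galg"
proof (induction n)
  case (Suc n) then show ?case using galg_mult[of f "\<lambda>b. f b ^ n"] by simp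
qed (simp add: galg_const)

lemma galg_sum: "(\<And>i. i \<in> I \<Longrightarrow> f i \<in> galg) \<Longrightarrow> (\<lambda>b. \<Sum>i\<in>I. f i b) \<in> galg"
  by (induction I rule: infinite_finite_induct) (auto intro: galg_const galg_add)

text \<open>The geometric series converges uniformly, with remainder at most
  \<open>q ^ n / (1 - q)\<close>. This supplies the inverses behind
  \<open>character_bound\<close>.\<close>

lemma galg_Neumann:
  assumes f: "f \<in> galg" and q: "0 \<le> q" "q < 1" "\<And>b. cmod (f b) \<le> q"
  shows "(\<lambda>b. 1 / (1 - f b)) \<in> galg"
proof (rule galg_limit)
  show "(\<lambda>b. \<Sum>k<n. f b ^ k) \<in> galg" for n by (intro galg_sum galg_power f)
  have "(\<lambda>n. q ^ n / (1 - q)) \<longlonglongrightarrow> 0 / (1 - q)"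
    by (intro tendsto_divide LIMSEQ_realpow_zero tendsto_const) (use q in auto)
  then have lim: "(\<lambda>n. q ^ n / (1 - q)) \<longlonglongrightarrow> 0" by simp
  have le: "dist (\<Sum>k<n. f b ^ k) (1 / (1 - f b)) \<le> q ^ n / (1 - q)" for n b
  proof -
    have ne: "f b \<noteq> 1" using q(2) q(3)[of b] by auto
    have "1 - q \<le> cmod (1 - f b)" using norm_triangle_ineq2[of 1 "f b"] q(3)[of b] by simp
    moreover have "(\<Sum>k<n. f b ^ k) - 1 / (1 - f b) = - (f b ^ n / (1 - f b))"
      using ne by (simp add: sum_gp_strict divide_simps)
    then have "dist (\<Sum>k<n. f b ^ k) (1 / (1 - f b)) = cmod (f b) ^ n / cmod (1 - f b)"
      by (simp add: dist_norm norm_divide norm_power)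
    ultimately show ?thesis using q by (simp add: frac_le power_mono)
  qed
  show "uniform_limit UNIV (\<lambda>n b. \<Sum>k<n. f b ^ k) (\<lambda>b. 1 / (1 - f b)) sequentially"
    unfolding uniform_limit_iff
  proof (intro allI impI)
    fix e :: real assume "e > 0"
    then have "\<forall>\<^sub>F n in sequentially. dist (q ^ n / (1 - q)) 0 < e" by (rule tendstoD[OF lim])
    then show "\<forall>\<^sub>F n in sequentially. \<forall>x\<in>UNIV. dist (\<Sum>k<n. f x ^ k) (1 / (1 - f x)) < e"
    proof eventually_elim
      case (elim n)
      then have "q ^ n / (1 - q) < e" using q by simp
      then show ?case using le_less_trans[OF le] by blast
    qed
  qed
qed

section \<open>Characters and their filters on the poset\<close>

definition characters :: "(('p::order \<Rightarrow> complex) \<Rightarrow> complex) set" where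
  "characters = {h. linear_map gamma_algebra complex_cstar h \<and>
         (\<forall>x\<in>galg. \<forall>y\<in>galg. h (mul gamma_algebra x y) = h x * h y) \<and> (\<exists>x\<in>galg. h x \<noteq> 0)}"

lemma gamma_eq: "gamma = subtopology (product_topology (\<lambda>_. euclidean) galg) characters"
  by (simp add: gamma_def gelfand_spectrum_def characters_def)

lemma topspace_gamma: "topspace gamma = extensional galg \<inter> characters"
  by (auto simp: gamma_eq PiE_def)

lemma gamma_algebra_ops:
  "pls gamma_algebra = (\<lambda>f g b. f b + g b)" "scl gamma_algebra = (\<lambda>c f b. c * f b)"
  "mul gamma_algebra = (\<lambda>f g b. f b * g b)"
  by (simp_all add: gamma_algebra_def cstar_generated_def Cb_cstar_def Cb_vec_def complex_cstar_def)

text \<open>The trace on the poset of the neighbourhood filter of a character.\<close>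

definition nbhd_filter :: "(('p::order \<Rightarrow> complex) \<Rightarrow> complex) \<Rightarrow> 'p filter" where
  "nbhd_filter t = (INF a. principal {b. (a \<le> b) = (t (indicator {a..}) = 1)})"

context
  fixes t :: "('p::order \<Rightarrow> complex) \<Rightarrow> complex"
  assumes t: "t \<in> topspace gamma"
begin

lemma character_add: "f \<in> galg \<Longrightarrow> g \<in> galg \<Longrightarrow> t (\<lambda>b. f b + g b) = t f + t g"
  and character_scale: "f \<in> galg \<Longrightarrow> t (\<lambda>b. c * f b) = c * t f"
  and character_mult: "f \<in> galg \<Longrightarrow> g \<in> galg \<Longrightarrow> t (\<lambda>b. f b * g b) = t f * t g"
  using t by (auto simp: topspace_gamma characters_def linear_map_def gamma_algebra_ops complex_cstar_def)

lemma character_diff: "f \<in> galg \<Longrightarrow> g \<in> galg \<Longrightarrow> t (\<lambda>b. f b - g b) = t f - t g"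
  using character_add[of f "\<lambda>b. -1 * g b"] character_scale[of g "-1"] galg_scale[of g "-1"] by simp

lemma character_const: "t (\<lambda>_. c) = c"
proof -
  obtain f where f: "f \<in> galg" "t f \<noteq> 0" using t by (auto simp: topspace_gamma characters_def)
  then have "t (\<lambda>_. 1) = 1" using character_mult[OF galg_const[of 1] f(1)] by simp
  then show ?thesis using character_scale[OF galg_const[of 1], of c] by simp
qed

lemma character_indicator: "indicator U \<in> galg \<Longrightarrow> t (indicator U) = 0 \<or> t (indicator U) = 1"
proof -
  assume U: "indicator U \<in> galg"
  have "(\<lambda>b. indicator U b * indicator U b :: complex) = indicator U" by (auto simp: indicator_def)
  then have "t (indicator U) * t (indicator U) = t (indicator U)" using character_mult[OF U U] by simp
  then show ?thesis by simp
qed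

lemma character_indicator_Compl: "indicator U \<in> galg \<Longrightarrow> t (indicator (- U)) = 1 - t (indicator U)"
  unfolding indicator_Compl_eq using character_diff[OF galg_const[of 1]] character_const by simp

lemma character_indicator_Int:
  "indicator U \<in> galg \<Longrightarrow> indicator V \<in> galg \<Longrightarrow> t (indicator (U \<inter> V)) = t (indicator U) * t (indicator V)"
  using character_mult[of "indicator U" "indicator V"] by (simp add: indicator_inter_arith[abs_def])

text \<open>If \<open>t f\<close> exceeded the bound, then \<open>g = f / t f\<close> would have sup
  norm below 1, so \<open>1 - g\<close> would be invertible in \<open>galg\<close>, although
  \<open>t\<close> maps it to \<open>0\<close>.\<close>

lemma character_bound:
  assumes f: "f \<in> galg" and B: "\<And>b. cmod (f b) \<le> B"
  shows "cmod (t f) \<le> B"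
proof (rule ccontr)
  assume "\<not> cmod (t f) \<le> B"
  then have gt: "cmod (t f) > B" by simp
  have B0: "0 \<le> B" using B norm_ge_zero order_trans by blast
  with gt have tf: "cmod (t f) > 0" "t f \<noteq> 0" by auto
  define g where "g = (\<lambda>b. inverse (t f) * f b)"
  have g: "g \<in> galg" unfolding g_def by (rule galg_scale[OF f])
  have "cmod (g b) \<le> B / cmod (t f)" for b
    using divide_right_mono[OF B[of b], of "cmod (t f)"] by (simp add: g_def norm_divide divide_inverse_commute[symmetric])
  moreover have "0 \<le> B / cmod (t f)" "B / cmod (t f) < 1" using gt B0 tf by auto
  ultimately have h: "(\<lambda>b. 1 / (1 - g b)) \<in> galg" and lt: "cmod (g b) < 1" for b
    using galg_Neumann[OF g, of "B / cmod (t f)"] le_less_trans by blast+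
  have ne: "g b \<noteq> 1" for b using lt[of b] by auto
  have tg: "t g = 1" unfolding g_def using character_scale[OF f] tf by simp
  have "t (\<lambda>b. (1 - g b) * (1 / (1 - g b))) = t (\<lambda>b. 1 - g b) * t (\<lambda>b. 1 / (1 - g b))"
    by (rule character_mult[OF galg_diff[OF galg_const g] h])
  moreover have "(\<lambda>b. (1 - g b) * (1 / (1 - g b))) = (\<lambda>_. 1)" using ne by auto
  ultimately show False using character_diff[OF galg_const g, of 1] tg by (simp add: character_const)
qed

text \<open>A set of the filter contains a finite intersection of generating ones. Indicators of
  intersections are products, and \<open>t\<close> is multiplicative.\<close>

lemma eventually_nbhd_filterD:
  assumes "eventually P (nbhd_filter t)"
  shows "\<exists>U. indicator U \<in> galg \<and> t (indicator U) = 1 \<and> (\<forall>b\<in>U. P b)"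
proof -
  let ?K = "\<lambda>a. {b. (a \<le> b) = (t (indicator {a..}) = 1)}"
  obtain X where X: "finite X" "eventually P (INF a\<in>X. principal (?K a))"
    using assms unfolding nbhd_filter_def eventually_INF[of _ _ UNIV] by blast
  then have P: "\<forall>b\<in>\<Inter>(?K ` X). P b"
    by (simp add: INF_principal_finite eventually_principal)
  have K: "indicator (?K a) \<in> galg \<and> t (indicator (?K a)) = 1" for a
  proof (cases "t (indicator {a..}) = 1")
    case True
    then have K: "?K a = {a..}" by auto
    show ?thesis unfolding K using True indicator_in_galg(1)[of a] by simp
  next
    case False
    then have K: "?K a = - {a..}" by auto
    show ?thesis
      unfolding K using False indicator_in_galg[of a] character_indicator[of "{a..}"]
        character_indicator_Compl[of "{a..}"] by simp
  qed
  have "indicator (\<Inter>(?K ` X)) \<in> galg \<and> t (indicator (\<Inter>(?K ` X))) = 1"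
    using X(1)
  proof (induction X rule: finite_induct)
    case empty
    have "(indicator UNIV :: 'p \<Rightarrow> complex) = (\<lambda>_. 1)" by auto
    then show ?case using galg_const[of 1] character_const[of 1] by simp
  next
    case (insert a X)
    have "\<Inter>(?K ` insert a X) = ?K a \<inter> \<Inter>(?K ` X)" by blast
    moreover have "indicator (?K a \<inter> \<Inter>(?K ` X)) \<in> galg"
      using K[of a] insert.IH by (intro galg_indicator_Int) blast+
    moreover have "t (indicator (?K a \<inter> \<Inter>(?K ` X))) = 1"
      using character_indicator_Int[of "?K a" "\<Inter>(?K ` X)"] K[of a] insert.IH by simp
    ultimately show ?case by simp
  qed
  then show ?thesis using P by blast
qed

text \<open>The empty set has indicator \<open>0\<close>, on which \<open>t\<close> is not
  \<open>1\<close>. Limits along the filter are therefore unique.\<close>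

lemma nbhd_filter_neq_bot: "nbhd_filter t \<noteq> bot"
proof
  assume "nbhd_filter t = bot"
  then have "eventually (\<lambda>_. False) (nbhd_filter t)" by simp
  then obtain U where U: "indicator U \<in> galg" "t (indicator U) = 1" "\<forall>b\<in>U. False"
    using eventually_nbhd_filterD by blast
  have "U = {}" using U(3) by blast
  moreover have "(indicator {} :: 'p \<Rightarrow> complex) = (\<lambda>_. 0)" by auto
  ultimately show False using U(2) character_const[of 0] by simp
qed

text \<open>Automatic continuity: \<open>character_bound\<close> applied to
  \<open>s n - l\<close>.\<close>

lemma character_uniform_limit:
  assumes s: "\<And>n. s n \<in> galg" and l: "uniform_limit UNIV s l sequentially"
  shows "(\<lambda>n. t (s n)) \<longlonglongrightarrow> t l"
  unfolding tendsto_iff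
proof (intro allI impI)
  fix e :: real assume e: "e > 0"
  have lg: "l \<in> galg" by (rule galg_limit[OF s l])
  have "\<forall>\<^sub>F n in sequentially. \<forall>b\<in>UNIV. dist (s n b) (l b) < e/2"
    using l e by (intro uniform_limitD) auto
  then show "\<forall>\<^sub>F n in sequentially. dist (t (s n)) (t l) < e"
  proof eventually_elim
    case (elim n)
    have "cmod (t (\<lambda>b. s n b - l b)) \<le> e/2"
      by (rule character_bound[OF galg_diff[OF s lg]]) (use elim in \<open>auto simp: dist_norm intro: less_imp_le\<close>)
    then show ?case using e by (simp add: character_diff[OF s lg] dist_norm)
  qed
qed

text \<open>A character is not assumed to respect conjugation. To get past the star operation of
  \<open>galg\<close>, the induction therefore proves \<open>t (cnj f) = cnj (t f)\<close> along
  with the convergence.\<close>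

lemma tendsto_character:
  assumes "f \<in> galg"
  shows "(f \<longlongrightarrow> t f) (nbhd_filter t)"
proof -
  let ?N = "{f \<in> galg. (f \<longlongrightarrow> t f) (nbhd_filter t) \<and> t (\<lambda>b. cnj (f b)) = cnj (t f)}"
  have "galg \<subseteq> ?N"
  proof (rule galg_least)
    show "star_subalgebra (*) UNIV (*) cnj ?N"
      unfolding star_subalgebra_def
    proof (intro conjI ballI closed_subspace_CollectI[OF galg_subspace])
      show "((\<lambda>_. 0) \<longlongrightarrow> t (\<lambda>_. 0)) (nbhd_filter t)" "t (\<lambda>b. cnj 0) = cnj (t (\<lambda>_. 0))"
        by (simp_all add: character_const)
    next
      fix f g assume "f \<in> galg" "g \<in> galg" "(f \<longlongrightarrow> t f) (nbhd_filter t) \<and> t (\<lambda>b. cnj (f b)) = cnj (t f)"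
        "(g \<longlongrightarrow> t g) (nbhd_filter t) \<and> t (\<lambda>b. cnj (g b)) = cnj (t g)"
      then show "((\<lambda>b. f b + g b) \<longlongrightarrow> t (\<lambda>b. f b + g b)) (nbhd_filter t)"
        "t (\<lambda>b. cnj (f b + g b)) = cnj (t (\<lambda>b. f b + g b))"
        using galg_cnj[of f] galg_cnj[of g] by (auto simp: character_add intro!: tendsto_add)
    next
      fix f g assume f: "f \<in> ?N" and g: "g \<in> ?N"
      show "(\<lambda>b. f b * g b) \<in> ?N"
        using f g galg_cnj[of f] galg_cnj[of g] by (auto simp: galg_mult character_mult intro!: tendsto_mult)
      show "(\<lambda>b. cnj (f b)) \<in> ?N" using f galg_cnj[of f] by (auto intro!: tendsto_cnj)
    next
      fix c f assume "f \<in> galg" "(f \<longlongrightarrow> t f) (nbhd_filter t) \<and> t (\<lambda>b. cnj (f b)) = cnj (t f)"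
      then show "((\<lambda>b. c * f b) \<longlongrightarrow> t (\<lambda>b. c * f b)) (nbhd_filter t)"
        "t (\<lambda>b. cnj (c * f b)) = cnj (t (\<lambda>b. c * f b))"
        using galg_cnj[of f] by (auto simp: character_scale intro!: tendsto_mult)
    next
      fix s l assume sg: "\<And>n. s n \<in> galg" and l: "uniform_limit UNIV s l sequentially"
        and s: "\<And>n. (s n \<longlongrightarrow> t (s n)) (nbhd_filter t) \<and> t (\<lambda>b. cnj (s n b)) = cnj (t (s n))"
      show "(l \<longlongrightarrow> t l) (nbhd_filter t)"
        by (rule swap_uniform_limit'[OF _ character_uniform_limit[OF sg l] l]) (use s in auto)
      show "t (\<lambda>b. cnj (l b)) = cnj (t l)"
      proof (rule tendsto_unique)
        have "uniform_limit UNIV (\<lambda>n b. cnj (s n b)) (\<lambda>b. cnj (l b)) sequentially"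
          using l by (simp add: uniform_limit_iff dist_norm flip: complex_cnj_diff)
        then show "(\<lambda>n. t (\<lambda>b. cnj (s n b))) \<longlonglongrightarrow> t (\<lambda>b. cnj (l b))"
          by (intro character_uniform_limit galg_cnj sg)
        have "(\<lambda>n. cnj (t (s n))) \<longlonglongrightarrow> cnj (t l)"
          by (intro tendsto_cnj character_uniform_limit[OF sg l])
        then show "(\<lambda>n. t (\<lambda>b. cnj (s n b))) \<longlonglongrightarrow> cnj (t l)" using s by simp
      qed simp
    qed
    have I: "indicator {a..} \<in> ?N" for a
    proof -
      have "\<forall>\<^sub>F b in nbhd_filter t. (a \<le> b) = (t (indicator {a..}) = 1)"
        unfolding nbhd_filter_def by (rule eventually_INF1[of a]) (simp_all add: eventually_principal)
      then have "\<forall>\<^sub>F b in nbhd_filter t. indicator {a..} b = t (indicator {a..})"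
        by (rule eventually_mono)
          (use character_indicator[OF indicator_in_galg(1), of a] in \<open>auto simp: indicator_def of_bool_def\<close>)
      moreover have "(\<lambda>b. cnj (indicator {a..} b)) = indicator {a..}" by (auto simp: indicator_def)
      ultimately show ?thesis
        using character_indicator[OF indicator_in_galg(1), of a]
        by (auto simp: indicator_in_galg intro!: tendsto_eventually)
    qed
    show "indicator {a..} \<in> ?N" "indicator (- {a..}) \<in> ?N" for a
    proof -
      show "indicator {a..} \<in> ?N" by (rule I)
      have "((\<lambda>b. 1 - indicator {a..} b) \<longlongrightarrow> 1 - t (indicator {a..})) (nbhd_filter t)"
        using I[of a] by (intro tendsto_diff) auto
      moreover have "(\<lambda>b. cnj (indicator (- {a..}) b)) = indicator (- {a..})" by (auto simp: indicator_def)
      ultimately show "indicator (- {a..}) \<in> ?N"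
        using character_indicator[OF indicator_in_galg(1), of a] character_indicator_Compl[OF indicator_in_galg(1), of a]
        by (auto simp: indicator_in_galg indicator_Compl_eq[of "{a..}", symmetric])
    qed
  qed
  then show ?thesis using assms by auto
qed

text \<open>Converse of \<open>eventually_nbhd_filterD\<close>: an indicator value at distance less
  than 1 from \<open>1\<close> cannot be \<open>0\<close>.\<close>

lemma eventually_nbhd_filterI:
  assumes U: "indicator U \<in> galg" "t (indicator U) = 1"
  shows "\<forall>\<^sub>F b in nbhd_filter t. b \<in> U"
proof -
  have "\<forall>\<^sub>F b in nbhd_filter t. dist (indicator U b) (1 :: complex) < 1"
    using tendstoD[OF tendsto_character[OF U(1)], of 1] U(2) by simp
  then show ?thesis by eventually_elim (rule ccontr, simp)
qed

end

lemma character_gamma_point: "gamma_point b \<in> topspace gamma"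
  by (auto simp: topspace_gamma gamma_point_def characters_def linear_map_def gamma_algebra_ops complex_cstar_def
      galg_add galg_mult galg_scale galg_const intro!: bexI[of _ "\<lambda>_. 1"])

lemma gamma_point_apply: "f \<in> galg \<Longrightarrow> gamma_point b f = f b"
  by (simp add: gamma_point_def)

text \<open>The topology of \<open>gamma\<close> is that of pointwise convergence, so this is
  \<open>tendsto_character\<close> in each coordinate. It expresses the density of the poset and
  makes continuous extensions unique.\<close>

lemma limitin_gamma_point:
  assumes t: "t \<in> topspace gamma"
  shows "limitin gamma gamma_point t (nbhd_filter t)"
  unfolding gamma_eq limitin_subtopology limitin_componentwise
proof (intro conjI ballI)
  show "t \<in> characters" "t \<in> extensional galg" using t by (auto simp: topspace_gamma)
  show "\<forall>\<^sub>F b in nbhd_filter t. gamma_point b \<in> characters"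
    by (rule always_eventually) (use character_gamma_point in \<open>auto simp: topspace_gamma\<close>)
  show "\<forall>\<^sub>F b in nbhd_filter t. gamma_point b \<in> topspace (product_topology (\<lambda>_. euclidean) galg)"
    by (simp add: gamma_point_def)
  show "limitin euclidean (\<lambda>b. gamma_point b f) (t f) (nbhd_filter t)" if "f \<in> galg" for f
    using tendsto_character[OF t that] that by (simp add: gamma_point_apply)
qed

text \<open>Every set of the filter at \<open>gamma_point b\<close> contains \<open>b\<close>, so
  closeness to the limit along the filter includes closeness of \<open>m b\<close>.\<close>

lemma tendsto_nbhd_filter_gamma_point:
  fixes m :: "'p::order \<Rightarrow> 'e::metric_space"
  assumes "(m \<longlongrightarrow> l) (nbhd_filter (gamma_point b))"
  shows "l = m b"
proof (rule ccontr)
  assume "l \<noteq> m b"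
  then have "\<forall>\<^sub>F x in nbhd_filter (gamma_point b). dist (m x) l < dist (m b) l"
    by (intro tendstoD[OF assms]) auto
  then obtain U where "indicator U \<in> galg" "gamma_point b (indicator U) = 1" "\<forall>x\<in>U. dist (m x) l < dist (m b) l"
    using eventually_nbhd_filterD[OF character_gamma_point] by blast
  then show False by (cases "b \<in> U") (auto simp: gamma_point_apply)
qed

lemma Hausdorff_gamma: "Hausdorff_space gamma"
  unfolding gamma_eq by (intro Hausdorff_space_subtopology) (auto simp: Hausdorff_space_product_topology)

lemma continuous_map_gamma_eval: "f \<in> galg \<Longrightarrow> continuous_map gamma euclidean (\<lambda>t. t f)"
  unfolding gamma_eq by (intro continuous_map_from_subtopology continuous_map_product_projection)

lemma compact_gamma: "compact_space (gamma :: (('p::order \<Rightarrow> complex) \<Rightarrow> complex) topology)"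
proof -
  let ?X = "product_topology (\<lambda>_. euclidean :: complex topology) (galg :: ('p \<Rightarrow> complex) set)"
  let ?E = "topspace ?X"
  \<comment> \<open>Being nonzero is not a closed condition. For a multiplicative functional it
    amounts to taking the value 1 at the unit, which is closed.\<close>
  have eq: "topspace gamma = {h \<in> ?E. h (\<lambda>_. 1) = 1} \<inter>
      (\<Inter>f\<in>galg. \<Inter>g\<in>galg. {h \<in> ?E. h (\<lambda>b. f b + g b) = h f + h g} \<inter> {h \<in> ?E. h (\<lambda>b. f b * g b) = h f * h g}) \<inter>
      (\<Inter>f\<in>galg. \<Inter>c. {h \<in> ?E. h (\<lambda>b. c * f b) = c * h f})" (is "_ = ?R")
  proof (intro equalityI subsetI)
    fix h :: "('p \<Rightarrow> complex) \<Rightarrow> complex" assume h: "h \<in> topspace gamma"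
    then show "h \<in> ?R"
      by (auto simp: character_const character_add character_mult character_scale)
        (auto simp: topspace_gamma PiE_def extensional_def)
  next
    fix h assume h: "h \<in> ?R"
    then have "h \<in> characters"
      unfolding characters_def linear_map_def gamma_algebra_ops
      using galg_const[of 1] by (auto simp: complex_cstar_def intro!: bexI[of _ "\<lambda>_. 1"])
    then show "h \<in> topspace gamma" using h by (auto simp: topspace_gamma PiE_def)
  qed
  have pr: "continuous_map ?X euclidean (\<lambda>h. h f)" if "f \<in> galg" for f
    using continuous_map_product_projection[OF that, of "\<lambda>_. euclidean"] by simp
  have cl: "closedin ?X {h \<in> ?E. u h = v h}"
    if "continuous_map ?X euclidean u" "continuous_map ?X euclidean v" for u v :: "_ \<Rightarrow> complex"
    using closedin_continuous_maps_eq[OF _ that] by simp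
  have cm: "continuous_map ?X euclidean (\<lambda>h. h f * h g)" "continuous_map ?X euclidean (\<lambda>h. h f + h g)"
    "continuous_map ?X euclidean (\<lambda>h. c * h f)" if "f \<in> galg" "g \<in> galg" for f g c
    using pr[OF that(1)] pr[OF that(2)] unfolding continuous_map_euclidean_iff
    by (auto intro!: tendsto_mult tendsto_add tendsto_const)
  have cc: "closedin ?X {h \<in> ?E. h (\<lambda>b. f b + g b) = h f + h g}"
    "closedin ?X {h \<in> ?E. h (\<lambda>b. f b * g b) = h f * h g}"
    "closedin ?X {h \<in> ?E. h (\<lambda>b. c * f b) = c * h f}" if "f \<in> galg" "g \<in> galg" for f g c
    by (intro cl pr cm(1,2)[OF that] cm(3)[OF that(1) that(1)] galg_add galg_mult galg_scale that)+
  have "closedin ?X {h \<in> ?E. h (\<lambda>_. 1) = 1}"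
    by (intro cl pr galg_const) simp
  moreover have "galg \<noteq> {}" using galg_const by blast
  ultimately have closed: "closedin ?X (topspace gamma)"
    unfolding eq by (intro closedin_Int closedin_INT cc) auto
  \<comment> \<open>By \<open>character_bound\<close> all characters lie in a product of discs with
    these radii, which is compact by Tychonoff.\<close>
  obtain B :: "('p \<Rightarrow> complex) \<Rightarrow> real" where B: "\<And>f b. f \<in> galg \<Longrightarrow> cmod (f b) \<le> B f" using galg_bounded by metis
  have "compactin ?X (PiE galg (\<lambda>f. cball 0 (B f)))"
    by (simp add: compactin_PiE)
  moreover have "topspace gamma \<subseteq> PiE galg (\<lambda>f. cball 0 (B f))"
  proof
    fix t :: "('p \<Rightarrow> complex) \<Rightarrow> complex" assume t: "t \<in> topspace gamma"
    have "cmod (t f) \<le> B f" if "f \<in> galg" for f by (rule character_bound[OF t that B[OF that]])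
    then show "t \<in> PiE galg (\<lambda>f. cball 0 (B f))" using t by (auto simp: PiE_def topspace_gamma)
  qed
  ultimately have "compactin ?X (topspace gamma)" using closed closed_compactin by blast
  then have "compactin (subtopology ?X characters) (topspace gamma)"
    by (auto simp: compactin_subtopology topspace_gamma)
  then show ?thesis by (simp only: compact_space_def gamma_eq[symmetric])
qed

section \<open>Continuous extension to the compactification\<close>

lemma gamma_ext_unique:
  fixes m :: "'p::order \<Rightarrow> 'e::metric_space"
  assumes g: "continuous_map gamma euclidean g" "\<And>b. g (gamma_point b) = m b" and t: "t \<in> topspace gamma"
  shows "(m \<longlongrightarrow> g t) (nbhd_filter t)"
proof -
  have "g \<circ> gamma_point = m" using g(2) by auto
  then show ?thesis using continuous_map_limit[OF g(1) limitin_gamma_point[OF t]] by simp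
qed

text \<open>Convergence along each filter already gives continuity in \<open>t\<close>: a base set
  on which \<open>m\<close> is close to its limit at \<open>t\<close> spans a neighbourhood of
  \<open>t\<close>, at whose points the limits of \<open>m\<close> are equally close.\<close>

lemma
  fixes m :: "'p::order \<Rightarrow> 'e::metric_space"
  assumes conv: "\<And>t. t \<in> topspace gamma \<Longrightarrow> \<exists>l. (m \<longlongrightarrow> l) (nbhd_filter t)"
  shows continuous_map_gamma_ext: "continuous_map gamma euclidean (gamma_ext m)"
    and tendsto_gamma_ext: "t \<in> topspace gamma \<Longrightarrow> (m \<longlongrightarrow> gamma_ext m t) (nbhd_filter t)"
proof -
  obtain l where l: "\<And>t. t \<in> topspace gamma \<Longrightarrow> (m \<longlongrightarrow> l t) (nbhd_filter t)" using conv by metis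
  define g where "g = restrict l (topspace gamma)"
  have g: "(m \<longlongrightarrow> g t) (nbhd_filter t)" if "t \<in> topspace gamma" for t using l[OF that] that by (simp add: g_def)
  have cont: "continuous_map gamma euclidean g"
    unfolding continuous_map_euclidean_iff
  proof
    fix t :: "('p \<Rightarrow> complex) \<Rightarrow> complex" assume t: "t \<in> topspace gamma"
    show "(g \<longlongrightarrow> g t) (atin gamma t)"
    proof (rule tendstoI)
      fix e :: real assume e: "e > 0"
      have "\<forall>\<^sub>F b in nbhd_filter t. dist (m b) (g t) < e/2" using tendstoD[OF g[OF t], of "e/2"] e by simp
      then obtain U where U: "indicator U \<in> galg" "t (indicator U) = 1" "\<forall>b\<in>U. dist (m b) (g t) < e/2"
        using eventually_nbhd_filterD[OF t] by blast
      \<comment> \<open>Characters take only the values 0 and 1 on the indicator, so this open set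
        consists of the \<open>s\<close> whose filter contains \<open>U\<close>.\<close>
      let ?W = "{s \<in> topspace gamma. s (indicator U) \<in> - {0}}"
      have "openin gamma ?W"
        by (rule openin_continuous_map_preimage[OF continuous_map_gamma_eval[OF U(1)]]) (simp add: open_Compl)
      moreover have "dist (g s) (g t) < e" if "s \<in> ?W" for s
      proof -
        have s: "s \<in> topspace gamma" "s (indicator U) = 1"
          using that character_indicator[OF _ U(1), of s] by auto
        have "dist (g s) (g t) \<le> e/2"
        proof (rule tendsto_upperbound)
          show "((\<lambda>b. dist (m b) (g t)) \<longlongrightarrow> dist (g s) (g t)) (nbhd_filter s)"
            by (intro tendsto_dist g s tendsto_const)
          show "\<forall>\<^sub>F b in nbhd_filter s. dist (m b) (g t) \<le> e/2"
            using eventually_nbhd_filterI[OF s(1) U(1) s(2)] by eventually_elim (use U(3) in \<open>auto intro: less_imp_le\<close>)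
        qed (rule nbhd_filter_neq_bot[OF s(1)])
        then show ?thesis using e by simp
      qed
      ultimately show "\<forall>\<^sub>F s in atin gamma t. dist (g s) (g t) < e"
        unfolding eventually_atin using t U(2) by (intro disjI2 exI[of _ ?W]) auto
    qed
  qed
  have pt: "g (gamma_point b) = m b" for b
    by (rule tendsto_nbhd_filter_gamma_point[OF g[OF character_gamma_point]])
  have "gamma_ext m = g"
    unfolding gamma_ext_def
  proof (rule the_equality)
    show "g \<in> extensional (topspace gamma) \<and> continuous_map gamma euclidean g \<and> (\<forall>b. g (gamma_point b) = m b)"
      using cont pt by (simp add: g_def)
    fix h assume h: "h \<in> extensional (topspace gamma) \<and> continuous_map gamma euclidean h \<and> (\<forall>b. h (gamma_point b) = m b)"
    show "h = g"
    proof (rule extensionalityI[of _ "topspace gamma"])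
      fix t :: "('p \<Rightarrow> complex) \<Rightarrow> complex" assume t: "t \<in> topspace gamma"
      have "(m \<longlongrightarrow> h t) (nbhd_filter t)" using h by (intro gamma_ext_unique t) auto
      then show "h t = g t" using tendsto_unique[OF nbhd_filter_neq_bot[OF t] _ g[OF t]] by blast
    qed (use h in \<open>auto simp: g_def\<close>)
  qed
  then show "continuous_map gamma euclidean (gamma_ext m)"
    "t \<in> topspace gamma \<Longrightarrow> (m \<longlongrightarrow> gamma_ext m t) (nbhd_filter t)"
    using cont g by simp_all
qed

lemma gamma_ext_eq:
  fixes m :: "'p::order \<Rightarrow> 'e::metric_space"
  assumes "\<And>t. t \<in> topspace gamma \<Longrightarrow> \<exists>l. (m \<longlongrightarrow> l) (nbhd_filter t)"
    and t: "t \<in> topspace gamma" and "(m \<longlongrightarrow> l) (nbhd_filter t)"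
  shows "gamma_ext m t = l"
  using tendsto_unique[OF nbhd_filter_neq_bot[OF t] tendsto_gamma_ext[of m t]] assms by blast

text \<open>By compactness a continuous function on \<open>gamma\<close> is a uniform limit of step functions with
  clopen steps.\<close>

lemma galg_of_continuous:
  assumes f: "continuous_map gamma euclidean f"
  shows "(\<lambda>b :: 'p::order. f (gamma_point b) :: complex) \<in> galg"
proof -
  let ?F = "\<lambda>b :: 'p. f (gamma_point b)"
  have approx: "\<exists>g\<in>galg. \<forall>b. cmod (g b - ?F b) < e" if e: "e > 0" for e
  proof -
    have "\<exists>U c. indicator U \<in> galg \<and> t (indicator U) = 1 \<and> (\<forall>b\<in>U. cmod (c - ?F b) < e)"
      if t: "t \<in> topspace gamma" for t
    proof -
      have "(?F \<longlongrightarrow> f t) (nbhd_filter t)" by (rule gamma_ext_unique[OF f _ t]) simp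
      then have "\<forall>\<^sub>F b in nbhd_filter t. dist (?F b) (f t) < e" using e by (rule tendstoD)
      then show ?thesis
        using eventually_nbhd_filterD[OF t] unfolding dist_norm by (metis norm_minus_commute)
    qed
    note loc = this
    let ?W = "\<lambda>U. {s \<in> topspace gamma. s (indicator U) \<in> - {0}}"
    define \<U> where "\<U> = {?W U | U. indicator U \<in> galg \<and> (\<exists>c. \<forall>b\<in>U. cmod (c - ?F b) < e)}"
    have op: "openin gamma W" if W: "W \<in> \<U>" for W
    proof -
      obtain U where "W = ?W U" "indicator U \<in> galg" using W unfolding \<U>_def by blast
      then show ?thesis
        using openin_continuous_map_preimage[OF continuous_map_gamma_eval, of "indicator U" "- {0}"]
        by (simp add: open_Compl)
    qed
    have cov: "topspace gamma \<subseteq> \<Union>\<U>"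
    proof
      fix t :: "('p \<Rightarrow> complex) \<Rightarrow> complex" assume t: "t \<in> topspace gamma"
      obtain U c where U: "indicator U \<in> galg" "t (indicator U) = 1" "\<forall>b\<in>U. cmod (c - ?F b) < e"
        using loc[OF t] by blast
      then have "?W U \<in> \<U>" "t \<in> ?W U" unfolding \<U>_def using t by auto
      then show "t \<in> \<Union>\<U>" by blast
    qed
    have "compactin gamma (topspace gamma)" using compact_gamma by (simp add: compact_space_def)
    from compactinD[OF this op cov] obtain \<F>
      where F: "finite \<F>" "\<F> \<subseteq> \<U>" "topspace gamma \<subseteq> \<Union>\<F>" by blast
    \<comment> \<open>The local constants are glued over the finite subcover one set at a time: on
      each new \<open>U\<close> the function built so far is overwritten by the constant for
      \<open>U\<close>.\<close>
    have "\<exists>g\<in>galg. \<forall>b. gamma_point b \<in> \<Union>\<F> \<longrightarrow> cmod (g b - ?F b) < e"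
      using F(1,2)
    proof (induction \<F> rule: finite_induct)
      case empty show ?case using galg_const[of 0] by auto
    next
      case (insert W \<F>)
      then obtain g where g: "g \<in> galg" "\<And>b. gamma_point b \<in> \<Union>\<F> \<Longrightarrow> cmod (g b - ?F b) < e" by auto
      have "W \<in> \<U>" using insert.prems by blast
      then obtain U c where U: "W = ?W U" "indicator U \<in> galg" "\<And>b. b \<in> U \<Longrightarrow> cmod (c - ?F b) < e"
        unfolding \<U>_def by blast
      let ?g = "\<lambda>b. c * indicator U b + indicator (- U) b * g b"
      have "?g \<in> galg" by (intro galg_add galg_scale galg_mult galg_indicator_Compl U(2) g(1))
      moreover have "cmod (?g b - ?F b) < e" if "gamma_point b \<in> \<Union>(insert W \<F>)" for b
      proof (cases "b \<in> U")
        case False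
        then have "gamma_point b \<notin> W" using U(1,2) by (simp add: gamma_point_apply)
        then show ?thesis using that g(2)[of b] False by simp
      qed (simp add: U(3))
      ultimately show ?case by (intro bexI[of _ ?g] allI impI)
    qed
    then obtain g where g: "g \<in> galg" and le: "\<forall>b. gamma_point b \<in> \<Union>\<F> \<longrightarrow> cmod (g b - ?F b) < e"
      by (rule bexE)
    show ?thesis
      by (rule bexI[OF _ g]) (intro allI le[rule_format] subsetD[OF F(3)] character_gamma_point)
  qed
  have "\<forall>n. \<exists>g\<in>galg. \<forall>b. cmod (g b - ?F b) < 1 / real (Suc n)" using approx by simp
  then obtain g where g: "\<And>n. g n \<in> galg" "\<And>n b. cmod (g n b - ?F b) < 1 / real (Suc n)" by metis
  have "uniform_limit UNIV g ?F sequentially"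
    unfolding uniform_limit_iff
  proof (intro allI impI)
    fix e :: real assume "e > 0"
    then have "\<forall>\<^sub>F n in sequentially. dist (1 / real (Suc n)) 0 < e" by (intro tendstoD LIMSEQ_inverse_real_of_nat[unfolded inverse_eq_divide])
    then show "\<forall>\<^sub>F n in sequentially. \<forall>b\<in>UNIV. dist (g n b) (?F b) < e"
      by eventually_elim (use g(2) in \<open>auto simp: dist_norm intro: less_trans\<close>)
  qed
  then show ?thesis by (rule galg_limit[OF g(1)])
qed

section \<open>Fields of operator spaces\<close>

definition extendable :: "('p::order \<Rightarrow> 'e::metric_space) \<Rightarrow> bool" where
  "extendable m \<longleftrightarrow> (\<forall>t\<in>topspace gamma. \<exists>l. (m \<longlongrightarrow> l) (nbhd_filter t))"

lemma field_eval_tendsto: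
  "extendable m \<Longrightarrow> t \<in> topspace gamma \<Longrightarrow> (m \<longlongrightarrow> field_eval t m) (nbhd_filter t)"
  unfolding field_eval_def extendable_def by (rule tendsto_gamma_ext) auto

lemma field_eval_eqI:
  "t \<in> topspace gamma \<Longrightarrow> extendable m \<Longrightarrow> (m \<longlongrightarrow> l) (nbhd_filter t) \<Longrightarrow> field_eval t m = l"
  unfolding field_eval_def extendable_def by (rule gamma_ext_eq) auto

lemma continuous_map_field_eval: "extendable m \<Longrightarrow> continuous_map gamma euclidean (\<lambda>t. field_eval t m)"
  unfolding field_eval_def extendable_def by (rule continuous_map_gamma_ext) auto

lemma field_eval_gamma_point: "extendable m \<Longrightarrow> field_eval (gamma_point b) m = m b"
  by (intro tendsto_nbhd_filter_gamma_point field_eval_tendsto character_gamma_point)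

lemma extendable_const: "extendable (\<lambda>_. c)"
  unfolding extendable_def by (blast intro: tendsto_const)

lemma extendable_galg: "f \<in> galg \<Longrightarrow> extendable f"
  unfolding extendable_def using tendsto_character by blast

lemma field_eval_galg: "t \<in> topspace gamma \<Longrightarrow> f \<in> galg \<Longrightarrow> field_eval t f = t f"
  by (intro field_eval_eqI extendable_galg tendsto_character)

lemma
  assumes "bounded_bilinear h" "extendable f" "extendable g"
  shows extendable_bilinear: "extendable (\<lambda>b. h (f b) (g b))"
    and field_eval_bilinear: "t \<in> topspace gamma \<Longrightarrow> field_eval t (\<lambda>b. h (f b) (g b)) = h (field_eval t f) (field_eval t g)"
proof -
  have *: "((\<lambda>b. h (f b) (g b)) \<longlongrightarrow> h (field_eval t f) (field_eval t g)) (nbhd_filter t)"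
    if "t \<in> topspace gamma" for t
    by (intro bounded_bilinear.tendsto[OF assms(1)] field_eval_tendsto that assms)
  then show e: "extendable (\<lambda>b. h (f b) (g b))" unfolding extendable_def by blast
  show "t \<in> topspace gamma \<Longrightarrow> field_eval t (\<lambda>b. h (f b) (g b)) = h (field_eval t f) (field_eval t g)"
    by (rule field_eval_eqI[OF _ e *])
qed

lemma
  fixes f g :: "'p::order \<Rightarrow> 'e::real_normed_vector"
  assumes "extendable f" "extendable g"
  shows extendable_add: "extendable (\<lambda>b. f b + g b)"
    and field_eval_add: "t \<in> topspace gamma \<Longrightarrow> field_eval t (\<lambda>b. f b + g b) = field_eval t f + field_eval t g"
proof -
  have *: "((\<lambda>b. f b + g b) \<longlongrightarrow> field_eval t f + field_eval t g) (nbhd_filter t)"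
    if "t \<in> topspace gamma" for t
    by (intro tendsto_add field_eval_tendsto that assms)
  then show e: "extendable (\<lambda>b. f b + g b)" unfolding extendable_def by blast
  show "t \<in> topspace gamma \<Longrightarrow> field_eval t (\<lambda>b. f b + g b) = field_eval t f + field_eval t g"
    by (rule field_eval_eqI[OF _ e *])
qed

lemma field_eval_const:
  fixes c :: "'e::metric_space"
  shows "t \<in> topspace gamma \<Longrightarrow> field_eval t (\<lambda>_. c) = c"
  by (intro field_eval_eqI extendable_const tendsto_const)

lemma field_eval_cscale:
  assumes "extendable m" "t \<in> topspace gamma"
  shows "field_eval t (\<lambda>b. cscale_op c (m b)) = cscale_op c (field_eval t m)"
  using field_eval_bilinear[OF bounded_bilinear_cscale_op extendable_const assms, of c] assms(2)
  by (simp add: field_eval_const)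

lemma extendable_cscale: "extendable m \<Longrightarrow> extendable (\<lambda>b. cscale_op c (m b))"
  by (rule extendable_bilinear[OF bounded_bilinear_cscale_op extendable_const])

lemma field_eval_bounded_ops:
  assumes "m \<in> cb bounded_ops" "extendable m" "t \<in> topspace gamma"
  shows "field_eval t m \<in> bounded_ops"
  by (rule tendsto_bounded_ops[OF cb_in[OF assms(1)] nbhd_filter_neq_bot[OF assms(3)]
        field_eval_tendsto[OF assms(2,3)]])

lemma
  assumes "m \<in> cb bounded_ops" "extendable m"
  shows extendable_adj: "extendable (\<lambda>b. adj (m b))"
    and field_eval_adj: "t \<in> topspace gamma \<Longrightarrow> field_eval t (\<lambda>b. adj (m b)) = adj (field_eval t m)"
proof -
  have *: "((\<lambda>b. adj (m b)) \<longlongrightarrow> adj (field_eval t m)) (nbhd_filter t)" if "t \<in> topspace gamma" for t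
    by (intro tendsto_adj cb_in[OF assms(1)] field_eval_bounded_ops field_eval_tendsto that assms)
  then show e: "extendable (\<lambda>b. adj (m b))" unfolding extendable_def by blast
  show "t \<in> topspace gamma \<Longrightarrow> field_eval t (\<lambda>b. adj (m b)) = adj (field_eval t m)"
    by (rule field_eval_eqI[OF _ e *])
qed

lemma field_eval_norm_le:
  fixes m :: "'p::order \<Rightarrow> 'e::real_normed_vector"
  assumes "extendable m" "t \<in> topspace gamma" "\<And>b. norm (m b) \<le> B"
  shows "norm (field_eval t m) \<le> B"
  by (rule tendsto_upperbound[OF tendsto_norm[OF field_eval_tendsto[OF assms(1,2)]] _ nbhd_filter_neq_bot[OF assms(2)]])
    (simp add: assms(3))

text \<open>The values at \<open>t\<close> form a Cauchy sequence because evaluation does not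
  increase uniform distances; uniform convergence then allows the two limits to be
  interchanged.\<close>

lemma extendable_uniform_limit:
  fixes s :: "nat \<Rightarrow> 'p::order \<Rightarrow> 'e::banach"
  assumes s: "\<And>n. extendable (s n)" and l: "uniform_limit UNIV s l sequentially"
  shows "extendable l"
    and "t \<in> topspace gamma \<Longrightarrow> (\<lambda>n. field_eval t (s n)) \<longlonglongrightarrow> field_eval t l"
proof -
  have *: "\<exists>y. (\<lambda>n. field_eval t (s n)) \<longlonglongrightarrow> y \<and> (l \<longlongrightarrow> y) (nbhd_filter t)" if t: "t \<in> topspace gamma" for t
  proof -
    have "Cauchy (\<lambda>n. field_eval t (s n))"
      unfolding Cauchy_def
    proof (intro allI impI)
      fix e :: real assume e: "e > 0"
      have "\<forall>\<^sub>F n in sequentially. \<forall>b\<in>UNIV. dist (s n b) (l b) < e/4"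
        using l e by (intro uniform_limitD) auto
      then obtain N where N: "\<And>n b. n \<ge> N \<Longrightarrow> dist (s n b) (l b) < e/4"
        unfolding eventually_sequentially by blast
      have "dist (field_eval t (s m)) (field_eval t (s n)) < e" if "m \<ge> N" "n \<ge> N" for m n
      proof -
        have "dist (s m b) (s n b) \<le> e/2" for b
          using dist_triangle2[of "s m b" "s n b" "l b"] N[OF that(1), of b] N[OF that(2), of b] by simp
        then have "dist (field_eval t (s m)) (field_eval t (s n)) \<le> e/2"
          by (intro tendsto_upperbound[OF tendsto_dist[OF field_eval_tendsto[OF s t] field_eval_tendsto[OF s t]]
                _ nbhd_filter_neq_bot[OF t]]) simp
        then show ?thesis using e by simp
      qed
      then show "\<exists>M. \<forall>m\<ge>M. \<forall>n\<ge>M. dist (field_eval t (s m)) (field_eval t (s n)) < e" by blast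
    qed
    then obtain y where y: "(\<lambda>n. field_eval t (s n)) \<longlonglongrightarrow> y" by (auto simp: Cauchy_convergent_iff convergent_def)
    have "(l \<longlongrightarrow> y) (nbhd_filter t)"
      by (rule swap_uniform_limit'[OF _ y l]) (use field_eval_tendsto[OF s t] in auto)
    then show ?thesis using y by blast
  qed
  then show e: "extendable l" unfolding extendable_def by blast
  show "t \<in> topspace gamma \<Longrightarrow> (\<lambda>n. field_eval t (s n)) \<longlonglongrightarrow> field_eval t l"
    using * field_eval_eqI[OF _ e] by blast
qed

text \<open>Each filter contains \<open>{a..}\<close> or its complement, and the map is constant on
  either.\<close>

lemma extendable_step_map: "extendable (step_map a s)"
proof -
  have eq: "step_map a s = (\<lambda>b. if indicator {a..} b = (1::complex) then s else 0)"
    by (auto simp: step_map_def indicator_def)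
  have "\<exists>l. (step_map a s \<longlongrightarrow> l) (nbhd_filter t)" if t: "t \<in> topspace gamma" for t :: "('a \<Rightarrow> complex) \<Rightarrow> complex"
  proof -
    have "\<forall>\<^sub>F b in nbhd_filter t. (a \<le> b) = (t (indicator {a..}) = 1)"
      unfolding nbhd_filter_def by (rule eventually_INF1[of a]) (simp_all add: eventually_principal)
    then have "\<forall>\<^sub>F b in nbhd_filter t. step_map a s b = (if t (indicator {a..}) = 1 then s else 0)"
      by (rule eventually_mono) (simp add: step_map_def)
    then show ?thesis by (blast intro: tendsto_eventually)
  qed
  then show ?thesis unfolding extendable_def by blast
qed

lemma cb_step_map: "s \<in> S \<Longrightarrow> 0 \<in> S \<Longrightarrow> step_map a s \<in> cb S"
  unfolding step_map_def[abs_def] by (rule cb_step)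

text \<open>The properties shared by the total spaces of all three fields. Closedness of the fibres
  and the action of the continuous functions on \<open>gamma\<close> follow from these
  alone.\<close>

definition galg_module :: "('p::order \<Rightarrow> 'a ell2 \<Rightarrow>\<^sub>L 'b ell2) set \<Rightarrow> bool" where
  "galg_module N \<longleftrightarrow> closed_subspace cscale_op bounded_ops N \<and> (\<forall>m\<in>N. extendable m) \<and>
     (\<forall>f\<in>galg. \<forall>m\<in>N. (\<lambda>b. cscale_op (f b) (m b)) \<in> N)"

context
  fixes N :: "('p::order \<Rightarrow> 'a ell2 \<Rightarrow>\<^sub>L 'b ell2) set"
  assumes N: "galg_module N"
begin

lemma galg_module_subspace: "closed_subspace cscale_op bounded_ops N"
  and galg_module_extendable: "m \<in> N \<Longrightarrow> extendable m"
  and galg_module_scale: "f \<in> galg \<Longrightarrow> m \<in> N \<Longrightarrow> (\<lambda>b. cscale_op (f b) (m b)) \<in> N"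
  using N by (auto simp: galg_module_def)

lemmas galg_module_cb = closed_subspaceD(1)[OF galg_module_subspace]
lemmas galg_module_add = closed_subspaceD(3)[OF galg_module_subspace]
lemmas galg_module_cscale = closed_subspaceD(4)[OF galg_module_subspace]

lemma galg_module_diff: "f \<in> N \<Longrightarrow> g \<in> N \<Longrightarrow> (\<lambda>b. f b - g b) \<in> N"
  using galg_module_add[OF _ galg_module_cscale[of g "-1"], of f] by (simp add: cscale_op_distrib)

lemma fibre_subspace:
  assumes t: "t \<in> topspace gamma"
  shows "field_eval t ` N \<subseteq> bounded_ops" "0 \<in> field_eval t ` N"
    "x \<in> field_eval t ` N \<Longrightarrow> y \<in> field_eval t ` N \<Longrightarrow> x + y \<in> field_eval t ` N"
    "x \<in> field_eval t ` N \<Longrightarrow> cscale_op c x \<in> field_eval t ` N"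
proof -
  show "field_eval t ` N \<subseteq> bounded_ops"
    using field_eval_bounded_ops[OF galg_module_cb galg_module_extendable t] by blast
  show "0 \<in> field_eval t ` N"
    using closed_subspaceD(2)[OF galg_module_subspace] field_eval_const[OF t, of 0] by (metis imageI)
  show "x + y \<in> field_eval t ` N" if xy: "x \<in> field_eval t ` N" "y \<in> field_eval t ` N"
  proof -
    obtain f g where fg: "x = field_eval t f" "y = field_eval t g" "f \<in> N" "g \<in> N" using xy by blast
    show ?thesis
      unfolding fg(1,2) field_eval_add[OF galg_module_extendable[OF fg(3)] galg_module_extendable[OF fg(4)] t, symmetric]
      by (intro imageI galg_module_add fg)
  qed
  show "cscale_op c x \<in> field_eval t ` N" if x: "x \<in> field_eval t ` N"
  proof -
    obtain f where f: "x = field_eval t f" "f \<in> N" using x by blast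
    show ?thesis
      unfolding f(1) field_eval_cscale[OF galg_module_extendable[OF f(2)] t, symmetric]
      by (intro imageI galg_module_cscale f)
  qed
qed

text \<open>Multiplication by the indicator of a small clopen neighbourhood shrinks the norm of a section
  to that of its value.\<close>

lemma lift_norm:
  assumes t: "t \<in> topspace gamma" and m: "m \<in> N" "norm (field_eval t m) < e"
  shows "\<exists>k\<in>N. field_eval t k = field_eval t m \<and> (\<forall>b. norm (k b) \<le> e)"
proof -
  have "\<forall>\<^sub>F b in nbhd_filter t. norm (m b) < e"
    using tendsto_norm[OF field_eval_tendsto[OF galg_module_extendable[OF m(1)] t]] m(2) by (rule order_tendstoD)
  then obtain U where U: "indicator U \<in> galg" "t (indicator U) = 1" "\<forall>b\<in>U. norm (m b) < e"
    using eventually_nbhd_filterD[OF t] by blast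
  define k where "k = (\<lambda>b. cscale_op (indicator U b) (m b))"
  have "k \<in> N" unfolding k_def by (rule galg_module_scale[OF U(1) m(1)])
  moreover have "field_eval t k = field_eval t m"
    unfolding k_def
    using field_eval_bilinear[OF bounded_bilinear_cscale_op extendable_galg[OF U(1)] galg_module_extendable[OF m(1)] t]
    by (simp add: field_eval_galg[OF t U(1)] U(2) cscale_op_distrib)
  moreover have "norm (k b) \<le> e" for b
    using U(3) le_less_trans[OF norm_ge_zero m(2)] by (cases "b \<in> U") (auto simp: k_def cscale_op_distrib)
  ultimately show ?thesis by blast
qed

text \<open>As in the open mapping theorem, small differences in the fibre lift to uniformly small
  sections by \<open>lift_norm\<close>. Successive corrections turn approximating values into a
  uniformly convergent sequence of sections.\<close>

lemma closed_fibre: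
  assumes t: "t \<in> topspace gamma"
  shows "closed (field_eval t ` N)"
  unfolding closed_limpt islimpt_approachable
proof (intro allI impI)
  fix y assume y: "\<forall>e>0. \<exists>x'\<in>field_eval t ` N. x' \<noteq> y \<and> dist x' y < e"
  \<comment> \<open>\<open>?P\<close> makes the values converge to \<open>y\<close>, and
    \<open>?Q\<close> makes the increments of the sections summable uniformly in
    \<open>b\<close>.\<close>
  let ?P = "\<lambda>n s. s \<in> N \<and> norm (field_eval t s - y) < (1/2) ^ n"
  let ?Q = "\<lambda>n s s'. \<forall>b. norm (s' b - s b) \<le> 2 * (1/2) ^ n"
  have near: "\<exists>s. ?P n s" for n
    using y[rule_format, of "(1/2) ^ n"] by (auto simp: dist_norm)
  have step: "\<exists>s'. ?P (Suc n) s' \<and> ?Q n s s'" if s: "?P n s" for s n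
  proof -
    obtain r where r: "r \<in> N" "norm (field_eval t r - y) < (1/2) ^ Suc n" using near by blast
    let ?d = "\<lambda>b. r b - s b"
    have d: "?d \<in> N" using galg_module_diff r(1) s by blast
    have rd: "field_eval t r = field_eval t s + field_eval t ?d"
      using field_eval_add[OF galg_module_extendable galg_module_extendable t, of s ?d] s d by simp
    \<comment> \<open>The two values lie within \<open>(1/2) ^ Suc n\<close> and
      \<open>(1/2) ^ n\<close> of \<open>y\<close>.\<close>
    have "norm (field_eval t ?d) < 2 * (1/2) ^ n"
    proof -
      have "field_eval t ?d = (field_eval t r - y) - (field_eval t s - y)" by (simp add: rd)
      then have "norm (field_eval t ?d) \<le> norm (field_eval t r - y) + norm (field_eval t s - y)"
        by (metis norm_triangle_ineq4)
      moreover have "(1/2::real) ^ Suc n < (1/2) ^ n" by simp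
      ultimately show ?thesis using r(2) s by linarith
    qed
    then obtain k where k: "k \<in> N" "field_eval t k = field_eval t ?d" "\<forall>b. norm (k b) \<le> 2 * (1/2) ^ n"
      using lift_norm[OF t d] by blast
    let ?s = "\<lambda>b. s b + k b"
    have "?s \<in> N" using galg_module_add s k(1) by blast
    moreover have "field_eval t ?s = field_eval t r"
      using field_eval_add[OF galg_module_extendable galg_module_extendable t, of s k] s k rd by simp
    ultimately show ?thesis using r(2) k(3) by (intro exI[of _ ?s]) simp
  qed
  obtain s where s: "\<And>n. ?P n (s n)" "\<And>n. ?Q n (s n) (s (Suc n))"
    using dependent_nat_choice[of ?P ?Q, OF near step] by blast
  \<comment> \<open>The sum of the increments; by telescoping, \<open>s\<close> converges uniformly
    to \<open>l\<close> plus the initial section \<open>s 0\<close>.\<close>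
  define l where "l = (\<lambda>b. \<Sum>i. s (Suc i) b - s i b)"
  have l: "uniform_limit UNIV (\<lambda>n b. \<Sum>i<n. s (Suc i) b - s i b) l sequentially"
    unfolding l_def
    by (rule Weierstrass_m_test[where M = "\<lambda>n. 2 * (1/2) ^ n"])
      (use s(2) in \<open>auto intro!: summable_mult summable_geometric\<close>)
  have "uniform_limit UNIV s (\<lambda>b. l b + s 0 b) sequentially"
  proof -
    have eq: "(\<Sum>i<n. s (Suc i) b - s i b) - l b = s n b - (l b + s 0 b)" for n b
      by (subst sum_lessThan_telescope) simp
    show ?thesis using l by (simp only: uniform_limit_iff dist_norm eq)
  qed
  note lim = this
  have ls: "(\<lambda>b. l b + s 0 b) \<in> N"
    by (rule closed_subspaceD(5)[OF galg_module_subspace _ lim]) (use s(1) in blast)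
  have "(\<lambda>n. field_eval t (s n)) \<longlonglongrightarrow> field_eval t (\<lambda>b. l b + s 0 b)"
    by (rule extendable_uniform_limit(2)[OF _ lim t]) (use s(1) galg_module_extendable in blast)
  moreover have "(\<lambda>n. field_eval t (s n)) \<longlonglongrightarrow> y"
  proof (rule LIM_zero_cancel, rule Lim_null_comparison)
    show "\<forall>\<^sub>F n in sequentially. norm (field_eval t (s n) - y) \<le> (1/2) ^ n"
      by (intro always_eventually allI less_imp_le) (use s(1) in blast)
    show "(\<lambda>n. (1/2) ^ n :: real) \<longlonglongrightarrow> 0" by (rule LIMSEQ_realpow_zero) auto
  qed
  ultimately have "y = field_eval t (\<lambda>b. l b + s 0 b)" using LIMSEQ_unique by blast
  then show "y \<in> field_eval t ` N" using ls by blast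
qed

text \<open>A continuous function on \<open>gamma\<close> acts through its restriction to the poset,
  which lies in \<open>galg\<close> by \<open>galg_of_continuous\<close>.\<close>

lemma CT_acts_galg_module:
  assumes "carr V = N" "\<And>t. t \<in> topspace gamma \<Longrightarrow> scl (Vt t) = cscale_op"
  shows "CT_acts gamma V Vt field_eval"
  unfolding CT_acts_def assms(1)
proof (intro exI[of _ "\<lambda>f m b. cscale_op (f (gamma_point b)) (m b)"] allI impI ballI conjI)
  fix f :: "(('p \<Rightarrow> complex) \<Rightarrow> complex) \<Rightarrow> complex" and m
  assume f: "continuous_map gamma euclidean f" and m: "m \<in> N"
  note fg = galg_of_continuous[OF f]
  show "(\<lambda>b. cscale_op (f (gamma_point b)) (m b)) \<in> N" by (rule galg_module_scale[OF fg m])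
  fix t :: "('p \<Rightarrow> complex) \<Rightarrow> complex" assume t: "t \<in> topspace gamma"
  have "field_eval t (\<lambda>b. f (gamma_point b)) = f t"
    by (intro field_eval_eqI t extendable_galg fg gamma_ext_unique[OF f]) simp
  then show "field_eval t (\<lambda>b. cscale_op (f (gamma_point b)) (m b)) = scl (Vt t) (f t) (field_eval t m)"
    using field_eval_bilinear[OF bounded_bilinear_cscale_op extendable_galg[OF fg] galg_module_extendable[OF m] t]
    by (simp add: assms(2)[OF t])
qed

lemma jointly_injective_galg_module: "jointly_injective gamma N field_eval"
  unfolding jointly_injective_def
proof (intro ballI impI)
  fix v w assume vw: "v \<in> N" "w \<in> N" and eq: "\<forall>t\<in>topspace gamma. field_eval t v = field_eval t w"
  have "v b = w b" for b
    using field_eval_gamma_point[OF galg_module_extendable[OF vw(1)], of b]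
      field_eval_gamma_point[OF galg_module_extendable[OF vw(2)], of b] eq character_gamma_point by metis
  then show "v = w" by (rule ext)
qed

lemma bdd_above_field_eval: "m \<in> N \<Longrightarrow> bdd_above ((\<lambda>t. norm (field_eval t m)) ` topspace gamma)"
proof -
  assume m: "m \<in> N"
  obtain B where "\<And>b. norm (m b) \<le> B" using cb_bounded[OF galg_module_cb[OF m]] by blast
  then have "norm (field_eval t m) \<le> B" if "t \<in> topspace gamma" for t
    by (intro field_eval_norm_le galg_module_extendable m that)
  then show ?thesis by (rule bdd_aboveI2)
qed

lemma linear_map_field_eval:
  assumes "carr V = N" "pls V = (\<lambda>f g b. f b + g b)" "scl V = (\<lambda>c f b. cscale_op c (f b))"
    "carr W = field_eval t ` N" "pls W = (+)" "scl W = cscale_op" and t: "t \<in> topspace gamma"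
  shows "linear_map V W (field_eval t)"
  unfolding linear_map_def assms(1-6)
  by (intro conjI ballI allI imageI field_eval_add field_eval_cscale galg_module_extendable t)

end

section \<open>Fields of C*-algebras\<close>

lemma op_vec_complex_space:
  fixes S :: "('a ell2 \<Rightarrow>\<^sub>L 'b ell2) set" and V :: "('a ell2 \<Rightarrow>\<^sub>L 'b ell2, 'z) cvec_scheme"
  assumes V: "carr V = S" "zro V = 0" "pls V = (+)" "scl V = cscale_op"
    and S: "0 \<in> S" "\<And>x y. x \<in> S \<Longrightarrow> y \<in> S \<Longrightarrow> x + y \<in> S" "\<And>c x. x \<in> S \<Longrightarrow> cscale_op c x \<in> S"
  shows "complex_space V"
  by unfold_locales (auto simp: V S mns_def cscale_op_distrib ac_simps)

lemma op_norm_complete: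
  assumes V: "carr V = S" "pls V = (+)" "scl V = cscale_op" and S: "closed S"
    and nr: "\<And>x. x \<in> S \<Longrightarrow> nr x = norm x"
    and sub: "\<And>x y. x \<in> S \<Longrightarrow> y \<in> S \<Longrightarrow> x + y \<in> S" "\<And>c x. x \<in> S \<Longrightarrow> cscale_op c x \<in> S"
  shows "norm_complete V nr"
  unfolding norm_complete_def V
proof (intro allI impI, elim conjE)
  fix s :: "nat \<Rightarrow> _" assume s: "\<forall>n. s n \<in> S" and C: "\<forall>e>0. \<exists>k. \<forall>m\<ge>k. \<forall>n\<ge>k. nr (mns V (s m) (s n)) < e"
  have mn: "nr (mns V x y) = norm (x - y)" if "x \<in> S" "y \<in> S" for x y
    using nr[OF sub(1)[OF that(1) sub(2)[OF that(2), of "-1"]]] by (simp add: mns_def V cscale_op_distrib)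
  have "Cauchy s" using C s by (simp add: Cauchy_def dist_norm mn)
  then obtain l where l: "s \<longlonglongrightarrow> l" by (auto simp: Cauchy_convergent_iff convergent_def)
  have "l \<in> S" using closed_sequentially[OF S _ l] s by blast
  moreover have "(\<lambda>n. nr (mns V (s n) l)) \<longlonglongrightarrow> 0"
    using l s \<open>l \<in> S\<close> by (simp add: mn tendsto_norm_zero_iff LIM_zero_iff)
  ultimately show "\<exists>l\<in>S. (\<lambda>n. nr (mns V (s n) l)) \<longlonglongrightarrow> 0" by blast
qed

lemma op_cstar_algebra:
  assumes S: "S \<subseteq> bounded_ops" "closed S" "0 \<in> S" "\<And>x y. x \<in> S \<Longrightarrow> y \<in> S \<Longrightarrow> x + y \<in> S"
    "\<And>c x. x \<in> S \<Longrightarrow> cscale_op c x \<in> S" "\<And>x y. x \<in> S \<Longrightarrow> y \<in> S \<Longrightarrow> x o\<^sub>L y \<in> S" "\<And>x. x \<in> S \<Longrightarrow> adj x \<in> S"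
  shows "cstar_algebra (op_cstar S)"
proof -
  interpret complex_space "op_cstar S"
    by (rule op_vec_complex_space[OF _ _ _ _ S(3-5)]) (simp_all add: op_cstar_def)
  have bo: "x \<in> S \<Longrightarrow> x \<in> bounded_ops" for x using S(1) by blast
  show ?thesis
  proof
    show "norm_complete (op_cstar S) (nrm (op_cstar S))"
      by (rule op_norm_complete[OF _ _ _ S(2) _ S(4,5)]) (simp_all add: op_cstar_def)
  qed (auto simp: op_cstar_def linear_map_def S bo blinfun_compose_distrib cscale_op_compose adj_add adj_cscale
      adj_compose norm_triangle_ineq norm_cscale_op norm_blinfun_compose norm_adj_compose_self)
qed

definition star_algebra_field :: "('p::order \<Rightarrow> 'a ell2 \<Rightarrow>\<^sub>L 'a ell2) set \<Rightarrow> bool" where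
  "star_algebra_field N \<longleftrightarrow> galg_module N \<and> star_subalgebra cscale_op bounded_ops (o\<^sub>L) adj N \<and>
     (\<lambda>_. id_blinfun) \<in> N"

abbreviation field_cstar :: "('p::order \<Rightarrow> 'a ell2 \<Rightarrow>\<^sub>L 'a ell2) set \<Rightarrow> ('p \<Rightarrow> 'a ell2 \<Rightarrow>\<^sub>L 'a ell2) cstar" where
  "field_cstar N \<equiv> Cb_cstar (op_cstar bounded_ops)\<lparr>carr := N\<rparr>"

lemma field_cstar_simps:
  "carr (field_cstar N) = N" "zro (field_cstar N) = (\<lambda>_. 0)" "pls (field_cstar N) = (\<lambda>f g b. f b + g b)"
  "scl (field_cstar N) = (\<lambda>c f b. cscale_op c (f b))" "mul (field_cstar N) = (\<lambda>f g b. f b o\<^sub>L g b)"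
  "star (field_cstar N) = (\<lambda>f b. adj (f b))" "nrm (field_cstar N) = (\<lambda>f. SUP b. norm (f b))"
  by (simp_all add: Cb_cstar_def Cb_vec_def op_cstar_def)

lemma op_cstar_simps:
  "carr (op_cstar S) = S" "zro (op_cstar S) = 0" "pls (op_cstar S) = (+)" "scl (op_cstar S) = cscale_op"
  "mul (op_cstar S) = (o\<^sub>L)" "star (op_cstar S) = adj" "nrm (op_cstar S) = norm"
  by (simp_all add: op_cstar_def)

lemma map_complex_space:
  assumes V: "carr V = N" "zro V = (\<lambda>_. 0)" "pls V = (\<lambda>f g b. f b + g b)" "scl V = (\<lambda>c f b. cscale_op c (f b))"
    and N: "closed_subspace cscale_op S N"
  shows "complex_space V"
  by unfold_locales (auto simp: V closed_subspaceD[OF N] mns_def cscale_op_distrib ac_simps)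

lemma SUP_norm:
  fixes f :: "'p::order \<Rightarrow> 'e::real_normed_vector"
  assumes "f \<in> cb S"
  shows "norm (f b) \<le> (SUP b. norm (f b))" "0 \<le> (SUP b. norm (f b))"
    "(\<And>b. norm (f b) \<le> B) \<Longrightarrow> (SUP b. norm (f b)) \<le> B"
proof -
  show *: "norm (f b) \<le> (SUP b. norm (f b))" for b by (rule cb_le_SUP[OF assms])
  show "0 \<le> (SUP b. norm (f b))" using order_trans[OF norm_ge_zero *] .
  show "(\<And>b. norm (f b) \<le> B) \<Longrightarrow> (SUP b. norm (f b)) \<le> B" by (rule cSUP_least) auto
qed

text \<open>Carries the identity \<open>norm (adj S o\<^sub>L S) = (norm S)\<^sup>2\<close> from
  values to sup norms. The value types of \<open>f\<close> and \<open>g\<close> differ, since it is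
  also applied to inner products of module sections.\<close>

lemma SUP_norm_square:
  fixes f :: "'p::order \<Rightarrow> 'e::real_normed_vector" and g :: "'p \<Rightarrow> 'f::real_normed_vector"
  assumes f: "f \<in> cb S" and g: "g \<in> cb S'" and eq: "\<And>b. norm (g b) = (norm (f b))\<^sup>2"
  shows "(SUP b. norm (g b)) = (SUP b. norm (f b))\<^sup>2"
proof (rule antisym)
  show "(SUP b. norm (g b)) \<le> (SUP b. norm (f b))\<^sup>2"
    by (rule SUP_norm(3)[OF g]) (simp add: eq power_mono SUP_norm(1)[OF f])
  have "norm (f b) \<le> sqrt (SUP b. norm (g b))" for b
    using SUP_norm(1)[OF g, of b] by (simp add: eq real_le_rsqrt)
  then have "(SUP b. norm (f b)) \<le> sqrt (SUP b. norm (g b))" by (rule SUP_norm(3)[OF f])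
  then have "(SUP b. norm (f b))\<^sup>2 \<le> (sqrt (SUP b. norm (g b)))\<^sup>2"
    by (intro power_mono SUP_norm(2)[OF f])
  then show "(SUP b. norm (f b))\<^sup>2 \<le> (SUP b. norm (g b))" using SUP_norm(2)[OF g] by simp
qed

lemma field_cstar_algebra:
  assumes "star_algebra_field N"
  shows "cstar_algebra (field_cstar N)"
proof -
  have st: "star_subalgebra cscale_op bounded_ops (o\<^sub>L) adj N" using assms by (simp add: star_algebra_field_def)
  note sub = star_subalgebraD(1)[OF st]
  note cbN = closed_subspaceD(1)[OF sub]
  have bo: "f b \<in> bounded_ops" if "f \<in> N" for f b by (rule cb_in[OF cbN[OF that]])
  interpret complex_space "field_cstar N"
    by (rule map_complex_space[OF _ _ _ _ sub]) (simp_all add: field_cstar_simps)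
  show ?thesis
  proof
    show "norm_complete (field_cstar N) (nrm (field_cstar N))"
      by (rule complete_closed_subspace[OF _ _ _ _ _ sub]) (simp_all add: field_cstar_simps cscale_op_distrib)
    show "nrm (field_cstar N) x = 0 \<longleftrightarrow> x = zro (field_cstar N)" if "x \<in> carr (field_cstar N)" for x
    proof
      have x: "x \<in> cb bounded_ops" using that cbN by (simp add: field_cstar_simps)
      assume "nrm (field_cstar N) x = 0"
      then have "norm (x b) \<le> 0" for b using SUP_norm(1)[OF x, of b] by (simp add: field_cstar_simps)
      then show "x = zro (field_cstar N)" by (simp add: field_cstar_simps fun_eq_iff)
    qed (simp add: field_cstar_simps)
    fix x y assume xN: "x \<in> carr (field_cstar N)" and yN: "y \<in> carr (field_cstar N)"
    then have x: "x \<in> cb bounded_ops" and y: "y \<in> cb bounded_ops" using cbN by (simp_all add: field_cstar_simps)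
    have xy: "(\<lambda>b. x b + y b) \<in> cb bounded_ops" "(\<lambda>b. x b o\<^sub>L y b) \<in> cb bounded_ops"
      using closed_subspaceD(3)[OF sub, of x y] star_subalgebraD(2)[OF st, of x y] xN yN cbN by (auto simp: field_cstar_simps)
    show "nrm (field_cstar N) (pls (field_cstar N) x y) \<le> nrm (field_cstar N) x + nrm (field_cstar N) y"
      unfolding field_cstar_simps
    proof (rule SUP_norm(3)[OF xy(1)])
      show "norm (x b + y b) \<le> (SUP b. norm (x b)) + (SUP b. norm (y b))" for b
        using norm_triangle_ineq[of "x b" "y b"] SUP_norm(1)[OF x, of b] SUP_norm(1)[OF y, of b] by linarith
    qed
    show "nrm (field_cstar N) (mul (field_cstar N) x y) \<le> nrm (field_cstar N) x * nrm (field_cstar N) y"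
      unfolding field_cstar_simps
    proof (rule SUP_norm(3)[OF xy(2)])
      show "norm (x b o\<^sub>L y b) \<le> (SUP b. norm (x b)) * (SUP b. norm (y b))" for b
        by (rule order_trans[OF norm_blinfun_compose]) (intro mult_mono SUP_norm(1,2)[OF x] SUP_norm(1)[OF y] norm_ge_zero)
    qed
  next
    fix x c assume xN: "x \<in> carr (field_cstar N)"
    then have x: "x \<in> cb bounded_ops" using cbN by (simp add: field_cstar_simps)
    show "0 \<le> nrm (field_cstar N) x" unfolding field_cstar_simps by (rule SUP_norm(2)[OF x])
    have "(\<lambda>b. adj (x b) o\<^sub>L x b) \<in> N"
      using xN star_subalgebraD(2)[OF st star_subalgebraD(3)[OF st]] by (simp add: field_cstar_simps)
    then show "nrm (field_cstar N) (mul (field_cstar N) (star (field_cstar N) x) x) = (nrm (field_cstar N) x)\<^sup>2"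
      unfolding field_cstar_simps
      by (intro SUP_norm_square[OF x cbN]) (simp_all add: norm_adj_compose_self cb_in[OF x])
    have bd: "bdd_above (range (\<lambda>b. norm (x b)))" using cb_bounded[OF x] by (auto simp: bdd_above_def)
    show "nrm (field_cstar N) (scl (field_cstar N) c x) = cmod c * nrm (field_cstar N) x"
    proof (cases "c = 0")
      case False
      have "mono ((*) (cmod c))" by (intro monoI mult_left_mono) auto
      moreover have "continuous (at_left (SUP b. norm (x b))) ((*) (cmod c))" by (intro continuous_intros)
      ultimately have "cmod c * (SUP b. norm (x b)) = (SUP b. cmod c * norm (x b))"
        using bd by (simp add: continuous_at_Sup_mono image_image)
      then show ?thesis by (simp add: field_cstar_simps norm_cscale_op)
    qed (simp add: field_cstar_simps cscale_op_distrib)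
  qed (auto simp: field_cstar_simps linear_map_def star_subalgebraD[OF st] closed_subspaceD[OF sub] bo
      blinfun_compose_distrib cscale_op_compose adj_add adj_cscale adj_compose)
qed

text \<open>The fibres are C*-algebras because evaluation respects products and adjoints and has
  closed range. The norm functions are continuous because the extended sections are.\<close>

lemma continuous_field_star_algebra:
  assumes "star_algebra_field N"
  shows "continuous_field_cstar gamma (field_cstar N) (\<lambda>t. op_cstar (field_eval t ` N)) field_eval"
proof -
  have N: "galg_module N" and st: "star_subalgebra cscale_op bounded_ops (o\<^sub>L) adj N"
    using assms by (simp_all add: star_algebra_field_def)
  note ex = galg_module_extendable[OF N]
  note cbN = galg_module_cb[OF N]
  have comp: "field_eval t (\<lambda>b. x b o\<^sub>L y b) = field_eval t x o\<^sub>L field_eval t y"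
    if "x \<in> N" "y \<in> N" "t \<in> topspace gamma" for x y t
    by (rule field_eval_bilinear[OF bounded_bilinear_blinfun_compose ex ex]) (use that in auto)
  have ad: "field_eval t (\<lambda>b. adj (x b)) = adj (field_eval t x)" if "x \<in> N" "t \<in> topspace gamma" for x t
    by (rule field_eval_adj[OF cbN ex]) (use that in auto)
  show ?thesis
    unfolding continuous_field_cstar_def
  proof (intro conjI ballI compact_gamma Hausdorff_gamma field_cstar_algebra[OF assms])
    fix t :: "('a \<Rightarrow> complex) \<Rightarrow> complex" assume t: "t \<in> topspace gamma"
    note fs = fibre_subspace[OF N t]
    show "cstar_algebra (op_cstar (field_eval t ` N))"
    proof (rule op_cstar_algebra[OF fs(1) closed_fibre[OF N t] fs(2-4)])
      fix x y assume "x \<in> field_eval t ` N" "y \<in> field_eval t ` N"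
      then obtain f g where fg: "x = field_eval t f" "y = field_eval t g" "f \<in> N" "g \<in> N" by blast
      show "x o\<^sub>L y \<in> field_eval t ` N"
        unfolding fg(1,2) comp[OF fg(3,4) t, symmetric] by (intro imageI star_subalgebraD(2)[OF st] fg)
      show "adj x \<in> field_eval t ` N"
        unfolding fg(1) ad[OF fg(3) t, symmetric] by (intro imageI star_subalgebraD(3)[OF st] fg)
    qed
    have "linear_map (field_cstar N) (op_cstar (field_eval t ` N)) (field_eval t)"
      by (rule linear_map_field_eval[OF N]) (use t in \<open>simp_all add: field_cstar_simps op_cstar_simps\<close>)
    then show "star_hom (field_cstar N) (op_cstar (field_eval t ` N)) (field_eval t)"
      unfolding star_hom_def using comp ad t by (simp add: field_cstar_simps op_cstar_simps)
    show "field_eval t ` carr (field_cstar N) = carr (op_cstar (field_eval t ` N))"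
      by (simp add: field_cstar_simps op_cstar_simps)
  next
    show "jointly_injective gamma (carr (field_cstar N)) field_eval"
      unfolding field_cstar_simps by (rule jointly_injective_galg_module[OF N])
    show "CT_acts gamma (field_cstar N) (\<lambda>t. op_cstar (field_eval t ` N)) field_eval"
      by (rule CT_acts_galg_module[OF N]) (simp_all add: field_cstar_simps op_cstar_simps)
    fix x assume "x \<in> carr (field_cstar N)"
    then have x: "x \<in> N" by (simp add: field_cstar_simps)
    show "bdd_above ((\<lambda>t. nrm (op_cstar (field_eval t ` N)) (field_eval t x)) ` topspace gamma)"
      using bdd_above_field_eval[OF N x] by (simp add: op_cstar_simps)
    show "continuous_map gamma euclideanreal (\<lambda>t. nrm (op_cstar (field_eval t ` N)) (field_eval t x))"
      using continuous_map_field_eval[OF ex[OF x]] unfolding continuous_map_euclidean_iff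
      by (auto simp: op_cstar_simps intro!: tendsto_norm)
  qed
qed

section \<open>Square roots\<close>

lemma blinfun_compose_id: "id_blinfun o\<^sub>L S = S" "S o\<^sub>L id_blinfun = S"
  by (rule blinfun_eqI, simp)+

text \<open>Expanding the square of \<open>norm (v - adj S (S v))\<close> gives
  \<open>norm v\<close> squared, minus twice \<open>norm (S v)\<close> squared, plus a term which
  for a contraction is at most \<open>norm (S v)\<close> squared.\<close>

lemma norm_id_minus_le:
  assumes S: "S \<in> bounded_ops" "norm S \<le> 1"
  shows "norm (id_blinfun - (adj S o\<^sub>L S)) \<le> 1"
proof (rule norm_blinfun_bound)
  fix v
  let ?w = "blinfun_apply S v"
  have le: "norm (blinfun_apply T u) \<le> norm u" if "norm T \<le> 1" for T :: "'c ell2 \<Rightarrow>\<^sub>L 'd ell2" and u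
    using norm_blinfun[of T u] mult_right_mono[OF that, of "norm u"] by simp
  have "inner v (blinfun_apply (adj S) ?w) = (norm ?w)\<^sup>2"
    by (simp add: inner_ell2_def cinner_adj_right[OF S(1)] cinner_self)
  then have "(norm (v - blinfun_apply (adj S) ?w))\<^sup>2
      = (norm v)\<^sup>2 - 2 * (norm ?w)\<^sup>2 + (norm (blinfun_apply (adj S) ?w))\<^sup>2"
    by (simp add: power2_norm_eq_inner inner_diff_left inner_diff_right inner_commute)
  moreover have "(norm (blinfun_apply (adj S) ?w))\<^sup>2 \<le> (norm ?w)\<^sup>2"
    by (rule power_mono[OF le]) (simp_all add: norm_adj S)
  moreover have "0 \<le> (norm ?w)\<^sup>2" by simp
  ultimately have "(norm (v - blinfun_apply (adj S) ?w))\<^sup>2 \<le> (norm v)\<^sup>2" by linarith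
  then have "norm (v - blinfun_apply (adj S) ?w) \<le> norm v" by (rule power2_le_imp_le) simp
  then show "norm (blinfun_apply (id_blinfun - (adj S o\<^sub>L S)) v) \<le> 1 * norm v"
    by (simp add: blinfun.diff_left)
qed simp

text \<open>If \<open>w\<close> is the limit of this iteration then \<open>w = (z + w\<^sup>2) / 2\<close>, that is \<open>(1 - w)\<^sup>2 = 1 - z\<close>.
  It converges for every \<open>z\<close> of norm at most \<open>1\<close>, since its increments are dominated by those of
  the scalar iteration with \<open>z = 1\<close>.\<close>

primrec sqrt_iter :: "('a ell2 \<Rightarrow>\<^sub>L 'a ell2) \<Rightarrow> nat \<Rightarrow> ('a ell2 \<Rightarrow>\<^sub>L 'a ell2)" where
  "sqrt_iter z 0 = 0"
| "sqrt_iter z (Suc n) = cscale_op (1/2) (z + (sqrt_iter z n o\<^sub>L sqrt_iter z n))"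

primrec scalar_iter :: "nat \<Rightarrow> real" where
  "scalar_iter 0 = 0"
| "scalar_iter (Suc n) = (1 + (scalar_iter n)\<^sup>2) / 2"

lemma scalar_iter_bounds: "0 \<le> scalar_iter n" "scalar_iter n \<le> 1"
proof (induction n)
  case (Suc n)
  { case 1 show ?case by (simp add: add_nonneg_nonneg) }
  { case 2 show ?case using power_mono[OF Suc.IH(2,1), of 2] by simp }
qed auto

lemma scalar_iter_Suc_le: "scalar_iter n \<le> scalar_iter (Suc n)"
proof -
  have "0 \<le> (1 - scalar_iter n)\<^sup>2" by simp
  then show ?thesis by (simp add: power2_diff)
qed

lemma Cauchy_scalar_iter: "Cauchy scalar_iter"
proof -
  have "incseq scalar_iter" by (rule incseq_SucI) (rule scalar_iter_Suc_le)
  then have "convergent scalar_iter"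
    by (rule Bseq_monoseq_convergent[OF BseqI'[of _ 1] incseq_imp_monoseq, rotated]) (use scalar_iter_bounds in auto)
  then show ?thesis by (rule convergent_Cauchy)
qed

lemma norm_sqrt_iter:
  assumes z: "norm z \<le> 1"
  shows "norm (sqrt_iter z n) \<le> scalar_iter n"
    and "norm (sqrt_iter z (Suc n) - sqrt_iter z n) \<le> scalar_iter (Suc n) - scalar_iter n"
proof -
  show le: "norm (sqrt_iter z n) \<le> scalar_iter n" for n
  proof (induction n)
    case (Suc n)
    have "norm (sqrt_iter z n o\<^sub>L sqrt_iter z n) \<le> scalar_iter n * scalar_iter n"
      by (rule order_trans[OF norm_blinfun_compose]) (intro mult_mono Suc scalar_iter_bounds norm_ge_zero)
    then show ?case
      using norm_triangle_ineq[of z "sqrt_iter z n o\<^sub>L sqrt_iter z n"] z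
      by (simp add: norm_cscale_op norm_divide power2_eq_square)
  qed simp
  show "norm (sqrt_iter z (Suc n) - sqrt_iter z n) \<le> scalar_iter (Suc n) - scalar_iter n"
  proof (induction n)
    case 0 then show ?case using z by (simp add: norm_cscale_op norm_divide)
  next
    case (Suc n)
    let ?a = "sqrt_iter z (Suc n)" and ?b = "sqrt_iter z n"
    let ?u = "scalar_iter (Suc n)" and ?v = "scalar_iter n"
    \<comment> \<open>A noncommutative difference of two squares. The scalar iteration satisfies the
      corresponding identity, so the two inductions run in parallel.\<close>
    have "(z + (?a o\<^sub>L ?a)) - (z + (?b o\<^sub>L ?b)) = (?a o\<^sub>L (?a - ?b)) + ((?a - ?b) o\<^sub>L ?b)"
      by (simp add: blinfun_compose_distrib del: sqrt_iter.simps)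
    then have eq: "sqrt_iter z (Suc (Suc n)) - ?a = cscale_op (1/2) ((?a o\<^sub>L (?a - ?b)) + ((?a - ?b) o\<^sub>L ?b))"
      unfolding sqrt_iter.simps(2)[of z "Suc n"] sqrt_iter.simps(2)[of z n]
      using cscale_op_distrib(1)[of "1/2" "z + (?a o\<^sub>L ?a)" "- (z + (?b o\<^sub>L ?b))"]
        bounded_bilinear.minus_right[OF bounded_bilinear_cscale_op, of "1/2" "z + (?b o\<^sub>L ?b)"]
      by (simp add: del: sqrt_iter.simps) (simp add: sqrt_iter.simps)
    have "norm (?a o\<^sub>L (?a - ?b)) \<le> ?u * (?u - ?v)"
      by (rule order_trans[OF norm_blinfun_compose]) (intro mult_mono le Suc scalar_iter_bounds norm_ge_zero)
    moreover have "norm ((?a - ?b) o\<^sub>L ?b) \<le> (?u - ?v) * ?v"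
      by (rule order_trans[OF norm_blinfun_compose])
        (intro mult_mono le Suc norm_ge_zero, use scalar_iter_Suc_le[of n] in simp)
    ultimately have "norm (sqrt_iter z (Suc (Suc n)) - ?a) \<le> (?u * (?u - ?v) + (?u - ?v) * ?v) / 2"
      unfolding eq norm_cscale_op
      using norm_triangle_ineq[of "?a o\<^sub>L (?a - ?b)" "(?a - ?b) o\<^sub>L ?b"] by (simp add: norm_divide)
    also have "\<dots> = scalar_iter (Suc (Suc n)) - ?u"
      unfolding scalar_iter.simps(2)[of "Suc n"] by (simp add: scalar_iter.simps(2)[of n] power2_eq_square field_simps)
    finally show ?case .
  qed
qed

lemma norm_sqrt_iter_diff:
  assumes z: "norm z \<le> 1" and nm: "n \<le> m"
  shows "norm (sqrt_iter z m - sqrt_iter z n) \<le> scalar_iter m - scalar_iter n"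
  using nm
proof (induction m rule: dec_induct)
  case (step m)
  then show ?case
    using norm_sqrt_iter(2)[OF z, of m] norm_triangle_ineq[of "sqrt_iter z (Suc m) - sqrt_iter z m" "sqrt_iter z m - sqrt_iter z n"]
    by (simp del: sqrt_iter.simps scalar_iter.simps)
qed simp

lemma sqrt_iter_bounded_ops: "z \<in> bounded_ops \<Longrightarrow> sqrt_iter z n \<in> bounded_ops"
  by (induction n) auto

lemma adj_sqrt_iter: "z \<in> bounded_ops \<Longrightarrow> adj z = z \<Longrightarrow> adj (sqrt_iter z n) = sqrt_iter z n"
  by (induction n) (simp_all add: adj_cscale adj_add adj_compose sqrt_iter_bounded_ops)

text \<open>The iteration is run at \<open>z = id_blinfun - (adj r o\<^sub>L r)\<close> for the
  rescaled \<open>r = m / K\<close>. The algebra element found is \<open>K\<close> times the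
  difference of the identity and the limit \<open>w\<close>. All estimates are uniform over the
  poset, so \<open>w\<close> stays in \<open>N\<close>.\<close>

lemma star_algebra_sqrt:
  fixes N :: "('p::order \<Rightarrow> 'a ell2 \<Rightarrow>\<^sub>L 'a ell2) set" and m :: "'p \<Rightarrow> 'a ell2 \<Rightarrow>\<^sub>L 'b ell2"
  assumes st: "star_subalgebra cscale_op bounded_ops (o\<^sub>L) adj N" and id: "(\<lambda>_. id_blinfun) \<in> N"
    and m: "m \<in> cb bounded_ops" and mm: "(\<lambda>b. adj (m b) o\<^sub>L m b) \<in> N"
  shows "\<exists>w\<in>N. \<forall>b. adj (m b) o\<^sub>L m b = adj (w b) o\<^sub>L w b"
proof -
  note sub = star_subalgebraD(1)[OF st]
  note m_bo = cb_in[OF m]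
  obtain B where B: "\<And>b. norm (m b) \<le> B" using cb_bounded[OF m] by blast
  \<comment> \<open>The added 1 keeps \<open>K\<close> positive when \<open>m\<close> vanishes, so
    that division by \<open>K\<close> is possible.\<close>
  define K where "K = B + 1"
  have "0 \<le> B" using B norm_ge_zero order_trans by blast
  then have K: "K > 0" "\<And>b. norm (m b) \<le> K" using B by (auto simp: K_def intro: order_trans[OF B])
  define r where "r b = cscale_op (1 / complex_of_real K) (m b)" for b
  have r_bo: "r b \<in> bounded_ops" and r1: "norm (r b) \<le> 1" for b
    using K by (simp_all add: r_def m_bo norm_cscale_op norm_divide divide_le_eq)
  define z where "z b = id_blinfun - (adj (r b) o\<^sub>L r b)" for b
  have rr: "adj (r b) o\<^sub>L r b = cscale_op (1 / (complex_of_real K)\<^sup>2) (adj (m b) o\<^sub>L m b)" for b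
    by (simp add: r_def adj_cscale m_bo cscale_op_compose cscale_op_distrib power2_eq_square)
  have z_bo: "z b \<in> bounded_ops" and z1: "norm (z b) \<le> 1" and z_adj: "adj (z b) = z b" for b
    using r_bo[of b] r1[of b] by (simp_all add: z_def norm_id_minus_le adj_minus adj_compose)
  have zN: "z \<in> N"
  proof -
    have "z = (\<lambda>b. id_blinfun + cscale_op (-1) (cscale_op (1 / (complex_of_real K)\<^sup>2) (adj (m b) o\<^sub>L m b)))"
      by (simp add: z_def rr fun_eq_iff cscale_op_distrib(7))
    then show ?thesis
      by (simp only:) (intro closed_subspaceD(3,4)[OF sub] id mm)
  qed
  have itN: "(\<lambda>b. sqrt_iter (z b) n) \<in> N" for n
  proof (induction n)
    case 0 show ?case using closed_subspaceD(2)[OF sub] by simp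
  next
    case (Suc n)
    show ?case unfolding sqrt_iter.simps
      by (intro closed_subspaceD(3,4)[OF sub] zN star_subalgebraD(2)[OF st Suc Suc])
  qed
  have "uniformly_Cauchy_on UNIV (\<lambda>n b. sqrt_iter (z b) n)"
    unfolding uniformly_Cauchy_on_def
  proof (intro allI impI)
    fix e :: real assume "e > 0"
    then obtain M where M: "\<And>m n. m \<ge> M \<Longrightarrow> n \<ge> M \<Longrightarrow> dist (scalar_iter m) (scalar_iter n) < e"
      using Cauchy_scalar_iter unfolding Cauchy_def by blast
    \<comment> \<open>The dominating scalar sequence does not depend on \<open>b\<close>, which
      makes the Cauchy property uniform.\<close>
    have "dist (sqrt_iter (z b) m) (sqrt_iter (z b) n) \<le> dist (scalar_iter m) (scalar_iter n)" for m n b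
    proof (cases "n \<le> m")
      case True
      then show ?thesis using norm_sqrt_iter_diff[OF z1 True, of b] by (simp add: dist_norm)
    next
      case False
      then have mn: "m \<le> n" by simp
      show ?thesis using norm_sqrt_iter_diff[OF z1 mn, of b]
        by (simp add: dist_norm norm_minus_commute)
    qed
    then show "\<exists>M. \<forall>x\<in>UNIV. \<forall>m\<ge>M. \<forall>n\<ge>M. dist (sqrt_iter (z x) m) (sqrt_iter (z x) n) < e"
      using M le_less_trans by blast
  qed
  then obtain w where w: "uniform_limit UNIV (\<lambda>n b. sqrt_iter (z b) n) w sequentially"
    using Cauchy_uniformly_convergent uniformly_convergent_on_def by blast
  have wN: "w \<in> N" by (rule closed_subspaceD(5)[OF sub itN w])
  have lim: "(\<lambda>n. sqrt_iter (z b) n) \<longlonglongrightarrow> w b" for b by (rule tendsto_uniform_limitI[OF w]) simp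
  have w_bo: "w b \<in> bounded_ops" for b by (rule cb_in[OF closed_subspaceD(1)[OF sub wN]])
  have fixpt: "w b = cscale_op (1/2) (z b + (w b o\<^sub>L w b))" for b
  proof (rule LIMSEQ_unique)
    show "(\<lambda>n. sqrt_iter (z b) (Suc n)) \<longlonglongrightarrow> w b" by (rule LIMSEQ_Suc[OF lim])
    show "(\<lambda>n. sqrt_iter (z b) (Suc n)) \<longlonglongrightarrow> cscale_op (1/2) (z b + (w b o\<^sub>L w b))"
      unfolding sqrt_iter.simps
      by (intro bounded_bilinear.tendsto[OF bounded_bilinear_cscale_op] tendsto_add tendsto_const
          bounded_bilinear.tendsto[OF bounded_bilinear_blinfun_compose] lim)
  qed
  have w_adj: "adj (w b) = w b" for b
  proof (rule LIMSEQ_unique[OF _ lim])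
    show "(\<lambda>n. sqrt_iter (z b) n) \<longlonglongrightarrow> adj (w b)"
      using tendsto_adj[OF sqrt_iter_bounded_ops[OF z_bo] w_bo lim] by (simp add: adj_sqrt_iter z_bo z_adj)
  qed
  have sq: "(id_blinfun - w b) o\<^sub>L (id_blinfun - w b) = adj (r b) o\<^sub>L r b" for b
  proof -
    have "w b + w b = z b + (w b o\<^sub>L w b)"
    proof -
      have "cscale_op 2 (w b) = cscale_op 2 (cscale_op (1/2) (z b + (w b o\<^sub>L w b)))" using fixpt[of b] by simp
      then show ?thesis using cscale_op_distrib(2)[of 1 1 "w b"] by (simp add: cscale_op_distrib(3,4))
    qed
    moreover have "(id_blinfun - w b) o\<^sub>L (id_blinfun - w b) = id_blinfun - (w b + w b) + (w b o\<^sub>L w b)"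
      by (simp add: blinfun_compose_distrib blinfun_compose_id)
    ultimately show ?thesis by (simp add: z_def)
  qed
  \<comment> \<open>Self-adjoint, since \<open>w\<close> is, so \<open>adj v o\<^sub>L v\<close> is
    \<open>K\<close> squared times the square of \<open>id_blinfun - w\<close>; this undoes the
    scaling of \<open>m\<close>.\<close>
  let ?v = "\<lambda>b. cscale_op (of_real K) (id_blinfun + cscale_op (-1) (w b))"
  have "?v \<in> N" by (intro closed_subspaceD(3,4)[OF sub] id wN)
  moreover have "adj (m b) o\<^sub>L m b = adj (?v b) o\<^sub>L ?v b" for b
  proof -
    have "adj (?v b) o\<^sub>L ?v b = cscale_op ((of_real K)\<^sup>2) ((id_blinfun - w b) o\<^sub>L (id_blinfun - w b))"
      by (simp add: cscale_op_distrib(7) adj_cscale adj_minus w_bo w_adj cscale_op_compose cscale_op_distrib(3) power2_eq_square)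
    also have "\<dots> = adj (m b) o\<^sub>L m b" using K by (simp add: sq rr cscale_op_distrib(3,4))
    finally show ?thesis by simp
  qed
  ultimately show ?thesis by (intro bexI[of _ ?v] allI)
qed


section \<open>Families of subalgebras and submodules indexed by a poset\<close>

lemma closed_subspace_cb: "closed_subspace cscale_op bounded_ops (cb bounded_ops)"
  unfolding closed_subspace_def
  by (auto intro: cb_const cb_add cb_uniform_limit[OF closed_bounded_ops]
      cb_binary[OF bounded_bilinear_cscale_op cb_const[of _ UNIV]])

text \<open>With \<open>\<sigma>\<close> the identity or \<open>cnj\<close>, both linear and
  conjugate-linear maps are covered. The hypotheses are restricted to \<open>bounded_ops\<close>
  because \<open>adj\<close> is unspecified elsewhere, and \<open>K\<close> must be uniform in
  \<open>b\<close> to preserve uniform limits.\<close>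

lemma closed_subspace_preimage:
  fixes h :: "'p::order \<Rightarrow> ('a ell2 \<Rightarrow>\<^sub>L 'b ell2) \<Rightarrow> ('c ell2 \<Rightarrow>\<^sub>L 'd ell2)"
  assumes N: "closed_subspace cscale_op bounded_ops N"
    and add: "\<And>b x y. x \<in> bounded_ops \<Longrightarrow> y \<in> bounded_ops \<Longrightarrow> h b (x + y) = h b x + h b y"
    and sc: "\<And>b c x. x \<in> bounded_ops \<Longrightarrow> h b (cscale_op c x) = cscale_op (\<sigma> c) (h b x)"
    and bd: "\<And>b x. x \<in> bounded_ops \<Longrightarrow> norm (h b x) \<le> K * norm x"
  shows "closed_subspace cscale_op bounded_ops {m \<in> cb bounded_ops. (\<lambda>b. h b (m b)) \<in> N}"
proof (rule closed_subspace_CollectI[OF closed_subspace_cb])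
  have "h b 0 = 0" for b using bd[of 0 b] by simp
  then show "(\<lambda>b. h b 0) \<in> N" using closed_subspaceD(2)[OF N] by simp
  fix f :: "'p \<Rightarrow> 'a ell2 \<Rightarrow>\<^sub>L 'b ell2" assume f: "f \<in> cb bounded_ops" "(\<lambda>b. h b (f b)) \<in> N"
  show "(\<lambda>b. h b (cscale_op c (f b))) \<in> N" for c
    using closed_subspaceD(4)[OF N f(2)] f(1) by (simp add: sc cb_in)
  fix g :: "'p \<Rightarrow> 'a ell2 \<Rightarrow>\<^sub>L 'b ell2" assume g: "g \<in> cb bounded_ops" "(\<lambda>b. h b (g b)) \<in> N"
  show "(\<lambda>b. h b (f b + g b)) \<in> N"
    using closed_subspaceD(3)[OF N f(2) g(2)] f(1) g(1) by (simp add: add cb_in)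
next
  fix s :: "nat \<Rightarrow> 'p \<Rightarrow> 'a ell2 \<Rightarrow>\<^sub>L 'b ell2" and l
  assume s: "\<And>n. s n \<in> cb bounded_ops" "\<And>n. (\<lambda>b. h b (s n b)) \<in> N"
    and lb: "l \<in> cb bounded_ops" and l: "uniform_limit UNIV s l sequentially"
  have "uniform_limit UNIV (\<lambda>n b. h b (s n b)) (\<lambda>b. h b (l b)) sequentially"
    unfolding uniform_limit_iff
  proof (intro allI impI)
    fix e :: real assume e: "e > 0"
    \<comment> \<open>\<open>K\<close> may be zero or negative, so \<open>\<bar>K\<bar> + 1\<close>
      is used as a positive bound to divide by.\<close>
    have K: "0 < \<bar>K\<bar> + 1" by simp
    have "\<forall>\<^sub>F n in sequentially. \<forall>b\<in>UNIV. dist (s n b) (l b) < e / (\<bar>K\<bar> + 1)"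
      using e by (intro uniform_limitD[OF l]) (simp add: add_nonneg_pos)
    then show "\<forall>\<^sub>F n in sequentially. \<forall>b\<in>UNIV. dist (h b (s n b)) (h b (l b)) < e"
    proof eventually_elim
      case (elim n)
      have "dist (h b (s n b)) (h b (l b)) < e" for b
      proof -
        have bo: "s n b \<in> bounded_ops" "l b \<in> bounded_ops" by (rule cb_in[OF s(1)], rule cb_in[OF lb])
        then have "h b (l b + (s n b - l b)) = h b (l b) + h b (s n b - l b)" by (intro add) auto
        then have "h b (s n b) - h b (l b) = h b (s n b - l b)" by simp
        then have "dist (h b (s n b)) (h b (l b)) \<le> K * norm (s n b - l b)"
          using bd[of "s n b - l b" b] bo by (simp add: dist_norm)
        also have "\<dots> \<le> (\<bar>K\<bar> + 1) * norm (s n b - l b)" by (intro mult_right_mono) auto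
        also have "\<dots> < e" using elim K by (simp add: dist_norm pos_less_divide_eq mult.commute)
        finally show ?thesis .
      qed
      then show ?case by blast
    qed
  qed
  then show "(\<lambda>b. h b (l b)) \<in> N" by (rule closed_subspaceD(5)[OF N s(2)])
qed

lemma closed_subspace_Ball:
  assumes "\<And>i. i \<in> I \<Longrightarrow> closed_subspace cscale_op bounded_ops {m \<in> cb bounded_ops. P i m}"
  shows "closed_subspace cscale_op bounded_ops {m \<in> cb bounded_ops. \<forall>i\<in>I. P i m}"
proof (rule closed_subspace_CollectI[OF closed_subspace_cb])
  note D = closed_subspaceD[OF assms]
  show "\<forall>i\<in>I. P i (\<lambda>_. 0)" using D(2) by simp
  show "\<forall>i\<in>I. P i (\<lambda>b. f b + g b)"
    if "f \<in> cb bounded_ops" "g \<in> cb bounded_ops" "\<forall>i\<in>I. P i f" "\<forall>i\<in>I. P i g" for f g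
    using D(3)[of _ f g] that by simp
  show "\<forall>i\<in>I. P i (\<lambda>b. cscale_op c (f b))" if "f \<in> cb bounded_ops" "\<forall>i\<in>I. P i f" for c f
    using D(4)[of _ f c] that by simp
  show "\<forall>i\<in>I. P i l" if "\<And>n. s n \<in> cb bounded_ops" "\<And>n. \<forall>i\<in>I. P i (s n)" "uniform_limit UNIV s l sequentially" for s l
    using D(5)[of _ s l] that by simp
qed

lemma closed_subspace_conj:
  assumes "closed_subspace cscale_op bounded_ops {m \<in> cb bounded_ops. P m}" "closed_subspace cscale_op bounded_ops {m \<in> cb bounded_ops. Q m}"
  shows "closed_subspace cscale_op bounded_ops {m \<in> cb bounded_ops. P m \<and> Q m}"
proof -
  \<comment> \<open>The conjunction is read as an intersection indexed by the two booleans.\<close>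
  have "closed_subspace cscale_op bounded_ops {m \<in> cb bounded_ops. \<forall>i\<in>UNIV. if i then P m else Q m}"
  proof (rule closed_subspace_Ball)
    show "closed_subspace cscale_op bounded_ops {m \<in> cb bounded_ops. if i then P m else Q m}" for i
      by (cases i) (simp_all add: assms)
  qed
  moreover have "(\<forall>i\<in>UNIV. if i then P m else Q m) \<longleftrightarrow> P m \<and> Q m" for m by auto
  ultimately show ?thesis by simp
qed

lemma norm_compose_le:
  assumes "norm x \<le> K"
  shows "norm (x o\<^sub>L y) \<le> K * norm y" "norm (y' o\<^sub>L x) \<le> K * norm y'"
  using norm_blinfun_compose[of x y] norm_blinfun_compose[of y' x] mult_right_mono[OF assms, of "norm y"]
    mult_right_mono[OF assms, of "norm y'"] by (simp_all add: mult.commute)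

context
  fixes N :: "('p::order \<Rightarrow> 'a ell2 \<Rightarrow>\<^sub>L 'b ell2) set"
  assumes N: "closed_subspace cscale_op bounded_ops N"
begin

lemma closed_subspace_compose_left:
  assumes g: "g \<in> cb bounded_ops"
  shows "closed_subspace cscale_op bounded_ops {m \<in> cb bounded_ops. (\<lambda>b. g b o\<^sub>L m b) \<in> N}"
proof -
  obtain K where K: "\<And>b. norm (g b) \<le> K" using cb_bounded[OF g] by blast
  show ?thesis
    by (rule closed_subspace_preimage[OF N, where K = K and \<sigma> = "\<lambda>c. c"])
      (simp_all add: blinfun_compose_distrib cscale_op_compose cb_in[OF g] norm_compose_le[OF K])
qed

lemma closed_subspace_compose_right:
  assumes g: "g \<in> cb bounded_ops"
  shows "closed_subspace cscale_op bounded_ops {m \<in> cb bounded_ops. (\<lambda>b. m b o\<^sub>L g b) \<in> N}"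
proof -
  obtain K where K: "\<And>b. norm (g b) \<le> K" using cb_bounded[OF g] by blast
  show ?thesis
    by (rule closed_subspace_preimage[OF N, where K = K and \<sigma> = "\<lambda>c. c"])
      (simp_all add: blinfun_compose_distrib cscale_op_compose norm_compose_le[OF K])
qed

lemma closed_subspace_compose_adj_left:
  assumes g: "g \<in> cb bounded_ops"
  shows "closed_subspace cscale_op bounded_ops {m \<in> cb bounded_ops. (\<lambda>b. g b o\<^sub>L adj (m b)) \<in> N}"
proof -
  obtain K where K: "\<And>b. norm (g b) \<le> K" using cb_bounded[OF g] by blast
  show ?thesis
  proof (rule closed_subspace_preimage[OF N, where K = K and \<sigma> = cnj])
    show "norm (g b o\<^sub>L adj x) \<le> K * norm x" if "x \<in> bounded_ops" for b x
      using norm_compose_le(1)[OF K, of b "adj x"] by (simp add: norm_adj that)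
  qed (simp_all add: blinfun_compose_distrib adj_add adj_cscale cscale_op_compose cb_in[OF g])
qed

lemma closed_subspace_compose_adj_right:
  assumes g: "g \<in> cb bounded_ops"
  shows "closed_subspace cscale_op bounded_ops {m \<in> cb bounded_ops. (\<lambda>b. adj (m b) o\<^sub>L g b) \<in> N}"
proof -
  obtain K where K: "\<And>b. norm (g b) \<le> K" using cb_bounded[OF g] by blast
  show ?thesis
  proof (rule closed_subspace_preimage[OF N, where K = K and \<sigma> = cnj])
    show "norm (adj x o\<^sub>L g b) \<le> K * norm x" if "x \<in> bounded_ops" for b x
      using norm_compose_le(2)[OF K, of "adj x" b] by (simp add: norm_adj that)
  qed (simp_all add: blinfun_compose_distrib adj_add adj_cscale cscale_op_compose)
qed

lemma closed_subspace_cscale_fun: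
  assumes f: "\<And>b. cmod (f b) \<le> K"
  shows "closed_subspace cscale_op bounded_ops {m \<in> cb bounded_ops. (\<lambda>b. cscale_op (f b) (m b)) \<in> N}"
proof (rule closed_subspace_preimage[OF N, where K = K and \<sigma> = "\<lambda>c. c"])
  show "cscale_op (f b) (cscale_op c x) = cscale_op c (cscale_op (f b) x)" for b c and x :: "'a ell2 \<Rightarrow>\<^sub>L 'b ell2"
    by (simp add: cscale_op_distrib(3) mult.commute)
qed (simp_all add: cscale_op_distrib norm_cscale_op mult_right_mono[OF f])

end

text \<open>An ambient space for the total spaces: it contains the generating step maps and is
  closed under the operations, so its conditions hold for everything generated.\<close>

definition sections :: "('p::order \<Rightarrow> ('a ell2 \<Rightarrow>\<^sub>L 'b ell2) set) \<Rightarrow> ('p \<Rightarrow> 'a ell2 \<Rightarrow>\<^sub>L 'b ell2) set" where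
  "sections R = {m \<in> cb bounded_ops. extendable m \<and> (\<forall>b. m b \<in> R b)}"

lemma closed_subspace_sections:
  fixes R :: "'p::order \<Rightarrow> ('a ell2 \<Rightarrow>\<^sub>L 'b ell2) set"
  assumes R: "\<And>a. closed (R a)" "\<And>a. 0 \<in> R a" "\<And>a s s'. s \<in> R a \<Longrightarrow> s' \<in> R a \<Longrightarrow> s + s' \<in> R a"
    "\<And>a c s. s \<in> R a \<Longrightarrow> cscale_op c s \<in> R a"
  shows "closed_subspace cscale_op bounded_ops (sections R)"
  unfolding sections_def
proof (rule closed_subspace_CollectI[OF closed_subspace_cb])
  fix s :: "nat \<Rightarrow> 'p \<Rightarrow> 'a ell2 \<Rightarrow>\<^sub>L 'b ell2" and l
  assume s: "\<And>n. extendable (s n) \<and> (\<forall>b. s n b \<in> R b)" and l: "uniform_limit UNIV s l sequentially"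
  have "extendable l" by (rule extendable_uniform_limit(1)[OF _ l]) (use s in auto)
  moreover have "l b \<in> R b" for b
    by (rule closed_sequentially[OF R(1) _ tendsto_uniform_limitI[OF l]]) (use s in auto)
  ultimately show "extendable l \<and> (\<forall>b. l b \<in> R b)" by blast
qed (auto intro: extendable_const extendable_add extendable_cscale R)

text \<open>Collects what is used of \<open>class_A\<close> and \<open>class_B\<close>, so that both
  fields of algebras are treated at once. The least element of the poset provides the unit of the
  total algebra.\<close>

locale algebra_family =
  fixes R :: "'p::order \<Rightarrow> ('a ell2 \<Rightarrow>\<^sub>L 'a ell2) set"
  assumes R_closed: "closed (R a)" and R_subset: "R a \<subseteq> bounded_ops" and R_0: "0 \<in> R a"
    and R_add: "s \<in> R a \<Longrightarrow> s' \<in> R a \<Longrightarrow> s + s' \<in> R a"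
    and R_cscale: "s \<in> R a \<Longrightarrow> cscale_op c s \<in> R a"
    and R_id: "id_blinfun \<in> R a" and R_adj: "s \<in> R a \<Longrightarrow> adj s \<in> R a"
    and R_compose: "s \<in> R a \<Longrightarrow> s' \<in> R a \<Longrightarrow> s o\<^sub>L s' \<in> R a"
    and R_mono: "a \<le> b \<Longrightarrow> R a \<subseteq> R b"
    and least: "\<exists>z. \<forall>a :: 'p. z \<le> a"
begin

definition algebra :: "('p \<Rightarrow> 'a ell2 \<Rightarrow>\<^sub>L 'a ell2) cstar" where
  "algebra = cstar_generated (Cb_cstar (op_cstar bounded_ops)) {step_map a s | a s. s \<in> R a}"

definition total :: "('p \<Rightarrow> 'a ell2 \<Rightarrow>\<^sub>L 'a ell2) set" where
  "total = carr algebra"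

lemma algebra_eq: "algebra = field_cstar total"
  by (simp add: total_def algebra_def cstar_generated_def)

lemma star_subalgebra_sections:
  "star_subalgebra cscale_op bounded_ops (o\<^sub>L) adj (sections R)"
  unfolding star_subalgebra_def
proof (intro conjI ballI closed_subspace_sections R_closed R_0 R_add R_cscale)
  fix f g assume f: "f \<in> sections R"
  show "(\<lambda>b. adj (f b)) \<in> sections R"
    using f by (auto simp: sections_def intro: cb_adj extendable_adj R_adj)
  assume g: "g \<in> sections R"
  show "(\<lambda>b. f b o\<^sub>L g b) \<in> sections R"
    using f g by (auto simp: sections_def intro!: cb_binary[OF bounded_bilinear_blinfun_compose]
        extendable_bilinear[OF bounded_bilinear_blinfun_compose] R_compose)
qed

text \<open>\<open>total_least\<close> is the induction principle for the generated algebra;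
  \<open>total_sections\<close> is its conclusion for \<open>N = sections R\<close>.\<close>

lemma
  shows total_star: "star_subalgebra cscale_op bounded_ops (o\<^sub>L) adj total"
    and total_step: "s \<in> R a \<Longrightarrow> step_map a s \<in> total"
    and total_least: "star_subalgebra cscale_op bounded_ops (o\<^sub>L) adj N \<Longrightarrow>
      (\<And>a s. s \<in> R a \<Longrightarrow> step_map a s \<in> N) \<Longrightarrow> total \<subseteq> N"
    and total_sections: "m \<in> total \<Longrightarrow> extendable m \<and> (\<forall>b. m b \<in> R b)"
proof -
    have G: "{step_map a s | a s. s \<in> R a} \<subseteq> sections R"
      unfolding sections_def
  proof (intro subsetI CollectI conjI allI; elim CollectE exE conjE; simp only:)
    fix a b :: 'p and s assume s: "s \<in> R a"
    show "step_map a s \<in> cb bounded_ops" by (rule cb_step_map) (use s R_subset in auto)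
    show "extendable (step_map a s)" by (rule extendable_step_map)
    show "step_map a s b \<in> R b" using s R_mono[of a b] R_0 by (auto simp: step_map_def)
  qed
  note gen = carr_cstar_generated[of "op_cstar bounded_ops", OF op_cstar_simps(1-4,7) cscale_op_distrib(7) closed_bounded_ops,
      unfolded op_cstar_simps, OF star_subalgebra_sections G, folded algebra_def total_def]
  show "star_subalgebra cscale_op bounded_ops (o\<^sub>L) adj total" by (rule gen(1))
  show "s \<in> R a \<Longrightarrow> step_map a s \<in> total" using gen(2) by blast
  show "star_subalgebra cscale_op bounded_ops (o\<^sub>L) adj N \<Longrightarrow>
      (\<And>a s. s \<in> R a \<Longrightarrow> step_map a s \<in> N) \<Longrightarrow> total \<subseteq> N"
    by (rule gen(3)) auto
  show "m \<in> total \<Longrightarrow> extendable m \<and> (\<forall>b. m b \<in> R b)"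
    using gen(3)[OF star_subalgebra_sections G] by (auto simp: sections_def)
qed

lemmas total_subspace = star_subalgebraD(1)[OF total_star]
lemmas total_cb = closed_subspaceD(1)[OF total_subspace]

text \<open>At the least element of the poset a step map is constant.\<close>

lemma total_id: "(\<lambda>_. id_blinfun) \<in> total"
proof -
  obtain z where "\<And>a :: 'p. z \<le> a" using least by blast
  then have "step_map z (id_blinfun :: 'a ell2 \<Rightarrow>\<^sub>L 'a ell2) = (\<lambda>_. id_blinfun)" by (auto simp: step_map_def)
  then show ?thesis using total_step[OF R_id, of z] by simp
qed

text \<open>Closure under multiplication by \<open>galg\<close> is not part of the definition of the
  algebra. It follows because the indicator of \<open>{a..}\<close> corresponds to the generator
  \<open>step_map a id_blinfun\<close> and that of the complement to its difference from the
  unit.\<close>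

lemma galg_subset_total: "f \<in> galg \<Longrightarrow> (\<lambda>b. cscale_op (f b) id_blinfun) \<in> total"
proof -
  let ?N = "{f \<in> cb UNIV. (\<lambda>b. cscale_op (f b) id_blinfun) \<in> total}"
  note C = closed_subspaceD[OF total_subspace]
  have "galg \<subseteq> ?N"
  proof (rule galg_least)
    show "star_subalgebra (*) UNIV (*) cnj ?N"
      unfolding star_subalgebra_def
    proof (intro conjI ballI closed_subspace_CollectI[OF star_subalgebraD(1)[OF star_subalgebra_cb_complex]])
      show "(\<lambda>b. cscale_op 0 id_blinfun) \<in> total" using C(2) by (simp add: cscale_op_distrib)
      fix f :: "'p \<Rightarrow> complex" assume f: "(\<lambda>b. cscale_op (f b) id_blinfun) \<in> total"
      show "(\<lambda>b. cscale_op (c * f b) id_blinfun) \<in> total" for c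
        using C(4)[OF f, of c] by (simp add: cscale_op_distrib)
      fix g :: "'p \<Rightarrow> complex" assume g: "(\<lambda>b. cscale_op (g b) id_blinfun) \<in> total"
      show "(\<lambda>b. cscale_op (f b + g b) id_blinfun) \<in> total"
        using C(3)[OF f g] by (simp add: cscale_op_distrib)
    next
      fix f assume f: "f \<in> ?N"
      show "(\<lambda>b. cnj (f b)) \<in> ?N"
        using f star_subalgebraD(3)[OF total_star, of "\<lambda>b. cscale_op (f b) id_blinfun"]
          star_subalgebraD(3)[OF star_subalgebra_cb_complex, of f] by (simp add: adj_cscale)
      fix g assume g: "g \<in> ?N"
      show "(\<lambda>b. f b * g b) \<in> ?N"
        using f g star_subalgebraD(2)[OF total_star, of "\<lambda>b. cscale_op (f b) id_blinfun" "\<lambda>b. cscale_op (g b) id_blinfun"]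
          star_subalgebraD(2)[OF star_subalgebra_cb_complex, of f g]
        by (simp add: cscale_op_compose cscale_op_distrib blinfun_compose_id mult.commute)
    next
      fix s :: "nat \<Rightarrow> 'p \<Rightarrow> complex" and l
      assume s: "\<And>n. (\<lambda>b. cscale_op (s n b) id_blinfun) \<in> total" and l: "uniform_limit UNIV s l sequentially"
      show "(\<lambda>b. cscale_op (l b) id_blinfun) \<in> total"
        by (rule C(5)[OF s bounded_linear.uniform_limit[OF
                bounded_bilinear.bounded_linear_left[OF bounded_bilinear_cscale_op] l]])
    qed
    have step: "(\<lambda>b. cscale_op (indicator {a..} b) id_blinfun) = step_map a id_blinfun" for a :: 'p
      by (auto simp: step_map_def indicator_def cscale_op_distrib)
    have cbi: "indicator {a..} \<in> cb (UNIV :: complex set)" "indicator (- {a..}) \<in> cb (UNIV :: complex set)" for a :: 'p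
      using closed_subspaceD(1)[OF galg_subspace] indicator_in_galg by blast+
    show "indicator {a..} \<in> ?N" for a :: 'p using cbi total_step[OF R_id] by (simp add: step)
    show "indicator (- {a..}) \<in> ?N" for a :: 'p
    proof -
      have "(\<lambda>b. cscale_op (indicator (- {a..}) b) id_blinfun)
          = (\<lambda>b. id_blinfun + cscale_op (-1) (step_map a id_blinfun b :: 'a ell2 \<Rightarrow>\<^sub>L 'a ell2))"
        by (auto simp: step_map_def indicator_def cscale_op_distrib)
      then show ?thesis using cbi C(3)[OF total_id C(4)[OF total_step[OF R_id]]] by simp
    qed
  qed
  then show "f \<in> galg \<Longrightarrow> (\<lambda>b. cscale_op (f b) id_blinfun) \<in> total" by blast
qed

lemma total_field: "star_algebra_field total"
  unfolding star_algebra_field_def galg_module_def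
proof (intro conjI ballI total_subspace total_star total_id)
  show "extendable m" if "m \<in> total" for m using total_sections[OF that] by blast
  show "(\<lambda>b. cscale_op (f b) (m b)) \<in> total" if "f \<in> galg" "m \<in> total" for f m
    using star_subalgebraD(2)[OF total_star galg_subset_total[OF that(1)] that(2)]
    by (simp add: cscale_op_compose blinfun_compose_id)
qed

lemma fibre_total: "field_eval (gamma_point b) ` total = R b"
proof
  show "field_eval (gamma_point b) ` total \<subseteq> R b"
    using total_sections by (auto simp: field_eval_gamma_point)
  show "R b \<subseteq> field_eval (gamma_point b) ` total"
  proof
    fix s assume "s \<in> R b"
    then have "step_map b s \<in> total" by (rule total_step)
    moreover have "field_eval (gamma_point b) (step_map b s) = s"
      by (simp add: field_eval_gamma_point extendable_step_map step_map_def)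
    ultimately show "s \<in> field_eval (gamma_point b) ` total" by force
  qed
qed

end

section \<open>Closed linear spans and the bimodule of sections\<close>

definition cspan :: "('p::order \<Rightarrow> 'a ell2 \<Rightarrow>\<^sub>L 'b ell2) set \<Rightarrow> ('p \<Rightarrow> 'a ell2 \<Rightarrow>\<^sub>L 'b ell2) set" where
  "cspan G = \<Inter>{N. closed_subspace cscale_op bounded_ops N \<and> G \<subseteq> N}"

lemma cspan_superset: "G \<subseteq> cspan G"
  by (auto simp: cspan_def)

lemma cspan_induct:
  assumes "m \<in> cspan G" "closed_subspace cscale_op bounded_ops {m \<in> cb bounded_ops. P m}"
    "G \<subseteq> cb bounded_ops" "\<And>g. g \<in> G \<Longrightarrow> P g"
  shows "P m"
proof -
  have "{m \<in> cb bounded_ops. P m} \<in> {N. closed_subspace cscale_op bounded_ops N \<and> G \<subseteq> N}"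
    using assms(2-4) by blast
  then show ?thesis using assms(1) unfolding cspan_def by blast
qed

lemma closed_subspace_cspan:
  assumes "G \<subseteq> cb bounded_ops"
  shows "closed_subspace cscale_op bounded_ops (cspan G)"
proof -
  have eq: "cspan G = {m \<in> cb bounded_ops. \<forall>N\<in>{N. closed_subspace cscale_op bounded_ops N \<and> G \<subseteq> N}. m \<in> N}"
    using assms closed_subspace_cb by (auto simp: cspan_def)
  have "{m \<in> cb bounded_ops. m \<in> N} = N" if "closed_subspace cscale_op bounded_ops N" for N :: "('a \<Rightarrow> 'b ell2 \<Rightarrow>\<^sub>L 'c ell2) set"
    using closed_subspaceD(1)[OF that] by blast
  then show ?thesis
    unfolding eq by (intro closed_subspace_Ball) (use assms closed_subspace_cb in auto)
qed

text \<open>The two algebra families and the module family enter only through these properties.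
  \<open>bounded_join\<close> concerns pairs with a common upper bound; for any other pair the
  product of step maps vanishes.\<close>

locale bimodule_family = A: algebra_family AA + B: algebra_family BB
  for AA :: "'p::order \<Rightarrow> ('y ell2 \<Rightarrow>\<^sub>L 'y ell2) set" and BB :: "'p \<Rightarrow> ('x ell2 \<Rightarrow>\<^sub>L 'x ell2) set" +
  fixes MM :: "'p \<Rightarrow> ('x ell2 \<Rightarrow>\<^sub>L 'y ell2) set"
  assumes MM_closed: "closed (MM a)" and MM_subset: "MM a \<subseteq> bounded_ops" and MM_0: "0 \<in> MM a"
    and MM_add: "s \<in> MM a \<Longrightarrow> s' \<in> MM a \<Longrightarrow> s + s' \<in> MM a"
    and MM_cscale: "s \<in> MM a \<Longrightarrow> cscale_op c s \<in> MM a"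
    and MM_mono: "a \<le> b \<Longrightarrow> MM a \<subseteq> MM b"
    and AA_MM: "r \<in> AA a \<Longrightarrow> s \<in> MM a \<Longrightarrow> r o\<^sub>L s \<in> MM a"
    and MM_BB: "s \<in> MM a \<Longrightarrow> r' \<in> BB a \<Longrightarrow> s o\<^sub>L r' \<in> MM a"
    and MM_MM_adj: "s \<in> MM a \<Longrightarrow> s' \<in> MM a \<Longrightarrow> s o\<^sub>L adj s' \<in> AA a"
    and MM_adj_MM: "s \<in> MM a \<Longrightarrow> s' \<in> MM a \<Longrightarrow> adj s o\<^sub>L s' \<in> BB a"
    and bounded_join: "a \<le> ub \<Longrightarrow> b \<le> ub \<Longrightarrow> \<exists>j. a \<le> j \<and> b \<le> j \<and> (\<forall>k. a \<le> k \<longrightarrow> b \<le> k \<longrightarrow> j \<le> k)"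
begin

text \<open>\<open>h\<close> stands for composition, with an adjoint on the left factor, on the
  right factor or on neither; this treats all products of generators alike.\<close>

lemma step_map_product:
  assumes "\<And>j. a1 \<le> j \<Longrightarrow> a2 \<le> j \<Longrightarrow> step_map j (h s1 s2) \<in> N" "(\<lambda>_ :: 'p. 0) \<in> N"
    and h: "\<And>x. h x 0 = 0" "\<And>y. h 0 y = 0"
  shows "(\<lambda>b. h (step_map a1 s1 b) (step_map a2 s2 b)) \<in> N"
proof (cases "\<exists>c. a1 \<le> c \<and> a2 \<le> c")
  case True
  then obtain j where j: "a1 \<le> j" "a2 \<le> j" "\<And>k. a1 \<le> k \<Longrightarrow> a2 \<le> k \<Longrightarrow> j \<le> k"
    using bounded_join by blast
  then have "(a1 \<le> b \<and> a2 \<le> b) = (j \<le> b)" for b using order_trans by blast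
  then have "(\<lambda>b. h (step_map a1 s1 b) (step_map a2 s2 b)) = step_map j (h s1 s2)"
    by (fastforce simp: step_map_def h)
  then show ?thesis using assms(1) j by simp
next
  case False
  then have "(\<lambda>b. h (step_map a1 s1 b) (step_map a2 s2 b)) = (\<lambda>_. 0)"
    by (auto simp: step_map_def h)
  then show ?thesis using assms(2) by simp
qed

text \<open>The factors from \<open>galg\<close> make the span a module over \<open>galg\<close> by
  construction.\<close>

definition gens :: "('p \<Rightarrow> 'x ell2 \<Rightarrow>\<^sub>L 'y ell2) set" where
  "gens = {\<lambda>b. cscale_op (f b) (step_map a s b) | f a s. f \<in> galg \<and> s \<in> MM a}"

definition total :: "('p \<Rightarrow> 'x ell2 \<Rightarrow>\<^sub>L 'y ell2) set" where
  "total = cspan gens"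

lemma gensI: "f \<in> galg \<Longrightarrow> s \<in> MM a \<Longrightarrow> (\<lambda>b. cscale_op (f b) (step_map a s b)) \<in> gens"
  unfolding gens_def by blast

lemma gensE:
  assumes "g \<in> gens"
  obtains f a s where "g = (\<lambda>b. cscale_op (f b) (step_map a s b))" "f \<in> galg" "s \<in> MM a"
  using assms unfolding gens_def by blast

lemma step_map_bounded_ops: "s \<in> MM a \<Longrightarrow> step_map a' s b \<in> bounded_ops"
  using MM_subset by (auto simp: step_map_def)

lemma gens_cb: "gens \<subseteq> cb bounded_ops"
proof
  fix g assume "g \<in> gens"
  then obtain f a s where g: "g = (\<lambda>b. cscale_op (f b) (step_map a s b))" "f \<in> galg" "s \<in> MM a" by (rule gensE)
  have "step_map a s \<in> cb bounded_ops" by (rule cb_step_map) (use g(3) MM_subset in auto)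
  then show "g \<in> cb bounded_ops"
    unfolding g(1) using closed_subspaceD(1)[OF galg_subspace g(2)]
    by (intro cb_binary[OF bounded_bilinear_cscale_op]) auto
qed

lemma total_subspace: "closed_subspace cscale_op bounded_ops total"
  unfolding total_def by (rule closed_subspace_cspan[OF gens_cb])

lemmas total_cb = closed_subspaceD(1)[OF total_subspace]

lemma gens_total: "g \<in> gens \<Longrightarrow> g \<in> total"
  unfolding total_def using cspan_superset by blast

lemma total_induct:
  assumes "m \<in> total" "closed_subspace cscale_op bounded_ops {m \<in> cb bounded_ops. P m}" "\<And>g. g \<in> gens \<Longrightarrow> P g"
  shows "P m"
  using cspan_induct[OF assms(1)[unfolded total_def] assms(2) gens_cb assms(3)] .

lemma total_step: "s \<in> MM a \<Longrightarrow> step_map a s \<in> total"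
  using gens_total[OF gensI[OF galg_const[of 1]]] by (simp add: cscale_op_distrib)

lemma total_galg:
  assumes f: "f \<in> galg" and m: "m \<in> total"
  shows "(\<lambda>b. cscale_op (f b) (m b)) \<in> total"
proof -
  obtain K where K: "\<And>b. cmod (f b) \<le> K" using galg_bounded[OF f] by blast
  show ?thesis
  proof (rule total_induct[OF m closed_subspace_cscale_fun[OF total_subspace K]])
    fix g assume "g \<in> gens"
    then obtain f' a s where g: "g = (\<lambda>b. cscale_op (f' b) (step_map a s b))" "f' \<in> galg" "s \<in> MM a" by (rule gensE)
    show "(\<lambda>b. cscale_op (f b) (g b)) \<in> total"
      unfolding g(1) cscale_op_distrib(3) by (rule gens_total[OF gensI[OF galg_mult[OF f g(2)] g(3)]])
  qed
qed

lemma A_galg: "f \<in> galg \<Longrightarrow> m \<in> A.total \<Longrightarrow> (\<lambda>b. cscale_op (f b) (m b)) \<in> A.total"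
  and B_galg: "f' \<in> galg \<Longrightarrow> m' \<in> B.total \<Longrightarrow> (\<lambda>b. cscale_op (f' b) (m' b)) \<in> B.total"
  using A.total_field B.total_field by (auto simp: star_algebra_field_def galg_module_def)

text \<open>A density argument in two stages: first \<open>n\<close> is reduced to a generator with
  \<open>m\<close> arbitrary, then \<open>m\<close> against this generator. The second coefficient
  enters conjugated, hence the use of \<open>galg_cnj\<close>.\<close>

lemma total_total_adj:
  assumes m: "m \<in> total" and n: "n \<in> total"
  shows "(\<lambda>b. m b o\<^sub>L adj (n b)) \<in> A.total"
proof (rule total_induct[OF n closed_subspace_compose_adj_left[OF A.total_subspace total_cb[OF m]]])
  fix g' assume g': "g' \<in> gens"
  then obtain f' a' s' where g'_eq: "g' = (\<lambda>b. cscale_op (f' b) (step_map a' s' b))" "f' \<in> galg" "s' \<in> MM a'"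
    by (rule gensE)
  have "(\<lambda>b. adj (g' b)) \<in> cb bounded_ops" using g' gens_cb by (intro cb_adj) blast
  note cs = closed_subspace_compose_right[OF A.total_subspace this]
  show "(\<lambda>b. m b o\<^sub>L adj (g' b)) \<in> A.total"
  proof (rule total_induct[OF m cs])
    fix g assume "g \<in> gens"
    then obtain f a s where g: "g = (\<lambda>b. cscale_op (f b) (step_map a s b))" "f \<in> galg" "s \<in> MM a" by (rule gensE)
    have "(\<lambda>b. step_map a s b o\<^sub>L adj (step_map a' s' b)) \<in> A.total"
    proof (rule step_map_product[where h = "\<lambda>x y. x o\<^sub>L adj y"])
      fix j assume "a \<le> j" "a' \<le> j"
      then show "step_map j (s o\<^sub>L adj s') \<in> A.total"
        using MM_mono g(3) g'_eq(3) by (intro A.total_step MM_MM_adj) blast+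
    qed (simp_all add: blinfun_compose_distrib closed_subspaceD(2)[OF A.total_subspace])
    then have "(\<lambda>b. cscale_op (f b * cnj (f' b)) (step_map a s b o\<^sub>L adj (step_map a' s' b))) \<in> A.total"
      by (rule A_galg[OF galg_mult[OF g(2) galg_cnj[OF g'_eq(2)]]])
    then show "(\<lambda>b. g b o\<^sub>L adj (g' b)) \<in> A.total"
      by (simp add: g(1) g'_eq(1) adj_cscale step_map_bounded_ops[OF g(3)] step_map_bounded_ops[OF g'_eq(3)]
          cscale_op_compose cscale_op_distrib(3))
  qed
qed

lemma adj_total_total:
  assumes m: "m \<in> total" and n: "n \<in> total"
  shows "(\<lambda>b. adj (m b) o\<^sub>L n b) \<in> B.total"
proof (rule total_induct[OF m closed_subspace_compose_adj_right[OF B.total_subspace total_cb[OF n]]])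
  fix g' assume g': "g' \<in> gens"
  then obtain f' a' s' where g'_eq: "g' = (\<lambda>b. cscale_op (f' b) (step_map a' s' b))" "f' \<in> galg" "s' \<in> MM a'"
    by (rule gensE)
  have "(\<lambda>b. adj (g' b)) \<in> cb bounded_ops" using g' gens_cb by (intro cb_adj) blast
  note cs = closed_subspace_compose_left[OF B.total_subspace this]
  show "(\<lambda>b. adj (g' b) o\<^sub>L n b) \<in> B.total"
  proof (rule total_induct[OF n cs])
    fix g assume "g \<in> gens"
    then obtain f a s where g: "g = (\<lambda>b. cscale_op (f b) (step_map a s b))" "f \<in> galg" "s \<in> MM a" by (rule gensE)
    have "(\<lambda>b. adj (step_map a' s' b) o\<^sub>L step_map a s b) \<in> B.total"
    proof (rule step_map_product[where h = "\<lambda>x y. adj x o\<^sub>L y"])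
      fix j assume "a' \<le> j" "a \<le> j"
      then show "step_map j (adj s' o\<^sub>L s) \<in> B.total"
        using MM_mono g(3) g'_eq(3) by (intro B.total_step MM_adj_MM) blast+
    qed (simp_all add: blinfun_compose_distrib closed_subspaceD(2)[OF B.total_subspace])
    then have "(\<lambda>b. cscale_op (cnj (f' b) * f b) (adj (step_map a' s' b) o\<^sub>L step_map a s b)) \<in> B.total"
      by (rule B_galg[OF galg_mult[OF galg_cnj[OF g'_eq(2)] g(2)]])
    then show "(\<lambda>b. adj (g' b) o\<^sub>L g b) \<in> B.total"
      by (simp add: g(1) g'_eq(1) adj_cscale step_map_bounded_ops[OF g(3)] step_map_bounded_ops[OF g'_eq(3)]
          cscale_op_compose cscale_op_distrib(3))
  qed
qed

lemma A_step_total: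
  assumes r: "r \<in> AA c" and m: "m \<in> total"
  shows "(\<lambda>b. step_map c r b o\<^sub>L m b) \<in> total"
proof (rule total_induct[OF m closed_subspace_compose_left[OF total_subspace A.total_cb[OF A.total_step[OF r]]]])
  fix g assume "g \<in> gens"
  then obtain f a s where g: "g = (\<lambda>b. cscale_op (f b) (step_map a s b))" "f \<in> galg" "s \<in> MM a" by (rule gensE)
  have "(\<lambda>b. step_map c r b o\<^sub>L step_map a s b) \<in> total"
  proof (rule step_map_product[where h = "(o\<^sub>L)"])
    fix j assume "c \<le> j" "a \<le> j"
    then show "step_map j (r o\<^sub>L s) \<in> total"
      using MM_mono A.R_mono g(3) r by (intro total_step AA_MM) blast+
  qed (simp_all add: blinfun_compose_distrib closed_subspaceD(2)[OF total_subspace])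
  moreover have "step_map c r b \<in> bounded_ops" for b using A.R_subset r by (auto simp: step_map_def)
  ultimately show "(\<lambda>b. step_map c r b o\<^sub>L g b) \<in> total"
    using total_galg[OF g(2)] by (simp add: g(1) cscale_op_compose)
qed

lemma B_step_total:
  assumes r: "r \<in> BB c" and m: "m \<in> total"
  shows "(\<lambda>b. m b o\<^sub>L step_map c r b) \<in> total"
proof (rule total_induct[OF m closed_subspace_compose_right[OF total_subspace B.total_cb[OF B.total_step[OF r]]]])
  fix g assume "g \<in> gens"
  then obtain f a s where g: "g = (\<lambda>b. cscale_op (f b) (step_map a s b))" "f \<in> galg" "s \<in> MM a" by (rule gensE)
  have "(\<lambda>b. step_map a s b o\<^sub>L step_map c r b) \<in> total"
  proof (rule step_map_product[where h = "(o\<^sub>L)"])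
    fix j assume "a \<le> j" "c \<le> j"
    then show "step_map j (s o\<^sub>L r) \<in> total"
      using MM_mono B.R_mono g(3) r by (intro total_step MM_BB) blast+
  qed (simp_all add: blinfun_compose_distrib closed_subspaceD(2)[OF total_subspace])
  then show "(\<lambda>b. g b o\<^sub>L step_map c r b) \<in> total"
    using total_galg[OF g(2)] by (simp add: g(1) cscale_op_compose)
qed

text \<open>The induction over the generated algebra must pass through adjoints and products.
  Therefore the induction property covers \<open>adj r\<close> as well and quantifies over all
  \<open>m\<close>, so that two factors can act in succession.\<close>

lemma A_total:
  assumes r: "r \<in> A.total" and m: "m \<in> total"
  shows "(\<lambda>b. r b o\<^sub>L m b) \<in> total"
proof -
  let ?P = "\<lambda>r m. (\<lambda>b. r b o\<^sub>L m b) \<in> total \<and> (\<lambda>b. adj (r b) o\<^sub>L m b) \<in> total"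
  let ?N = "{r \<in> cb bounded_ops. \<forall>m\<in>total. ?P r m}"
  have "A.total \<subseteq> ?N"
  proof (rule A.total_least)
    have D: "(\<lambda>b. r b o\<^sub>L m b) \<in> total" "(\<lambda>b. adj (r b) o\<^sub>L m b) \<in> total" if "r \<in> ?N" "m \<in> total" for r m
      using that by simp_all
    show "star_subalgebra cscale_op bounded_ops (o\<^sub>L) adj ?N"
      unfolding star_subalgebra_def
    proof (intro conjI ballI)
      show "closed_subspace cscale_op bounded_ops ?N"
      proof (rule closed_subspace_Ball)
        show "closed_subspace cscale_op bounded_ops {r \<in> cb bounded_ops. ?P r m}" if "m \<in> total" for m
          by (intro closed_subspace_conj closed_subspace_compose_right[OF total_subspace total_cb[OF that]]
              closed_subspace_compose_adj_right[OF total_subspace total_cb[OF that]])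
      qed
      fix f assume f: "f \<in> ?N"
      then have f_bo: "f b \<in> bounded_ops" for b by (blast intro: cb_in)
      then show "(\<lambda>b. adj (f b)) \<in> ?N" using f by (simp add: cb_adj)
      fix g assume g: "g \<in> ?N"
      then have g_bo: "g b \<in> bounded_ops" for b by (blast intro: cb_in)
      have "(\<lambda>b. f b o\<^sub>L g b) \<in> cb bounded_ops"
        using f g by (intro cb_binary[OF bounded_bilinear_blinfun_compose]) auto
      moreover have "?P (\<lambda>b. f b o\<^sub>L g b) m" if "m \<in> total" for m
      proof -
        have "(\<lambda>b. f b o\<^sub>L (g b o\<^sub>L m b)) \<in> total" "(\<lambda>b. adj (g b) o\<^sub>L (adj (f b) o\<^sub>L m b)) \<in> total"
          by (rule D(1)[OF f D(1)[OF g that]], rule D(2)[OF g D(2)[OF f that]])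
        then show ?thesis by (simp add: blinfun_compose_distrib(5) adj_compose f_bo g_bo)
      qed
      ultimately show "(\<lambda>b. f b o\<^sub>L g b) \<in> ?N" by blast
    qed
    fix a s assume s: "s \<in> AA a"
    have eq: "(\<lambda>b. adj (step_map a s b)) = step_map a (adj s)" by (auto simp: step_map_def)
    have "(\<lambda>b. step_map a (adj s) b o\<^sub>L m b) \<in> total" if "m \<in> total" for m
      by (rule A_step_total[OF A.R_adj[OF s] that])
    then have "(\<lambda>b. adj (step_map a s b) o\<^sub>L m b) \<in> total" if "m \<in> total" for m
      using that by (simp add: eq[THEN fun_cong])
    then show "step_map a s \<in> ?N" using A_step_total[OF s] A.total_cb[OF A.total_step[OF s]] by blast
  qed
  then show ?thesis using r m by blast
qed

lemma B_total:
  assumes m: "m \<in> total" and r: "r \<in> B.total"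
  shows "(\<lambda>b. m b o\<^sub>L r b) \<in> total"
proof -
  let ?P = "\<lambda>r m. (\<lambda>b. m b o\<^sub>L r b) \<in> total \<and> (\<lambda>b. m b o\<^sub>L adj (r b)) \<in> total"
  let ?N = "{r \<in> cb bounded_ops. \<forall>m\<in>total. ?P r m}"
  have "B.total \<subseteq> ?N"
  proof (rule B.total_least)
    have D: "(\<lambda>b. m b o\<^sub>L r b) \<in> total" "(\<lambda>b. m b o\<^sub>L adj (r b)) \<in> total" if "r \<in> ?N" "m \<in> total" for r m
      using that by simp_all
    show "star_subalgebra cscale_op bounded_ops (o\<^sub>L) adj ?N"
      unfolding star_subalgebra_def
    proof (intro conjI ballI)
      show "closed_subspace cscale_op bounded_ops ?N"
      proof (rule closed_subspace_Ball)
        show "closed_subspace cscale_op bounded_ops {r \<in> cb bounded_ops. ?P r m}" if "m \<in> total" for m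
          by (intro closed_subspace_conj closed_subspace_compose_left[OF total_subspace total_cb[OF that]]
              closed_subspace_compose_adj_left[OF total_subspace total_cb[OF that]])
      qed
      fix f assume f: "f \<in> ?N"
      then have f_bo: "f b \<in> bounded_ops" for b by (blast intro: cb_in)
      then show "(\<lambda>b. adj (f b)) \<in> ?N" using f by (simp add: cb_adj)
      fix g assume g: "g \<in> ?N"
      then have g_bo: "g b \<in> bounded_ops" for b by (blast intro: cb_in)
      have "(\<lambda>b. f b o\<^sub>L g b) \<in> cb bounded_ops"
        using f g by (intro cb_binary[OF bounded_bilinear_blinfun_compose]) auto
      moreover have "?P (\<lambda>b. f b o\<^sub>L g b) m" if "m \<in> total" for m
      proof -
        have "(\<lambda>b. (m b o\<^sub>L f b) o\<^sub>L g b) \<in> total" "(\<lambda>b. (m b o\<^sub>L adj (g b)) o\<^sub>L adj (f b)) \<in> total"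
          by (rule D(1)[OF g D(1)[OF f that]], rule D(2)[OF f D(2)[OF g that]])
        then show ?thesis by (simp add: blinfun_compose_distrib(5) adj_compose f_bo g_bo)
      qed
      ultimately show "(\<lambda>b. f b o\<^sub>L g b) \<in> ?N" by blast
    qed
    fix a s assume s: "s \<in> BB a"
    have eq: "(\<lambda>b. adj (step_map a s b)) = step_map a (adj s)" by (auto simp: step_map_def)
    have "(\<lambda>b. m b o\<^sub>L step_map a (adj s) b) \<in> total" if "m \<in> total" for m
      by (rule B_step_total[OF B.R_adj[OF s] that])
    then have "(\<lambda>b. m b o\<^sub>L adj (step_map a s b)) \<in> total" if "m \<in> total" for m
      using that by (simp add: eq[THEN fun_cong])
    then show "step_map a s \<in> ?N" using B_step_total[OF s] B.total_cb[OF B.total_step[OF s]] by blast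
  qed
  then show ?thesis using r m by blast
qed

lemma total_sections: "m \<in> total \<Longrightarrow> extendable m \<and> (\<forall>b. m b \<in> MM b)"
proof (rule total_induct, assumption)
  show "closed_subspace cscale_op bounded_ops {m \<in> cb bounded_ops. extendable m \<and> (\<forall>b. m b \<in> MM b)}"
    by (rule closed_subspace_sections[OF MM_closed MM_0 MM_add MM_cscale, unfolded sections_def])
  fix g assume "g \<in> gens"
  then obtain f a s where g: "g = (\<lambda>b. cscale_op (f b) (step_map a s b))" "f \<in> galg" "s \<in> MM a" by (rule gensE)
  have "step_map a s b \<in> MM b" for b using MM_mono[of a b] MM_0 g(3) by (auto simp: step_map_def)
  then show "extendable g \<and> (\<forall>b. g b \<in> MM b)"
    unfolding g(1)
    by (blast intro: MM_cscale extendable_bilinear[OF bounded_bilinear_cscale_op extendable_galg[OF g(2)] extendable_step_map])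
qed

lemma total_module: "galg_module total"
  unfolding galg_module_def using total_subspace total_sections total_galg by blast

lemma fibre_total: "field_eval (gamma_point b) ` total = MM b"
proof
  show "field_eval (gamma_point b) ` total \<subseteq> MM b"
    using total_sections by (auto simp: field_eval_gamma_point)
  show "MM b \<subseteq> field_eval (gamma_point b) ` total"
  proof
    fix s assume "s \<in> MM b"
    then have "step_map b s \<in> total" by (rule total_step)
    moreover have "field_eval (gamma_point b) (step_map b s) = s"
      by (simp add: field_eval_gamma_point extendable_step_map step_map_def)
    ultimately show "s \<in> field_eval (gamma_point b) ` total" by force
  qed
qed

text \<open>Identifies the span with the module of the statement. Ternary products stay in the span
  because \<open>m o\<^sub>L adj n\<close> is a section of the first algebra, which acts on it;
  conversely every admissible \<open>N\<close> contains \<open>gens\<close>.\<close>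

lemma total_eq:
  "total = \<Inter>{N. closed_subspace cscale_op bounded_ops N \<and>
     (\<forall>a. \<forall>s\<in>MM a. step_map a s \<in> N) \<and>
     (\<forall>m\<in>N. \<forall>n\<in>N. \<forall>r\<in>N. (\<lambda>b. m b o\<^sub>L adj (n b) o\<^sub>L r b) \<in> N) \<and>
     (\<forall>f\<in>galg. \<forall>m\<in>N. (\<lambda>b. cscale_op (f b) (m b)) \<in> N)}" (is "_ = \<Inter>{N. ?C N}")
proof
  have "gens \<subseteq> N" if "?C N" for N using that unfolding gens_def by blast
  then show "total \<subseteq> \<Inter>{N. ?C N}" unfolding total_def cspan_def by blast
  have "?C total"
    using total_subspace total_step total_galg A_total[OF total_total_adj] by blast
  then show "\<Inter>{N. ?C N} \<subseteq> total" by blast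
qed

end

section \<open>Hilbert bimodules of operators\<close>

lemma op_bimod_simps:
  "carr (op_bimod S) = S" "zro (op_bimod S) = 0" "pls (op_bimod S) = (+)" "scl (op_bimod S) = cscale_op"
  "lact (op_bimod S) = (o\<^sub>L)" "ract (op_bimod S) = (o\<^sub>L)"
  "lip (op_bimod S) = (\<lambda>m n. m o\<^sub>L adj n)" "rip (op_bimod S) = (\<lambda>m n. adj m o\<^sub>L n)"
  by (simp_all add: op_bimod_def)

lemma map_bimod_simps:
  "carr (map_bimod N) = N" "zro (map_bimod N) = (\<lambda>_. 0)" "pls (map_bimod N) = (\<lambda>f g b. f b + g b)"
  "scl (map_bimod N) = (\<lambda>c f b. cscale_op c (f b))"
  "lact (map_bimod N) = (\<lambda>a m b. a b o\<^sub>L m b)" "ract (map_bimod N) = (\<lambda>m r b. m b o\<^sub>L r b)"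
  "lip (map_bimod N) = (\<lambda>m n b. m b o\<^sub>L adj (n b))" "rip (map_bimod N) = (\<lambda>m n b. adj (m b) o\<^sub>L n b)"
  by (simp_all add: map_bimod_def)

lemma compose_self_eq_0:
  assumes "S \<in> bounded_ops"
  shows "adj S o\<^sub>L S = 0 \<Longrightarrow> S = 0" "S o\<^sub>L adj S = 0 \<Longrightarrow> S = 0"
  using norm_adj_compose_self(1)[OF assms] norm_compose_adj_self[OF assms] by simp_all

text \<open>Both inner products induce the operator norm, so closedness of \<open>S\<close> gives
  completeness. The roots in \<open>posA\<close> and \<open>posB\<close> are hypotheses because over
  points of \<open>gamma\<close> they are obtained by evaluating roots of sections.\<close>

lemma op_hilbert_bimodule:
  fixes S :: "('x ell2 \<Rightarrow>\<^sub>L 'y ell2) set"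
  assumes A: "cstar_algebra (op_cstar A)" "A \<subseteq> bounded_ops" and B: "cstar_algebra (op_cstar B)" "B \<subseteq> bounded_ops"
    and S: "S \<subseteq> bounded_ops" "closed S" "0 \<in> S" "\<And>x y. x \<in> S \<Longrightarrow> y \<in> S \<Longrightarrow> x + y \<in> S"
      "\<And>c x. x \<in> S \<Longrightarrow> cscale_op c x \<in> S"
    and AS: "\<And>a s. a \<in> A \<Longrightarrow> s \<in> S \<Longrightarrow> a o\<^sub>L s \<in> S" and SB: "\<And>s b. s \<in> S \<Longrightarrow> b \<in> B \<Longrightarrow> s o\<^sub>L b \<in> S"
    and SS: "\<And>s s'. s \<in> S \<Longrightarrow> s' \<in> S \<Longrightarrow> s o\<^sub>L adj s' \<in> A" "\<And>s s'. s \<in> S \<Longrightarrow> s' \<in> S \<Longrightarrow> adj s o\<^sub>L s' \<in> B"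
    and posA: "\<And>s. s \<in> S \<Longrightarrow> \<exists>w\<in>A. s o\<^sub>L adj s = adj w o\<^sub>L w"
    and posB: "\<And>s. s \<in> S \<Longrightarrow> \<exists>w\<in>B. adj s o\<^sub>L s = adj w o\<^sub>L w"
  shows "hilbert_bimodule (op_cstar A) (op_cstar B) (op_bimod S)"
proof -
  have cs: "complex_space (op_bimod S)"
    by (rule op_vec_complex_space[OF _ _ _ _ S(3-5)]) (simp_all add: op_bimod_simps)
  have bo: "a \<in> A \<Longrightarrow> a \<in> bounded_ops" "b \<in> B \<Longrightarrow> b \<in> bounded_ops" "s \<in> S \<Longrightarrow> s \<in> bounded_ops" for a b s
    using A(2) B(2) S(1) by blast+
  note simps = op_bimod_simps op_cstar_simps linear_map_def bo blinfun_compose_distrib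
    cscale_op_compose adj_add adj_cscale adj_compose
  have "left_hilbert_module (op_bimod S) (op_cstar A) (lact (op_bimod S)) (lip (op_bimod S))"
    unfolding left_hilbert_module_def left_hilbert_module_axioms_def
  proof (intro conjI allI impI cs A(1))
    show "norm_complete (op_bimod S) (\<lambda>m. sqrt (nrm (op_cstar A) (lip (op_bimod S) m m)))"
      by (rule op_norm_complete[OF _ _ _ S(2) _ S(4,5)]) (simp_all add: op_bimod_simps op_cstar_simps bo norm_compose_adj_self)
    fix m assume m: "m \<in> carr (op_bimod S)"
    show "positive_in (op_cstar A) (lip (op_bimod S) m m)"
      using posA[of m] m by (simp add: positive_in_def op_bimod_simps op_cstar_simps)
    show "m = zro (op_bimod S)" if "lip (op_bimod S) m m = zro (op_cstar A)"
      using compose_self_eq_0(2)[of m] m that by (simp add: op_bimod_simps op_cstar_simps bo)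
  qed (simp_all add: simps AS SS S(3-5))
  moreover have "right_hilbert_module (op_bimod S) (op_cstar B) (ract (op_bimod S)) (rip (op_bimod S))"
    unfolding right_hilbert_module_def right_hilbert_module_axioms_def
  proof (intro conjI allI impI cs B(1))
    show "norm_complete (op_bimod S) (\<lambda>m. sqrt (nrm (op_cstar B) (rip (op_bimod S) m m)))"
      by (rule op_norm_complete[OF _ _ _ S(2) _ S(4,5)]) (simp_all add: op_bimod_simps op_cstar_simps bo norm_adj_compose_self)
    fix m assume m: "m \<in> carr (op_bimod S)"
    show "positive_in (op_cstar B) (rip (op_bimod S) m m)"
      using posB[of m] m by (simp add: positive_in_def op_bimod_simps op_cstar_simps)
    show "m = zro (op_bimod S)" if "rip (op_bimod S) m m = zro (op_cstar B)"
      using compose_self_eq_0(1)[of m] m that by (simp add: op_bimod_simps op_cstar_simps bo)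
  qed (simp_all add: simps SB SS S(3-5))
  ultimately show ?thesis
    unfolding hilbert_bimodule_def by (simp add: op_bimod_simps blinfun_compose_distrib)
qed

section \<open>Hilbert bimodule structure on sections and fibres\<close>

context bimodule_family
begin

lemma total_bounded_ops: "m \<in> total \<Longrightarrow> m b \<in> bounded_ops" "r \<in> A.total \<Longrightarrow> r b \<in> bounded_ops"
  "r' \<in> B.total \<Longrightarrow> r' b \<in> bounded_ops"
  using total_cb A.total_cb B.total_cb by (auto intro: cb_in)

text \<open>For the left inner product the root construction is applied to the section of
  adjoints.\<close>

lemma total_sqrt:
  assumes m: "m \<in> total"
  shows "\<exists>w\<in>A.total. \<forall>b. m b o\<^sub>L adj (m b) = adj (w b) o\<^sub>L w b"
    and "\<exists>w\<in>B.total. \<forall>b. adj (m b) o\<^sub>L m b = adj (w b) o\<^sub>L w b"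
proof -
  show "\<exists>w\<in>B.total. \<forall>b. adj (m b) o\<^sub>L m b = adj (w b) o\<^sub>L w b"
    by (rule star_algebra_sqrt[OF B.total_star B.total_id total_cb[OF m] adj_total_total[OF m m]])
  have "(\<lambda>b. adj (adj (m b)) o\<^sub>L adj (m b)) \<in> A.total"
    using total_total_adj[OF m m] by (simp add: total_bounded_ops(1)[OF m])
  then show "\<exists>w\<in>A.total. \<forall>b. m b o\<^sub>L adj (m b) = adj (w b) o\<^sub>L w b"
    using star_algebra_sqrt[OF A.total_star A.total_id cb_adj[OF total_cb[OF m]]]
    by (simp add: total_bounded_ops(1)[OF m])
qed

lemma field_hilbert_bimodule: "hilbert_bimodule A.algebra B.algebra (map_bimod total)"
proof -
  have cs: "complex_space (map_bimod total)"
    by (rule map_complex_space[OF _ _ _ _ total_subspace]) (simp_all add: map_bimod_simps)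
  note AC = field_cstar_algebra[OF A.total_field] and BC = field_cstar_algebra[OF B.total_field]
  note simps = map_bimod_simps field_cstar_simps linear_map_def blinfun_compose_distrib
    cscale_op_compose adj_add adj_cscale adj_compose total_bounded_ops
    A_total B_total total_total_adj adj_total_total closed_subspaceD(2-4)[OF total_subspace]
  \<comment> \<open>Both inner products induce the sup norm, so one completeness result serves the
    left and the right module.\<close>
  have sup: "sqrt (SUP b. norm (m b o\<^sub>L adj (m b))) = (SUP b. norm (m b))"
    "sqrt (SUP b. norm (adj (m b) o\<^sub>L m b)) = (SUP b. norm (m b))" if m: "m \<in> total" for m
  proof -
    note cbm = total_cb[OF m]
    have "(SUP b. norm (m b o\<^sub>L adj (m b))) = (SUP b. norm (m b))\<^sup>2"
      by (rule SUP_norm_square[OF cbm A.total_cb[OF total_total_adj[OF m m]]])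
        (simp add: norm_compose_adj_self total_bounded_ops(1)[OF m])
    then show "sqrt (SUP b. norm (m b o\<^sub>L adj (m b))) = (SUP b. norm (m b))"
      using SUP_norm(2)[OF cbm] by simp
    have "(SUP b. norm (adj (m b) o\<^sub>L m b)) = (SUP b. norm (m b))\<^sup>2"
      by (rule SUP_norm_square[OF cbm B.total_cb[OF adj_total_total[OF m m]]])
        (simp add: norm_adj_compose_self total_bounded_ops(1)[OF m])
    then show "sqrt (SUP b. norm (adj (m b) o\<^sub>L m b)) = (SUP b. norm (m b))"
      using SUP_norm(2)[OF cbm] by simp
  qed
  have zero: "m = (\<lambda>_. 0)" if "m \<in> total" "(\<lambda>b. m b o\<^sub>L adj (m b)) = (\<lambda>_. 0) \<or> (\<lambda>b. adj (m b) o\<^sub>L m b) = (\<lambda>_. 0)" for m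
  proof
    fix b
    have "m b o\<^sub>L adj (m b) = 0 \<or> adj (m b) o\<^sub>L m b = 0" using that(2) by (auto dest: fun_cong)
    then show "m b = 0" using compose_self_eq_0[OF total_bounded_ops(1)[OF that(1), of b]] by blast
  qed
  have "left_hilbert_module (map_bimod total) A.algebra (lact (map_bimod total)) (lip (map_bimod total))"
    unfolding left_hilbert_module_def left_hilbert_module_axioms_def A.algebra_eq
  proof (intro conjI allI impI cs AC)
    show "norm_complete (map_bimod total) (\<lambda>m. sqrt (nrm (field_cstar A.total) (lip (map_bimod total) m m)))"
      by (rule complete_closed_subspace[OF _ _ _ _ _ total_subspace])
        (simp_all add: map_bimod_simps field_cstar_simps cscale_op_distrib sup)
    fix m assume m: "m \<in> carr (map_bimod total)"
    show "positive_in (field_cstar A.total) (lip (map_bimod total) m m)"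
      using total_sqrt(1)[of m] m by (auto simp: positive_in_def map_bimod_simps field_cstar_simps fun_eq_iff)
    show "m = zro (map_bimod total)" if "lip (map_bimod total) m m = zro (field_cstar A.total)"
      using zero[of m] m that by (simp add: map_bimod_simps field_cstar_simps)
  qed (simp_all add: simps)
  moreover have "right_hilbert_module (map_bimod total) B.algebra (ract (map_bimod total)) (rip (map_bimod total))"
    unfolding right_hilbert_module_def right_hilbert_module_axioms_def B.algebra_eq
  proof (intro conjI allI impI cs BC)
    show "norm_complete (map_bimod total) (\<lambda>m. sqrt (nrm (field_cstar B.total) (rip (map_bimod total) m m)))"
      by (rule complete_closed_subspace[OF _ _ _ _ _ total_subspace])
        (simp_all add: map_bimod_simps field_cstar_simps cscale_op_distrib sup)
    fix m assume m: "m \<in> carr (map_bimod total)"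
    show "positive_in (field_cstar B.total) (rip (map_bimod total) m m)"
      using total_sqrt(2)[of m] m by (auto simp: positive_in_def map_bimod_simps field_cstar_simps fun_eq_iff)
    show "m = zro (map_bimod total)" if "rip (map_bimod total) m m = zro (field_cstar B.total)"
      using zero[of m] m that by (simp add: map_bimod_simps field_cstar_simps)
  qed (simp_all add: simps)
  ultimately show ?thesis
    unfolding hilbert_bimodule_def by (simp add: map_bimod_simps blinfun_compose_distrib)
qed

context
  fixes t :: "('p \<Rightarrow> complex) \<Rightarrow> complex"
  assumes t: "t \<in> topspace gamma"
begin

lemma total_extendable: "m \<in> total \<Longrightarrow> extendable m" "r \<in> A.total \<Longrightarrow> extendable r" "r' \<in> B.total \<Longrightarrow> extendable r'"
  using total_sections A.total_sections B.total_sections by blast+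

lemma field_eval_compose:
  "extendable m \<Longrightarrow> extendable n \<Longrightarrow> field_eval t (\<lambda>b. m b o\<^sub>L n b) = field_eval t m o\<^sub>L field_eval t n"
  by (rule field_eval_bilinear[OF bounded_bilinear_blinfun_compose _ _ t])

lemma field_eval_lip:
  assumes "m \<in> total" "n \<in> total"
  shows "field_eval t (\<lambda>b. m b o\<^sub>L adj (n b)) = field_eval t m o\<^sub>L adj (field_eval t n)"
    and "field_eval t (\<lambda>b. adj (m b) o\<^sub>L n b) = adj (field_eval t m) o\<^sub>L field_eval t n"
  using assms t
  by (simp_all add: field_eval_compose total_extendable total_cb extendable_adj field_eval_adj)

text \<open>Elements of the fibres are lifted to sections, multiplied there and evaluated again;
  positivity comes from evaluating the roots of \<open>total_sqrt\<close>.\<close>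

lemma fibre_hilbert_bimodule:
  "hilbert_bimodule (op_cstar (field_eval t ` A.total)) (op_cstar (field_eval t ` B.total)) (op_bimod (field_eval t ` total))"
proof -
  have AN: "galg_module A.total" and BN: "galg_module B.total"
    using A.total_field B.total_field by (auto simp: star_algebra_field_def)
  note fA = fibre_subspace[OF AN t] and fB = fibre_subspace[OF BN t] and fM = fibre_subspace[OF total_module t]
  have "cstar_algebra (op_cstar (field_eval t ` A.total))" "cstar_algebra (op_cstar (field_eval t ` B.total))"
    using continuous_field_star_algebra[OF A.total_field] continuous_field_star_algebra[OF B.total_field] t
    unfolding continuous_field_cstar_def by blast+
  then show ?thesis
  proof (rule op_hilbert_bimodule[OF _ fA(1) _ fB(1) fM(1) closed_fibre[OF total_module t] fM(2-4)])
    fix x y assume x: "x \<in> field_eval t ` A.total" and y: "y \<in> field_eval t ` total"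
    obtain f g where fg: "x = field_eval t f" "y = field_eval t g" "f \<in> A.total" "g \<in> total" using x y by blast
    show "x o\<^sub>L y \<in> field_eval t ` total"
      unfolding fg(1,2) field_eval_compose[OF total_extendable(2)[OF fg(3)] total_extendable(1)[OF fg(4)], symmetric]
      by (intro imageI A_total fg)
  next
    fix x y assume x: "x \<in> field_eval t ` total" and y: "y \<in> field_eval t ` B.total"
    obtain f g where fg: "x = field_eval t f" "y = field_eval t g" "f \<in> total" "g \<in> B.total" using x y by blast
    show "x o\<^sub>L y \<in> field_eval t ` total"
      unfolding fg(1,2) field_eval_compose[OF total_extendable(1)[OF fg(3)] total_extendable(3)[OF fg(4)], symmetric]
      by (intro imageI B_total fg)
  next
    fix x y assume x: "x \<in> field_eval t ` total" and y: "y \<in> field_eval t ` total"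
    obtain f g where fg: "x = field_eval t f" "y = field_eval t g" "f \<in> total" "g \<in> total" using x y by blast
    show "x o\<^sub>L adj y \<in> field_eval t ` A.total"
      unfolding fg(1,2) field_eval_lip(1)[OF fg(3,4), symmetric] by (intro imageI total_total_adj fg)
    show "adj x o\<^sub>L y \<in> field_eval t ` B.total"
      unfolding fg(1,2) field_eval_lip(2)[OF fg(3,4), symmetric] by (intro imageI adj_total_total fg)
  next
    fix x assume x: "x \<in> field_eval t ` total"
    obtain m where m: "x = field_eval t m" "m \<in> total" using x by blast
    obtain w where w: "w \<in> A.total" "(\<lambda>b. m b o\<^sub>L adj (m b)) = (\<lambda>b. adj (w b) o\<^sub>L w b)"
      using total_sqrt(1)[OF m(2)] by blast
    have "x o\<^sub>L adj x = field_eval t (\<lambda>b. adj (w b) o\<^sub>L w b)"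
      unfolding m(1) field_eval_lip(1)[OF m(2) m(2), symmetric] w(2) ..
    also have "\<dots> = adj (field_eval t w) o\<^sub>L field_eval t w"
      using w(1) t by (simp add: field_eval_compose total_extendable A.total_cb extendable_adj field_eval_adj)
    finally show "\<exists>w\<in>field_eval t ` A.total. x o\<^sub>L adj x = adj w o\<^sub>L w" using w(1) by blast
    obtain v where v: "v \<in> B.total" "(\<lambda>b. adj (m b) o\<^sub>L m b) = (\<lambda>b. adj (v b) o\<^sub>L v b)"
      using total_sqrt(2)[OF m(2)] by blast
    have "adj x o\<^sub>L x = field_eval t (\<lambda>b. adj (v b) o\<^sub>L v b)"
      unfolding m(1) field_eval_lip(2)[OF m(2) m(2), symmetric] v(2) ..
    also have "\<dots> = adj (field_eval t v) o\<^sub>L field_eval t v"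
      using v(1) t by (simp add: field_eval_compose total_extendable B.total_cb extendable_adj field_eval_adj)
    finally show "\<exists>w\<in>field_eval t ` B.total. adj x o\<^sub>L x = adj w o\<^sub>L w" using v(1) by blast
  qed
qed

end

lemma continuous_field:
  "continuous_field_bimodule gamma
     A.algebra (\<lambda>t. op_cstar (field_eval t ` A.total)) field_eval
     B.algebra (\<lambda>t. op_cstar (field_eval t ` B.total)) field_eval
     (map_bimod total) (\<lambda>t. op_bimod (field_eval t ` total)) field_eval"
  unfolding continuous_field_bimodule_def
proof (intro conjI ballI)
  show "continuous_field_cstar gamma A.algebra (\<lambda>t. op_cstar (field_eval t ` A.total)) field_eval"
    unfolding A.algebra_eq by (rule continuous_field_star_algebra[OF A.total_field])
  show "continuous_field_cstar gamma B.algebra (\<lambda>t. op_cstar (field_eval t ` B.total)) field_eval"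
    unfolding B.algebra_eq by (rule continuous_field_star_algebra[OF B.total_field])
  show "hilbert_bimodule A.algebra B.algebra (map_bimod total)" by (rule field_hilbert_bimodule)
  show "jointly_injective gamma (carr (map_bimod total)) field_eval"
    unfolding map_bimod_simps by (rule jointly_injective_galg_module[OF total_module])
  show "CT_acts gamma (map_bimod total) (\<lambda>t. op_bimod (field_eval t ` total)) field_eval"
    by (rule CT_acts_galg_module[OF total_module]) (simp_all add: map_bimod_simps op_bimod_simps)
  show "bdd_above ((\<lambda>t. sqrt (nrm (op_cstar (field_eval t ` B.total))
      (rip (op_bimod (field_eval t ` total)) (field_eval t m) (field_eval t m)))) ` topspace gamma)"
    if "m \<in> carr (map_bimod total)" for m
  proof -
    have m: "m \<in> total" using that by (simp add: map_bimod_simps)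
    have "sqrt (nrm (op_cstar (field_eval t ` B.total))
      (rip (op_bimod (field_eval t ` total)) (field_eval t m) (field_eval t m))) = norm (field_eval t m)"
      if "t \<in> topspace gamma" for t
      using field_eval_bounded_ops[OF total_cb[OF m] _ that] total_sections[OF m]
      by (simp add: op_cstar_simps op_bimod_simps norm_adj_compose_self)
    then show ?thesis using bdd_above_field_eval[OF total_module m] by simp
  qed
  fix t :: "('p \<Rightarrow> complex) \<Rightarrow> complex" assume t: "t \<in> topspace gamma"
  show "hilbert_bimodule (op_cstar (field_eval t ` A.total)) (op_cstar (field_eval t ` B.total)) (op_bimod (field_eval t ` total))"
    by (rule fibre_hilbert_bimodule[OF t])
  show "linear_map (map_bimod total) (op_bimod (field_eval t ` total)) (field_eval t)"
    by (rule linear_map_field_eval[OF total_module]) (use t in \<open>simp_all add: map_bimod_simps op_bimod_simps\<close>)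
  show "field_eval t ` carr (map_bimod total) = carr (op_bimod (field_eval t ` total))"
    by (simp add: map_bimod_simps op_bimod_simps)
  fix m assume "m \<in> carr (map_bimod total)"
  then have m: "m \<in> total" by (simp add: map_bimod_simps)
  note ex = total_extendable[OF t]
  show "field_eval t (lact (map_bimod total) a m) = lact (op_bimod (field_eval t ` total)) (field_eval t a) (field_eval t m)"
    if "a \<in> carr A.algebra" for a
    using that m by (simp add: map_bimod_simps op_bimod_simps A.algebra_eq field_eval_compose[OF t] ex)
  show "field_eval t (ract (map_bimod total) m r) = ract (op_bimod (field_eval t ` total)) (field_eval t m) (field_eval t r)"
    if "r \<in> carr B.algebra" for r
    using that m by (simp add: map_bimod_simps op_bimod_simps B.algebra_eq field_eval_compose[OF t] ex)
  fix n assume "n \<in> carr (map_bimod total)"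
  then have n: "n \<in> total" by (simp add: map_bimod_simps)
  show "field_eval t (lip (map_bimod total) m n) = lip (op_bimod (field_eval t ` total)) (field_eval t m) (field_eval t n)"
    "field_eval t (rip (map_bimod total) m n) = rip (op_bimod (field_eval t ` total)) (field_eval t m) (field_eval t n)"
    by (simp_all add: map_bimod_simps op_bimod_simps field_eval_lip[OF t m n])
qed

end

section \<open>Application to the coarse classes\<close>

lemma algebra_family_class_A: "algebra_family (class_A :: ('x::metric_space, 'y::metric_space) coarse_class \<Rightarrow> _)"
  by (rule algebra_family.intro)
    (fact closed_class class_subset class_linear class_star_algebra class_mono class_least)+

lemma algebra_family_class_B: "algebra_family (class_B :: ('x::metric_space, 'y::metric_space) coarse_class \<Rightarrow> _)"
  by (rule algebra_family.intro)
    (fact closed_class class_subset class_linear class_star_algebra class_mono class_least)+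

lemma bimodule_family_class:
  "bimodule_family (class_A :: ('x::metric_space, 'y::metric_space) coarse_class \<Rightarrow> _) class_B class_M"
  by (intro bimodule_family.intro bimodule_family_axioms.intro algebra_family_class_A algebra_family_class_B)
    (fact closed_class class_subset class_linear class_mono class_bimodule class_bounded_join)+

text \<open>Reconciles generators indexed by metrics, as in the definitions of the fields, with
  generators indexed by classes, as in the locale.\<close>

lemma step_maps_abs_coarse_class:
  fixes C :: "('x::metric_space, 'y::metric_space) coarse_class \<Rightarrow> 'e::zero set"
  assumes "\<And>d. d \<in> union_metrics \<Longrightarrow> C (abs_coarse_class d) = R d"
  shows "{step_map (abs_coarse_class d) a | d a. d \<in> union_metrics \<and> a \<in> R d} = {step_map a s | a s. s \<in> C a}"
proof (intro equalityI subsetI; elim CollectE exE conjE)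
  fix m d a assume "m = step_map (abs_coarse_class d) a" "d \<in> union_metrics" "a \<in> R d"
  then show "m \<in> {step_map a s | a s. s \<in> C a}" using assms by blast
next
  fix m a s assume m: "m = step_map a s" "s \<in> C a"
  obtain d where "d \<in> union_metrics" "a = abs_coarse_class d" using abs_coarse_class_surj by blast
  then show "m \<in> {step_map (abs_coarse_class d) a | d a. d \<in> union_metrics \<and> a \<in> R d}" using m assms by blast
qed

theorem theorem4p8:
  assumes "uniform_discrete (UNIV :: 'x::metric_space set)" "bounded_geometry (UNIV :: 'x set)"
    and "uniform_discrete (UNIV :: 'y::metric_space set)" "bounded_geometry (UNIV :: 'y set)"
  shows "continuous_field_bimodule (gamma :: ((('x, 'y) coarse_class \<Rightarrow> complex) \<Rightarrow> complex) topology)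
           field_A fibre_A field_eval
           field_B fibre_B field_eval
           field_M fibre_M field_eval
       \<and> (\<forall>d \<in> (union_metrics :: ('x + 'y \<Rightarrow> 'x + 'y \<Rightarrow> real) set).
            carr (fibre_A (gamma_point (abs_coarse_class d))) = roe_closure (left_metric d) \<and>
            carr (fibre_B (gamma_point (abs_coarse_class d))) = roe_closure (right_metric d) \<and>
            carr (fibre_M (gamma_point (abs_coarse_class d))) = roe_closure (cross d))"
proof -
  interpret bimodule_family "class_A :: ('x, 'y) coarse_class \<Rightarrow> _" class_B class_M
    by (rule bimodule_family_class)
  have fA: "field_A = A.algebra"
    unfolding field_A_def A.algebra_def by (simp only: step_maps_abs_coarse_class[where C = class_A and R = "\<lambda>d. roe_closure (left_metric d)", OF class_abs(2)])
  have fB: "field_B = B.algebra"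
    unfolding field_B_def B.algebra_def by (simp only: step_maps_abs_coarse_class[where C = class_B and R = "\<lambda>d. roe_closure (right_metric d)", OF class_abs(3)])
  have steps: "(\<forall>d\<in>union_metrics. \<forall>s\<in>roe_closure (cross d). step_map (abs_coarse_class d) s \<in> N) \<longleftrightarrow>
      (\<forall>a :: ('x, 'y) coarse_class. \<forall>s\<in>class_M a. step_map a s \<in> N)" for N
    using abs_coarse_class_surj class_abs(1) by metis
  \<comment> \<open>\<open>Q\<close> stands for the remaining closure conditions, so that the
    equivalence can rewrite the conjunction inside \<open>field_M_carr_def\<close>.\<close>
  have sub: "linear_subspace (Cb_vec (op_vec bounded_ops)) N \<and>
      norm_closed_in (Cb_vec (op_vec bounded_ops)) (\<lambda>f. SUP b. norm (f b)) N \<and> Q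
      \<longleftrightarrow> closed_subspace cscale_op bounded_ops N \<and> Q" for N :: "(('x, 'y) coarse_class \<Rightarrow> 'x ell2 \<Rightarrow>\<^sub>L 'y ell2) set" and Q
    using closed_subspace_iff[of "Cb_vec (op_vec bounded_ops)" bounded_ops cscale_op "\<lambda>f. SUP b. norm (f b)" N]
    by (auto simp: Cb_vec_def op_vec_def cb_def closed_bounded_ops cscale_op_distrib)
  have fM: "(field_M_carr :: (('x, 'y) coarse_class \<Rightarrow> _) set) = total"
    unfolding field_M_carr_def total_eq sub steps ..
  have fib: "fibre_A = (\<lambda>t. op_cstar (field_eval t ` A.total))" "fibre_B = (\<lambda>t. op_cstar (field_eval t ` B.total))"
    "fibre_M = (\<lambda>t. op_bimod (field_eval t ` total))" "field_M = map_bimod total"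
    by (simp_all add: fun_eq_iff fibre_A_def fibre_B_def fibre_M_def field_M_def fA fB fM A.total_def B.total_def)
  show ?thesis
    unfolding fA fB fib using continuous_field
    by (simp add: op_cstar_simps op_bimod_simps A.fibre_total B.fibre_total fibre_total class_abs)
qed

end
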